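(* Let $\Gamma$ be a diffeological groupoid. There exists a diffeological space $B\Gamma$, equipped with a smoothly numerable $\Gamma$-structure $\gamma$, for which the following hold: 1. For any smoothly numerable $\Gamma$-structure $h$ on a diffeological space $X$, there is a smooth map $\eta\colon X\to B\Gamma$ such that $h=\eta^*\gamma$ (as $\Gamma$-structures). 2. If $X$ is a diffeological space and $\eta_0,\eta_1\colon X\to B\Gamma$ are smooth maps, then the $\Gamma$-structures $\eta_0^*\gamma$ and $\eta_1^*\gamma$ are smoothly, numerably concordant if and only if $\eta_0$ and $\eta_1$ are smoothly homotopic.
   Context: A diffeological space is a set with a collection of plots (maps from open subsets of Euclidean spaces) containing constant maps, local in nature, and closed under precomposition with smooth maps of Euclidean open sets; maps are smooth if they send plots to plots. The D-topology is the finest topology making all plots continuous; diffeological spaces carry the D-topology, subsets the subspace diffeology, disjoint unions the sum diffeology, and $[0,1]$ the subspace diffeology of $\mathbb R$. A diffeological groupoid is a groupoid whose morphism set is a diffeological space, whose object set carries the subspace diffeology via the unit map, and whose range, source, composition and inversion maps are smooth. For a (D-)open cover $\mathcal U=\{U_\alpha\}$ of $X$, the Čech groupoid $\check{\mathcal U}$ has morphism space $\bigsqcup_{(\alpha,\beta)}U_\alpha\cap U_\beta$, with elements $(x,\alpha,\beta)$, source $(x,\beta,\beta)$, range $(x,\alpha,\alpha)$ and composition $(x,\alpha,\beta)\cdot(x,\beta,\delta)=(x,\alpha,\delta)$. A $\Gamma$-cocycle on $X$ over $\mathcal U$ is a smooth morphism of groupoids $h\colon\check{\mathcal U}\to\Gamma$,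 i.e. smooth maps $h_{\alpha\beta}\colon U_\alpha\cap U_\beta\to\Gamma$ with $h_{\alpha\beta}h_{\beta\delta}=h_{\alpha\delta}$ on triple overlaps. Cocycles over $\mathcal U$ and $\mathcal V$ are equivalent if they are restrictions of a smooth $\Gamma$-cocycle over $\mathcal U\cup\mathcal V$; a $\Gamma$-structure is an equivalence class. The pullback of a $\Gamma$-structure along a smooth map is defined by pulling back a cover and precomposing a representing cocycle. A smooth countable partition of unity $\{\lambda_\alpha\}_{\alpha\in\mathbb N}$ on $X$ is locally finite if the family of supports $\overline{\lambda_\alpha^{-1}(0,1]}$ is locally finite, and subordinate to $\{U_\alpha\}_{\alpha\in\mathbb N}$ if $\overline{\lambda_\alpha^{-1}(0,1]}\subset U_\alpha$ for all $\alpha$. A countable open cover is smoothly numerable if it admits a subordinate, locally finite, smooth partition of unity; a $\Gamma$-structure is smoothly numerable if it is represented by a cocycle over a countable smoothly numerable open cover. Two smoothly numerable $\Gamma$-structures on $X$ are smoothly, numerably concordant if there is a smoothly numerable $\Gamma$-structure on $X\times[0,1]$ inducing them on $X\times\{0\}$ and $X\times\{1\}$. Two smooth maps $X\to Y$ are smoothly homotopic if they are the restrictions to the ends of a smooth map $X\times[0,1]\to Y$. *)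

theory Defs
  imports "HOL-Analysis.Analysis"
begin

section \<open>Smooth maps between open subsets of Euclidean spaces\<close>

text \<open>
  The dimension of the domain of a plot varies, so \<open>\<real>\<^sup>n\<close> is the library's
  \<^const>\<open>Euclidean_space\<close>, whose points are the sequences vanishing from index \<open>n\<close> on.
  A function on an open set is of class \<open>C\<^sup>k\<close> if all its iterated partial derivatives of
  order at most \<open>k\<close> exist and are continuous there. Functions are total in HOL; only the
  values on \<open>U\<close> matter below (the partial derivative at a point of the open set \<open>U\<close> does not
  see values outside \<open>U\<close>).
\<close>

definition partial_deriv :: "nat \<Rightarrow> ((nat \<Rightarrow> real) \<Rightarrow> real) \<Rightarrow> (nat \<Rightarrow> real) \<Rightarrow> real" where
  "partial_deriv i f x = deriv (\<lambda>t. f (x(i := t))) (x i)"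

primrec C_k_on :: "nat \<Rightarrow> nat \<Rightarrow> (nat \<Rightarrow> real) set \<Rightarrow> ((nat \<Rightarrow> real) \<Rightarrow> real) \<Rightarrow> bool" where
  "C_k_on 0 n U f \<longleftrightarrow> continuous_map (subtopology (Euclidean_space n) U) euclideanreal f"
| "C_k_on (Suc k) n U f \<longleftrightarrow>
     continuous_map (subtopology (Euclidean_space n) U) euclideanreal f \<and>
     (\<forall>i<n. (\<forall>x\<in>U. (\<lambda>t. f (x(i := t))) field_differentiable at (x i)) \<and>
            C_k_on k n U (partial_deriv i f))"

definition smooth_fun_on :: "nat \<Rightarrow> (nat \<Rightarrow> real) set \<Rightarrow> ((nat \<Rightarrow> real) \<Rightarrow> real) \<Rightarrow> bool" where
  "smooth_fun_on n U f \<longleftrightarrow> (\<forall>k. C_k_on k n U f)"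

definition euclidean_smooth ::
    "nat \<Rightarrow> (nat \<Rightarrow> real) set \<Rightarrow> nat \<Rightarrow> (nat \<Rightarrow> real) set \<Rightarrow> ((nat \<Rightarrow> real) \<Rightarrow> nat \<Rightarrow> real) \<Rightarrow> bool" where
  "euclidean_smooth n U m V f \<longleftrightarrow>
     openin (Euclidean_space n) U \<and> openin (Euclidean_space m) V \<and> f ` U \<subseteq> V \<and>
     (\<forall>j<m. smooth_fun_on n U (\<lambda>x. f x j))"

section \<open>Diffeological spaces\<close>

text \<open>\<open>plot X n U p\<close> reads: \<open>p\<close>, restricted to the open set \<open>U \<subseteq> \<real>\<^sup>n\<close>, is a plot of \<open>X\<close>.\<close>

record 'a diffeology =
  pts :: "'a set"
  plot :: "nat \<Rightarrow> (nat \<Rightarrow> real) set \<Rightarrow> ((nat \<Rightarrow> real) \<Rightarrow> 'a) \<Rightarrow> bool"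

text \<open>
  The second axiom says that being a plot depends only on the values on \<open>U\<close>. It is needed
  because plots are represented by total functions.
\<close>

definition diffeological_space :: "'a diffeology \<Rightarrow> bool" where
  "diffeological_space X \<longleftrightarrow>
     (\<forall>n U p. plot X n U p \<longrightarrow> openin (Euclidean_space n) U \<and> p ` U \<subseteq> pts X) \<and>
     (\<forall>n U p q. plot X n U p \<longrightarrow> (\<forall>u\<in>U. p u = q u) \<longrightarrow> plot X n U q) \<and>
     (\<forall>n U x. openin (Euclidean_space n) U \<longrightarrow> x \<in> pts X \<longrightarrow> plot X n U (\<lambda>_. x)) \<and>
     (\<forall>n U p. openin (Euclidean_space n) U \<longrightarrow>
        (\<forall>u\<in>U. \<exists>V. openin (Euclidean_space n) V \<and> u \<in> V \<and> V \<subseteq> U \<and> plot X n V p) \<longrightarrow>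
        plot X n U p) \<and>
     (\<forall>n U m V f p. plot X m V p \<longrightarrow> euclidean_smooth n U m V f \<longrightarrow> plot X n U (p \<circ> f))"

definition smooth_map :: "'a diffeology \<Rightarrow> 'b diffeology \<Rightarrow> ('a \<Rightarrow> 'b) \<Rightarrow> bool" where
  "smooth_map X Y f \<longleftrightarrow>
     f ` pts X \<subseteq> pts Y \<and> (\<forall>n U p. plot X n U p \<longrightarrow> plot Y n U (f \<circ> p))"

definition D_topology :: "'a diffeology \<Rightarrow> 'a topology" where
  "D_topology X = topology (\<lambda>A. A \<subseteq> pts X \<and>
     (\<forall>n U p. plot X n U p \<longrightarrow> openin (Euclidean_space n) {u \<in> U. p u \<in> A}))"

lemma openin_D_topology:
  "openin (D_topology X) A \<longleftrightarrow> A \<subseteq> pts X \<and>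
     (\<forall>n U p. plot X n U p \<longrightarrow> openin (Euclidean_space n) {u \<in> U. p u \<in> A})"
proof -
  have "istopology (\<lambda>A. A \<subseteq> pts X \<and>
     (\<forall>n U p. plot X n U p \<longrightarrow> openin (Euclidean_space n) {u \<in> U. p u \<in> A}))" (is "istopology ?L")
    unfolding istopology_def
  proof (intro conjI allI impI)
    fix n U p assume "plot X n U p"
    fix S T assume "?L S" "?L T"
    then have "openin (Euclidean_space n) ({u \<in> U. p u \<in> S} \<inter> {u \<in> U. p u \<in> T})"
      using \<open>plot X n U p\<close> by blast
    moreover have "{u \<in> U. p u \<in> S} \<inter> {u \<in> U. p u \<in> T} = {u \<in> U. p u \<in> S \<inter> T}"
      by auto
    ultimately show "openin (Euclidean_space n) {u \<in> U. p u \<in> S \<inter> T}"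
      by simp
  next
    fix n U p K assume "plot X n U p" "\<forall>A\<in>K. ?L A"
    then have "openin (Euclidean_space n) (\<Union>A\<in>K. {u \<in> U. p u \<in> A})"
      by (intro openin_Union) auto
    moreover have "(\<Union>A\<in>K. {u \<in> U. p u \<in> A}) = {u \<in> U. p u \<in> \<Union> K}"
      by auto
    ultimately show "openin (Euclidean_space n) {u \<in> U. p u \<in> \<Union> K}"
      by simp
  qed auto
  then show ?thesis
    unfolding D_topology_def by (simp add: topology_inverse')
qed

definition subspace_diffeology :: "'a diffeology \<Rightarrow> 'a set \<Rightarrow> 'a diffeology" where
  "subspace_diffeology X A =
     \<lparr>pts = pts X \<inter> A, plot = (\<lambda>n U p. plot X n U p \<and> p ` U \<subseteq> A)\<rparr>"

definition prod_diffeology :: "'a diffeology \<Rightarrow> 'b diffeology \<Rightarrow> ('a \<times> 'b) diffeology" where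
  "prod_diffeology X Y =
     \<lparr>pts = pts X \<times> pts Y, plot = (\<lambda>n U p. plot X n U (fst \<circ> p) \<and> plot Y n U (snd \<circ> p))\<rparr>"

text \<open>Plots of a disjoint union are the maps that locally are plots of a single summand.\<close>

definition sum_diffeology :: "('k \<Rightarrow> 'a diffeology) \<Rightarrow> ('a \<times> 'k) diffeology" where
  "sum_diffeology F =
     \<lparr>pts = {(x, k). x \<in> pts (F k)},
      plot = (\<lambda>n U p. openin (Euclidean_space n) U \<and>
        (\<forall>u\<in>U. \<exists>V k. openin (Euclidean_space n) V \<and> u \<in> V \<and> V \<subseteq> U \<and>
           (\<forall>v\<in>V. snd (p v) = k) \<and> plot (F k) n V (fst \<circ> p)))\<rparr>"

definition real_diffeology :: "real diffeology" where
  "real_diffeology =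
     \<lparr>pts = UNIV, plot = (\<lambda>n U p. openin (Euclidean_space n) U \<and> smooth_fun_on n U p)\<rparr>"

definition unit_interval :: "real diffeology" where
  "unit_interval = subspace_diffeology real_diffeology {0..1}"

definition smoothly_homotopic ::
    "'a diffeology \<Rightarrow> 'b diffeology \<Rightarrow> ('a \<Rightarrow> 'b) \<Rightarrow> ('a \<Rightarrow> 'b) \<Rightarrow> bool" where
  "smoothly_homotopic X Y f g \<longleftrightarrow>
     (\<exists>H. smooth_map (prod_diffeology X unit_interval) Y H \<and>
          (\<forall>x\<in>pts X. H (x, 0) = f x \<and> H (x, 1) = g x))"

section \<open>Diffeological groupoids\<close>

text \<open>
  A groupoid is given by its arrows; objects are identified with their units, so that the
  subspace diffeology on the object set via the unit map is the one induced from the arrows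
  and range and source take values in the arrows. The product \<open>gcomp G g h\<close> is meaningful
  when \<open>src G g = rng G h\<close>.
\<close>

record 'g groupoid =
  arr :: "'g diffeology"
  rng :: "'g \<Rightarrow> 'g"
  src :: "'g \<Rightarrow> 'g"
  gcomp :: "'g \<Rightarrow> 'g \<Rightarrow> 'g"
  ginv :: "'g \<Rightarrow> 'g"

definition is_groupoid :: "'g groupoid \<Rightarrow> bool" where
  "is_groupoid G \<longleftrightarrow>
     (\<forall>g\<in>pts (arr G). rng G g \<in> pts (arr G) \<and> src G g \<in> pts (arr G) \<and> ginv G g \<in> pts (arr G)) \<and>
     (\<forall>g\<in>pts (arr G). src G (src G g) = src G g \<and> rng G (src G g) = src G g \<and>
                      src G (rng G g) = rng G g \<and> rng G (rng G g) = rng G g) \<and>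
     (\<forall>g\<in>pts (arr G). \<forall>h\<in>pts (arr G). src G g = rng G h \<longrightarrow>
        gcomp G g h \<in> pts (arr G) \<and> src G (gcomp G g h) = src G h \<and>
        rng G (gcomp G g h) = rng G g) \<and>
     (\<forall>g\<in>pts (arr G). \<forall>h\<in>pts (arr G). \<forall>k\<in>pts (arr G).
        src G g = rng G h \<longrightarrow> src G h = rng G k \<longrightarrow>
        gcomp G (gcomp G g h) k = gcomp G g (gcomp G h k)) \<and>
     (\<forall>g\<in>pts (arr G). gcomp G (rng G g) g = g \<and> gcomp G g (src G g) = g) \<and>
     (\<forall>g\<in>pts (arr G). src G (ginv G g) = rng G g \<and> rng G (ginv G g) = src G g \<and>
        gcomp G g (ginv G g) = rng G g \<and> gcomp G (ginv G g) g = src G g)"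

definition composable_pairs :: "'g groupoid \<Rightarrow> ('g \<times> 'g) diffeology" where
  "composable_pairs G =
     subspace_diffeology (prod_diffeology (arr G) (arr G)) {(g, h). src G g = rng G h}"

definition diffeological_groupoid :: "'g groupoid \<Rightarrow> bool" where
  "diffeological_groupoid G \<longleftrightarrow>
     is_groupoid G \<and> diffeological_space (arr G) \<and>
     smooth_map (arr G) (arr G) (rng G) \<and> smooth_map (arr G) (arr G) (src G) \<and>
     smooth_map (composable_pairs G) (arr G) (\<lambda>(g, h). gcomp G g h) \<and>
     smooth_map (arr G) (arr G) (ginv G)"

definition smooth_groupoid_morphism :: "'g groupoid \<Rightarrow> 'h groupoid \<Rightarrow> ('g \<Rightarrow> 'h) \<Rightarrow> bool" where
  "smooth_groupoid_morphism G H f \<longleftrightarrow>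
     smooth_map (arr G) (arr H) f \<and>
     (\<forall>g\<in>pts (arr G). f (rng G g) = rng H (f g) \<and> f (src G g) = src H (f g)) \<and>
     (\<forall>g\<in>pts (arr G). \<forall>h\<in>pts (arr G). src G g = rng G h \<longrightarrow>
        f (gcomp G g h) = gcomp H (f g) (f h))"

section \<open>Cocycles and \<open>\<Gamma>\<close>-structures\<close>

text \<open>
  Covers are indexed families, the index set being a whole type (families with a smaller index
  set are padded with empty sets). The union of two covers is the family over the disjoint
  union of the index types.
\<close>

definition D_open_cover :: "'x diffeology \<Rightarrow> ('i \<Rightarrow> 'x set) \<Rightarrow> bool" where
  "D_open_cover X U \<longleftrightarrow> (\<forall>i. openin (D_topology X) (U i)) \<and> (\<Union>i. U i) = pts X"

definition cech_groupoid :: "'x diffeology \<Rightarrow> ('i \<Rightarrow> 'x set) \<Rightarrow> ('x \<times> 'i \<times> 'i) groupoid" where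
  "cech_groupoid X U =
     \<lparr>arr = sum_diffeology (\<lambda>(i, j). subspace_diffeology X (U i \<inter> U j)),
      rng = (\<lambda>(x, i, j). (x, i, i)),
      src = (\<lambda>(x, i, j). (x, j, j)),
      gcomp = (\<lambda>(x, i, j) (y, k, l). (x, i, l)),
      ginv = (\<lambda>(x, i, j). (x, j, i))\<rparr>"

type_synonym ('i, 'x, 'g) cocycle = "('i \<Rightarrow> 'x set) \<times> ('x \<times> 'i \<times> 'i \<Rightarrow> 'g)"

definition is_cocycle :: "'x diffeology \<Rightarrow> 'g groupoid \<Rightarrow> ('i, 'x, 'g) cocycle \<Rightarrow> bool" where
  "is_cocycle X \<Gamma> c \<longleftrightarrow>
     D_open_cover X (fst c) \<and> smooth_groupoid_morphism (cech_groupoid X (fst c)) \<Gamma> (snd c)"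

definition equivalent_cocycles ::
    "'x diffeology \<Rightarrow> 'g groupoid \<Rightarrow> ('i, 'x, 'g) cocycle \<Rightarrow> ('j, 'x, 'g) cocycle \<Rightarrow> bool" where
  "equivalent_cocycles X \<Gamma> c d \<longleftrightarrow>
     is_cocycle X \<Gamma> c \<and> is_cocycle X \<Gamma> d \<and>
     (\<exists>k. is_cocycle X \<Gamma> (case_sum (fst c) (fst d), k) \<and>
        (\<forall>i j. \<forall>x \<in> fst c i \<inter> fst c j. k (x, Inl i, Inl j) = snd c (x, i, j)) \<and>
        (\<forall>i j. \<forall>x \<in> fst d i \<inter> fst d j. k (x, Inr i, Inr j) = snd d (x, i, j)))"

definition cocycle_rel ::
    "'x diffeology \<Rightarrow> 'g groupoid \<Rightarrow> (('i, 'x, 'g) cocycle \<times> ('i, 'x, 'g) cocycle) set" where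
  "cocycle_rel X \<Gamma> = {(c, d). equivalent_cocycles X \<Gamma> c d}"

text \<open>
  An equivalence class needs a fixed index type. The structures considered later are smoothly
  numerable, hence represented over covers indexed by \<open>\<nat>\<close>, so they are taken with index type
  \<^typ>\<open>nat\<close>: intersecting a class of cocycles over arbitrary covers with the cocycles over
  \<open>\<nat>\<close>-indexed covers loses nothing when that intersection is nonempty.
\<close>

type_synonym ('x, 'g) gamma_structure = "(nat, 'x, 'g) cocycle set"

definition gamma_structures :: "'x diffeology \<Rightarrow> 'g groupoid \<Rightarrow> ('x, 'g) gamma_structure set" where
  "gamma_structures X \<Gamma> = {c. is_cocycle X \<Gamma> c} // cocycle_rel X \<Gamma>"

definition pullback_cocycle ::
    "'x diffeology \<Rightarrow> ('x \<Rightarrow> 'y) \<Rightarrow> ('i, 'y, 'g) cocycle \<Rightarrow> ('i, 'x, 'g) cocycle" where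
  "pullback_cocycle X f c =
     ((\<lambda>i. {x \<in> pts X. f x \<in> fst c i}), (\<lambda>(x, i, j). snd c (f x, i, j)))"

text \<open>
  The class of the pullback of any representative; the union is the usual way to define a
  function on a quotient.
\<close>

definition pullback_structure ::
    "'x diffeology \<Rightarrow> 'g groupoid \<Rightarrow> ('x \<Rightarrow> 'y) \<Rightarrow> ('y, 'g) gamma_structure \<Rightarrow> ('x, 'g) gamma_structure"
  where
  "pullback_structure X \<Gamma> f S = (\<Union>c\<in>S. cocycle_rel X \<Gamma> `` {pullback_cocycle X f c})"

section \<open>Numerability and concordance\<close>

definition supp_on :: "'x diffeology \<Rightarrow> ('x \<Rightarrow> real) \<Rightarrow> 'x set" where
  "supp_on X l = D_topology X closure_of {x \<in> pts X. l x \<in> {0<..1}}"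

definition smooth_partition_of_unity :: "'x diffeology \<Rightarrow> (nat \<Rightarrow> 'x \<Rightarrow> real) \<Rightarrow> bool" where
  "smooth_partition_of_unity X l \<longleftrightarrow>
     (\<forall>i. smooth_map X unit_interval (l i)) \<and> (\<forall>x\<in>pts X. (\<lambda>i. l i x) sums 1)"

text \<open>Local finiteness is that of the indexed family, not of the set of supports.\<close>

definition locally_finite_supports :: "'x diffeology \<Rightarrow> (nat \<Rightarrow> 'x \<Rightarrow> real) \<Rightarrow> bool" where
  "locally_finite_supports X l \<longleftrightarrow>
     (\<forall>x\<in>pts X. \<exists>V. openin (D_topology X) V \<and> x \<in> V \<and> finite {i. supp_on X (l i) \<inter> V \<noteq> {}})"

definition smoothly_numerable_cover :: "'x diffeology \<Rightarrow> (nat \<Rightarrow> 'x set) \<Rightarrow> bool" where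
  "smoothly_numerable_cover X U \<longleftrightarrow>
     D_open_cover X U \<and>
     (\<exists>l. smooth_partition_of_unity X l \<and> locally_finite_supports X l \<and>
          (\<forall>i. supp_on X (l i) \<subseteq> U i))"

definition smoothly_numerable ::
    "'x diffeology \<Rightarrow> 'g groupoid \<Rightarrow> ('x, 'g) gamma_structure \<Rightarrow> bool" where
  "smoothly_numerable X \<Gamma> S \<longleftrightarrow>
     S \<in> gamma_structures X \<Gamma> \<and> (\<exists>c\<in>S. smoothly_numerable_cover X (fst c))"

definition smoothly_numerably_concordant ::
    "'x diffeology \<Rightarrow> 'g groupoid \<Rightarrow> ('x, 'g) gamma_structure \<Rightarrow> ('x, 'g) gamma_structure \<Rightarrow> bool" where
  "smoothly_numerably_concordant X \<Gamma> S0 S1 \<longleftrightarrow>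
     smoothly_numerable X \<Gamma> S0 \<and> smoothly_numerable X \<Gamma> S1 \<and>
     (\<exists>S. smoothly_numerable (prod_diffeology X unit_interval) \<Gamma> S \<and>
          pullback_structure X \<Gamma> (\<lambda>x. (x, 0)) S = S0 \<and>
          pullback_structure X \<Gamma> (\<lambda>x. (x, 1)) S = S1)"

section \<open>Classifying spaces\<close>

text \<open>
  \<open>(B, \<gamma>)\<close> classifies smoothly numerable \<open>\<Gamma>\<close>-structures on all diffeological spaces whose
  points have type \<open>'x\<close>; the first argument only names that type.
\<close>

definition classifies ::
    "'x itself \<Rightarrow> 'g groupoid \<Rightarrow> 'b diffeology \<Rightarrow> ('b, 'g) gamma_structure \<Rightarrow> bool" where
  "classifies T \<Gamma> B \<gamma> \<longleftrightarrow>
     diffeological_space B \<and> smoothly_numerable B \<Gamma> \<gamma> \<and>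
     (\<forall>(X :: 'x diffeology) h. diffeological_space X \<longrightarrow> smoothly_numerable X \<Gamma> h \<longrightarrow>
        (\<exists>\<eta>. smooth_map X B \<eta> \<and> h = pullback_structure X \<Gamma> \<eta> \<gamma>)) \<and>
     (\<forall>(X :: 'x diffeology) \<eta>0 \<eta>1. diffeological_space X \<longrightarrow>
        smooth_map X B \<eta>0 \<longrightarrow> smooth_map X B \<eta>1 \<longrightarrow>
        (smoothly_numerably_concordant X \<Gamma>
           (pullback_structure X \<Gamma> \<eta>0 \<gamma>) (pullback_structure X \<Gamma> \<eta>1 \<gamma>) \<longleftrightarrow>
         smoothly_homotopic X B \<eta>0 \<eta>1))"

text \<open>
  An existential quantifier in HOL ranges over a fixed type. The points of the Milnor--Haefliger
  infinite join modulo \<open>\<Gamma>\<close> are sets of sequences of pairs (barycentric coordinate, arrow), so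
  this type has room for \<open>B\<Gamma>\<close>.

  Nor can a HOL formula say "there is \<open>(B, \<gamma>)\<close> such that for all types \<open>'x\<close>"; the statement
  "there is \<open>(B, \<gamma>)\<close> with \<open>classifies TYPE('x) \<Gamma> B \<gamma>\<close>" would let \<open>B\<close> depend on \<open>'x\<close>.
  To keep \<open>B\<Gamma>\<close> independent of the spaces being classified one asserts that some \<open>(B, \<gamma>)\<close>
  classifies for the type of its own points, and that any such pair classifies for every \<open>'x\<close>.
\<close>

type_synonym 'g classifying_point = "(nat \<Rightarrow> real \<times> 'g) set"

end

theory Submission
  imports Defs
begin

text \<open>
  The classifying space is a form of the Milnor--Haefliger join. A point of \<open>B\<Gamma>\<close> is a sequence of
  real weights, at least one of them larger than \<open>1\<close>, together with a \<open>\<Gamma>\<close>-cocycle on the set of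
  indices of positive weight (the cocycle \<open>h i j = inverse (g i) * g j\<close> of a sequence of arrows
  \<open>g\<close> is what remains of it modulo left translation). A map to the set of such points is declared
  to be a plot if its weights are smooth and its arrows are smooth wherever they are defined. So a
  smooth map from \<open>X\<close> to \<open>B\<Gamma>\<close> is the same as a sequence of smooth weights on \<open>X\<close> and a cocycle
  over the cover of \<open>X\<close> by their positivity sets, and the tautological cocycle on \<open>B\<Gamma>\<close> pulls back
  to this cocycle (\<open>smooth_map_classifying_map\<close>, \<open>pullback_classifying_map\<close>).

  The threshold \<open>1\<close> replaces the normalization of barycentric coordinates. The closed sets where a
  weight is at least \<open>1\<close> lie in the open sets where it is positive and still cover, which leaves
  room to build a subordinate, locally finite partition of unity out of the weights alone
  (\<open>smoothly_numerable_cover_positivity_sets\<close>). Conversely, rescaling the members of a partition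
  of unity by the factors \<open>2 ^ (i + 2)\<close> gives such weights. Hence every smoothly numerable
  structure is a pullback of the universal one, and every pullback of the universal one is smoothly
  numerable.

  For the second assertion, a homotopy pulls the universal structure back to a concordance. In the
  other direction a concordance is itself classified by a map on \<open>X \<times> [0, 1]\<close>, so it is enough
  that two maps \<open>f\<close> and \<open>g\<close> with the same pullback are homotopic. First \<open>f\<close> is moved to the odd
  coordinates and \<open>g\<close> to the even ones (\<open>spread_homotopic\<close>); then no coordinate is used twice, the
  equivalence of the two pullbacks is exactly a cocycle on all coordinates together, and one fades
  the first map out after fading the second one in (\<open>spread_join_homotopic\<close>).

  That any pair classifying for one type of spaces classifies for all types is the usual uniqueness
  up to homotopy equivalence: the pair is compared with \<open>B\<Gamma>\<close> by classifying maps in both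
  directions (\<open>classifies_transfer\<close>).

  The foundations are of two kinds. On the analytic side, the class of smooth functions is shown to
  be closed under composition and to contain a flat function. On the algebraic side, all
  manipulations of cocycles (pullback, refinement, renaming of indices) are instances of a single
  operation \<open>relabel\<close>, and equivalence of cocycles is shown to be transitive.
\<close>

section \<open>Calculus of smooth functions\<close>

declare C_k_on.simps(2) [simp del]

lemma Euclidean_space_eq_top_of_set: "Euclidean_space n = top_of_set {x. \<forall>i\<ge>n. x i = 0}"
  by (simp add: Euclidean_space_def euclidean_product_topology)

lemma continuous_map_Euclidean_subspace:
  assumes "openin (Euclidean_space n) U"
  shows "continuous_map (subtopology (Euclidean_space n) U) euclideanreal f \<longleftrightarrow> continuous_on U f"
proof -
  have "{x. \<forall>i\<ge>n. x i = 0} \<inter> U = U"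
    using openin_subset[OF assms] by (auto simp: topspace_Euclidean_space)
  then show ?thesis
    by (simp add: Euclidean_space_eq_top_of_set subtopology_subtopology)
qed

lemma openin_Euclidean_fun_upd:
  assumes "openin (Euclidean_space n) U" "i < n" "x \<in> U"
  shows "open {t. x(i := t) \<in> U}"
proof -
  obtain T where T: "open T" "U = {x. \<forall>i\<ge>n. x i = 0} \<inter> T"
    using assms(1) by (auto simp: Euclidean_space_eq_top_of_set openin_open)
  have x: "\<forall>j\<ge>n. x j = 0" using T assms(3) by auto
  have "continuous_on UNIV (\<lambda>t. x(i := t))"
    by (rule continuous_on_coordinatewise_then_product, rename_tac j, case_tac "j = i")
      (auto intro: continuous_intros)
  then have "open ((\<lambda>t. x(i := t)) -` T)"
    using T(1) by (simp add: open_vimage)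
  moreover have "(\<lambda>t. x(i := t)) -` T = {t. x(i := t) \<in> U}"
    using x assms(2) by (auto simp: T(2))
  ultimately show ?thesis by simp
qed

text \<open>
  Boxes contain, with two points that differ in one coordinate, the segment between them; the mean
  value theorem will be applied along such segments.
\<close>

lemma openin_Euclidean_contains_box:
  assumes "openin (Euclidean_space n) U" "x \<in> U"
  obtains e where "e > 0"
    "\<And>y. \<forall>i\<ge>n. y i = 0 \<Longrightarrow> \<forall>i<n. \<bar>y i - x i\<bar> < e \<Longrightarrow> y \<in> U"
proof -
  obtain T where T: "openin (powertop_real UNIV) T" "U = T \<inter> {x. \<forall>i\<ge>n. x i = 0}"
    using assms(1) by (auto simp: Euclidean_space_def openin_subtopology)
  then obtain W where W: "\<forall>i. openin euclideanreal (W i)" "x \<in> Pi\<^sub>E UNIV W" "Pi\<^sub>E UNIV W \<subseteq> T"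
    using assms(2) by (auto simp: openin_product_topology_alt)
  have "\<exists>e>0. ball (x i) e \<subseteq> W i" for i
    using W(1)[rule_format, of i] PiE_mem[OF W(2), of i]
    by (simp add: open_contains_ball open_openin[symmetric])
  then obtain d where d: "\<And>i. d i > 0" "\<And>i. ball (x i) (d i) \<subseteq> W i" by metis
  define e where "e = Min (insert 1 (d ` {..<n}))"
  have e0: "e > 0" using d by (auto simp: e_def)
  have ed: "e \<le> d i" if "i < n" for i using that by (simp add: e_def)
  have x0: "\<forall>i\<ge>n. x i = 0" using T(2) assms(2) by auto
  show ?thesis
  proof
    fix y assume y: "\<forall>i\<ge>n. y i = 0" "\<forall>i<n. \<bar>y i - x i\<bar> < e"
    have "y i \<in> W i" for i
    proof (cases "i < n")
      case True
      have "\<bar>y i - x i\<bar> < d i" using y(2) ed[OF True] True by (meson less_le_trans)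
      then have "y i \<in> ball (x i) (d i)"
        by (simp add: dist_real_def abs_minus_commute)
      then show ?thesis using d by blast
    next
      case False
      then have "y i = x i" using y x0 by simp
      then show ?thesis using W(2) by (simp add: PiE_mem)
    qed
    then have "y \<in> T" using W(3) by auto
    then show "y \<in> U" using y(1) T(2) by auto
  qed (fact e0)
qed

lemma C_k_on_continuous:
  assumes "openin (Euclidean_space n) U" "C_k_on k n U f"
  shows "continuous_on U f"
  using assms by (cases k) (auto simp: C_k_on.simps(2) continuous_map_Euclidean_subspace)

lemma C_k_on_Suc_iff:
  assumes "openin (Euclidean_space n) U"
  shows "C_k_on (Suc k) n U f \<longleftrightarrow> continuous_on U f \<and>
     (\<forall>i<n. (\<forall>x\<in>U. ((\<lambda>t. f (x(i := t))) has_real_derivative partial_deriv i f x) (at (x i))) \<and>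
            C_k_on k n U (partial_deriv i f))"
  using assms
  by (auto simp: C_k_on.simps(2) continuous_map_Euclidean_subspace partial_deriv_def
      DERIV_deriv_iff_field_differentiable field_differentiable_def)

lemma C_k_on_Suc_D: "C_k_on (Suc k) n U f \<Longrightarrow> C_k_on k n U f"
proof (induction k arbitrary: f)
  case (Suc k)
  then show ?case by (metis C_k_on.simps(2))
qed (simp add: C_k_on.simps(2))

lemma eventually_fun_upd_in:
  assumes "openin (Euclidean_space n) U" "i < n" "x \<in> U"
  shows "\<forall>\<^sub>F t in nhds (x i). x(i := t) \<in> U"
  using eventually_nhds_in_open[OF openin_Euclidean_fun_upd[OF assms], of "x i"] assms(3) by simp

lemma partial_deriv_cong:
  assumes "openin (Euclidean_space n) U" "i < n" "x \<in> U" "\<And>x. x \<in> U \<Longrightarrow> f x = g x"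
  shows "partial_deriv i f x = partial_deriv i g x"
  unfolding partial_deriv_def
  by (rule deriv_cong_ev) (use eventually_fun_upd_in[OF assms(1-3)] assms(4) in \<open>auto elim: eventually_mono\<close>)

lemma C_k_on_cong:
  assumes U: "openin (Euclidean_space n) U"
  shows "C_k_on k n U f \<Longrightarrow> (\<And>x. x \<in> U \<Longrightarrow> f x = g x) \<Longrightarrow> C_k_on k n U g"
proof (induction k arbitrary: f g)
  case 0
  then show ?case using U
    by (simp add: continuous_map_Euclidean_subspace)
next
  case (Suc k)
  have c: "continuous_on U g"
    using C_k_on_continuous[OF U Suc.prems(1)] Suc.prems(2) by (metis continuous_on_cong)
  have pd: "partial_deriv i f x = partial_deriv i g x" if "i < n" "x \<in> U" for i x
    using partial_deriv_cong[OF U that Suc.prems(2)] .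
  have "((\<lambda>t. g (x(i := t))) has_real_derivative partial_deriv i g x) (at (x i))"
    if "i < n" "x \<in> U" for i x
  proof -
    have "((\<lambda>t. f (x(i := t))) has_real_derivative partial_deriv i f x) (at (x i))"
      using Suc.prems(1) that C_k_on_Suc_iff[OF U] by blast
    moreover have "\<forall>\<^sub>F t in nhds (x i). f (x(i := t)) = g (x(i := t))"
      using eventually_fun_upd_in[OF U that] by (rule eventually_mono) (rule Suc.prems(2))
    ultimately show ?thesis
      using DERIV_cong_ev[of "x i" "x i" "\<lambda>t. f (x(i := t))" "\<lambda>t. g (x(i := t))"] pd[OF that] by auto
  qed
  moreover have "C_k_on k n U (partial_deriv i g)" if "i < n" for i
    using Suc.IH[of "partial_deriv i f" "partial_deriv i g"] Suc.prems(1) that pd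
    using C_k_on.simps(2) by blast
  ultimately show ?case using c by (simp only: C_k_on_Suc_iff[OF U]) blast
qed

text \<open>
  The recursive clause speaks about \<^const>\<open>partial_deriv\<close>; this rule lets a formula \<open>D\<close> for the
  partial derivatives stand in its place.
\<close>

lemma C_k_on_SucI:
  assumes U: "openin (Euclidean_space n) U" and "continuous_on U f"
    and d: "\<And>i x. i < n \<Longrightarrow> x \<in> U \<Longrightarrow> ((\<lambda>t. f (x(i := t))) has_real_derivative D i x) (at (x i))"
    and "\<And>i. i < n \<Longrightarrow> C_k_on k n U (D i)"
  shows "C_k_on (Suc k) n U f"
proof -
  have e: "partial_deriv i f x = D i x" if "i < n" "x \<in> U" for i x
    using d[OF that] by (simp add: partial_deriv_def DERIV_imp_deriv)
  have "C_k_on k n U (partial_deriv i f)" if "i < n" for i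
    by (rule C_k_on_cong[OF U assms(4)[OF that]]) (simp add: e that)
  then show ?thesis using assms e by (simp only: C_k_on_Suc_iff[OF U]) auto
qed

lemma C_k_on_partial:
  assumes "openin (Euclidean_space n) U" "C_k_on (Suc k) n U f" "i < n"
  shows "x \<in> U \<Longrightarrow> ((\<lambda>t. f (x(i := t))) has_real_derivative partial_deriv i f x) (at (x i))"
    and "C_k_on k n U (partial_deriv i f)"
  using assms C_k_on_Suc_iff by blast+

lemma C_k_on_subset:
  assumes "openin (Euclidean_space n) V" "V \<subseteq> U" "openin (Euclidean_space n) U"
  shows "C_k_on k n U f \<Longrightarrow> C_k_on k n V f"
proof (induction k arbitrary: f)
  case 0
  then show ?case using assms by (auto simp: continuous_map_Euclidean_subspace intro: continuous_on_subset)
next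
  case (Suc k)
  show ?case
    by (rule C_k_on_SucI[OF assms(1), where D="\<lambda>i. partial_deriv i f"])
      (use Suc assms C_k_on_partial[OF assms(3) Suc.prems] C_k_on_continuous[OF assms(3) Suc.prems] in
        \<open>auto intro: continuous_on_subset\<close>)
qed

lemma continuous_on_locally:
  assumes U: "openin (Euclidean_space n) U"
    and loc: "\<And>u. u \<in> U \<Longrightarrow> \<exists>V. openin (Euclidean_space n) V \<and> u \<in> V \<and> V \<subseteq> U \<and> continuous_on V f"
  shows "continuous_on U f"
  unfolding continuous_on_eq_continuous_within
proof
  fix u assume "u \<in> U"
  then obtain V where V: "openin (Euclidean_space n) V" "u \<in> V" "V \<subseteq> U" "continuous_on V f"
    using loc by blast
  then obtain T where T: "open T" "V = {x. \<forall>i\<ge>n. x i = 0} \<inter> T"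
    by (auto simp: Euclidean_space_eq_top_of_set openin_open)
  have "U \<inter> T - {u} = V \<inter> T - {u}"
    using V(3) T(2) openin_subset[OF U] by (auto simp: topspace_Euclidean_space)
  then have "at u within U = at u within V"
    using T V(2) by (intro at_within_nhd[of u T]) auto
  then show "continuous (at u within U) f"
    using V by (simp add: continuous_on_eq_continuous_within)
qed

lemma C_k_on_locally:
  assumes U: "openin (Euclidean_space n) U"
  shows "(\<And>u. u \<in> U \<Longrightarrow> \<exists>V. openin (Euclidean_space n) V \<and> u \<in> V \<and> V \<subseteq> U \<and> C_k_on k n V f)
    \<Longrightarrow> C_k_on k n U f"
proof (induction k arbitrary: f)
  case 0
  then show ?case
    using continuous_on_locally[OF U, of f] by (simp add: U continuous_map_Euclidean_subspace)
      (metis continuous_map_Euclidean_subspace)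
next
  case (Suc k)
  show ?case
  proof (rule C_k_on_SucI[OF U, where D="\<lambda>i. partial_deriv i f"])
    show "continuous_on U f"
      by (rule continuous_on_locally[OF U]) (meson Suc.prems C_k_on_continuous)
    show "C_k_on k n U (partial_deriv i f)" if "i < n" for i
      by (rule Suc.IH) (meson Suc.prems C_k_on_partial(2) that)
    show "((\<lambda>t. f (x(i := t))) has_real_derivative partial_deriv i f x) (at (x i))"
      if "i < n" "x \<in> U" for i x
      by (metis Suc.prems C_k_on_partial(1) that)
  qed
qed

lemma C_k_on_const: "openin (Euclidean_space n) U \<Longrightarrow> C_k_on k n U (\<lambda>_. c)"
proof (induction k arbitrary: c)
  case (Suc k)
  show ?case
    by (rule C_k_on_SucI[where D="\<lambda>_ _. 0"]) (use Suc in auto)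
qed (simp add: continuous_map_Euclidean_subspace)

lemma C_k_on_coordinate:
  assumes "openin (Euclidean_space n) U"
  shows "C_k_on k n U (\<lambda>x. x j)"
proof (cases k)
  case 0
  then show ?thesis using assms continuous_on_subset[OF continuous_on_product_coordinates]
    by (simp add: continuous_map_Euclidean_subspace)
next
  case (Suc m)
  have "C_k_on (Suc m) n U (\<lambda>x. x j)"
  proof (rule C_k_on_SucI[OF assms, where D="\<lambda>i x. if i = j then 1 else 0"])
    show "continuous_on U (\<lambda>x. x j)"
      by (rule continuous_on_subset[OF continuous_on_product_coordinates]) simp
  qed (auto simp: C_k_on_const[OF assms] intro!: derivative_eq_intros)
  then show ?thesis by (simp add: Suc)
qed

lemma C_k_on_add:
  assumes U: "openin (Euclidean_space n) U"
  shows "C_k_on k n U f \<Longrightarrow> C_k_on k n U g \<Longrightarrow> C_k_on k n U (\<lambda>x. f x + g x)"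
proof (induction k arbitrary: f g)
  case 0
  then show ?case using U by (auto simp: continuous_map_Euclidean_subspace intro: continuous_intros)
next
  case (Suc k)
  show ?case
  proof (rule C_k_on_SucI[OF U, where D="\<lambda>i x. partial_deriv i f x + partial_deriv i g x"])
    show "continuous_on U (\<lambda>x. f x + g x)"
      using Suc.prems C_k_on_continuous[OF U] by (auto intro!: continuous_intros)
    fix i assume i: "i < n"
    show "((\<lambda>t. f (x(i := t)) + g (x(i := t))) has_real_derivative
        partial_deriv i f x + partial_deriv i g x) (at (x i))" if x: "x \<in> U" for x
      using DERIV_add[OF C_k_on_partial(1)[OF U Suc.prems(1) i x] C_k_on_partial(1)[OF U Suc.prems(2) i x]] .
    show "C_k_on k n U (\<lambda>x. partial_deriv i f x + partial_deriv i g x)"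
      by (intro Suc.IH C_k_on_partial(2)[OF U _ i] Suc.prems)
  qed
qed

lemma C_k_on_mult:
  assumes U: "openin (Euclidean_space n) U"
  shows "C_k_on k n U f \<Longrightarrow> C_k_on k n U g \<Longrightarrow> C_k_on k n U (\<lambda>x. f x * g x)"
proof (induction k arbitrary: f g)
  case 0
  then show ?case using U by (auto simp: continuous_map_Euclidean_subspace intro: continuous_intros)
next
  case (Suc k)
  show ?case
  proof (rule C_k_on_SucI[OF U, where D="\<lambda>i x. partial_deriv i f x * g x + partial_deriv i g x * f x"])
    show "continuous_on U (\<lambda>x. f x * g x)"
      using Suc.prems C_k_on_continuous[OF U] by (auto intro!: continuous_intros)
    fix i assume i: "i < n"
    show "((\<lambda>t. f (x(i := t)) * g (x(i := t))) has_real_derivative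
        partial_deriv i f x * g x + partial_deriv i g x * f x) (at (x i))" if x: "x \<in> U" for x
      by (rule DERIV_cong[OF DERIV_mult[OF C_k_on_partial(1)[OF U Suc.prems(1) i x]
              C_k_on_partial(1)[OF U Suc.prems(2) i x]]]) simp
    show "C_k_on k n U (\<lambda>x. partial_deriv i f x * g x + partial_deriv i g x * f x)"
      using Suc C_k_on_partial(2)[OF U _ i] C_k_on_Suc_D by (intro C_k_on_add[OF U]) blast+
  qed
qed

lemma C_k_on_sum:
  assumes "openin (Euclidean_space n) U" "finite I" "\<And>i. i \<in> I \<Longrightarrow> C_k_on k n U (f i)"
  shows "C_k_on k n U (\<lambda>x. \<Sum>i\<in>I. f i x)"
  using assms(2,3) by (induction I rule: finite_induct) (auto intro: C_k_on_const C_k_on_add assms(1))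

lemma C_k_on_inverse:
  assumes U: "openin (Euclidean_space n) U"
  shows "C_k_on k n U f \<Longrightarrow> (\<And>x. x \<in> U \<Longrightarrow> f x \<noteq> 0) \<Longrightarrow> C_k_on k n U (\<lambda>x. inverse (f x))"
proof (induction k)
  case 0
  then show ?case using U by (auto simp: continuous_map_Euclidean_subspace intro: continuous_intros)
next
  case (Suc k)
  show ?case
  proof (rule C_k_on_SucI[OF U, where D="\<lambda>i x. (- 1) * (inverse (f x) * partial_deriv i f x * inverse (f x))"])
    show "continuous_on U (\<lambda>x. inverse (f x))"
      using Suc.prems C_k_on_continuous[OF U] by (auto intro!: continuous_intros)
    fix i assume i: "i < n"
    show "((\<lambda>t. inverse (f (x(i := t)))) has_real_derivative
        (- 1) * (inverse (f x) * partial_deriv i f x * inverse (f x))) (at (x i))" if x: "x \<in> U" for x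
      by (rule DERIV_cong[OF DERIV_inverse'[OF C_k_on_partial(1)[OF U Suc.prems(1) i x]]])
        (use Suc.prems(2)[OF x] in simp_all)
    show "C_k_on k n U (\<lambda>x. (- 1) * (inverse (f x) * partial_deriv i f x * inverse (f x)))"
      using Suc.IH Suc.prems C_k_on_partial(2)[OF U Suc.prems(1) i] C_k_on_Suc_D
      by (intro C_k_on_mult[OF U] C_k_on_const[OF U]) blast+
  qed
qed

lemma MVT_unordered:
  fixes f :: "real \<Rightarrow> real"
  assumes "\<And>x. x \<in> closed_segment a b \<Longrightarrow> (f has_real_derivative f' x) (at x)"
  obtains z where "z \<in> closed_segment a b" "f b - f a = (b - a) * f' z"
proof (cases a b rule: linorder_cases)
  case less
  then obtain z where "a < z" "z < b" "f b - f a = (b - a) * f' z"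
    using MVT2[of a b f f'] assms by (auto simp: closed_segment_eq_real_ivl)
  then show ?thesis using less by (intro that[of z]) (auto simp: closed_segment_eq_real_ivl)
next
  case equal
  then show ?thesis by (intro that[of a]) auto
next
  case greater
  then obtain z where "b < z" "z < a" "f a - f b = (a - b) * f' z"
    using MVT2[of b a f f'] assms by (auto simp: closed_segment_eq_real_ivl)
  then show ?thesis using greater
    by (intro that[of z]) (auto simp: closed_segment_eq_real_ivl algebra_simps)
qed

text \<open>
  Only one coordinate is moved at a time: the mean value theorem in that coordinate expresses the
  increment through the value of a partial derivative at a nearby point, and continuity of the
  partial derivative identifies the limit.
\<close>

lemma chain_rule_along_curve:
  assumes V: "openin (Euclidean_space m) V"
    and f: "C_k_on (Suc 0) m V f"
    and c0: "c t0 \<in> V" and cV: "\<forall>\<^sub>F t in nhds t0. c t \<in> V"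
    and c': "\<And>j. j < m \<Longrightarrow> ((\<lambda>t. c t j) has_real_derivative c' j) (at t0)"
  shows "((\<lambda>t. f (c t)) has_real_derivative (\<Sum>j<m. partial_deriv j f (c t0) * c' j)) (at t0)"
proof -
  define z0 where "z0 = c t0"
  define y where "y k t = (\<lambda>j. if j < k then c t j else z0 j)" for k t
  have z00: "\<forall>j\<ge>m. z0 j = 0" and z0V: "z0 \<in> V"
    using c0 openin_subset[OF V] by (auto simp: z0_def topspace_Euclidean_space)
  have y0: "y k t0 = z0" for k by (auto simp: y_def z0_def)
  have step: "((\<lambda>t. f (y (Suc k) t) - f (y k t)) has_real_derivative partial_deriv k f z0 * c' k) (at t0)"
    if k: "k < m" for k
  proof -
    define D where "D t = f (y (Suc k) t) - f (y k t)" for t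
    define q where "q t = (if c t k = z0 k then partial_deriv k f z0 else D t / (c t k - z0 k))" for t
    have "(q \<longlongrightarrow> partial_deriv k f z0) (at t0)"
    proof (rule tendstoI)
      fix e :: real assume e: "e > 0"
      define W where "W = {z \<in> V. partial_deriv k f z \<in> ball (partial_deriv k f z0) e}"
      have "continuous_map (subtopology (Euclidean_space m) V) euclideanreal (partial_deriv k f)"
        using C_k_on_partial(2)[OF V f k] by simp
      then have "openin (subtopology (Euclidean_space m) V)
          {z \<in> topspace (subtopology (Euclidean_space m) V). partial_deriv k f z \<in> ball (partial_deriv k f z0) e}"
        by (rule openin_continuous_map_preimage) simp
      moreover have "topspace (subtopology (Euclidean_space m) V) = V"
        using openin_subset[OF V] by auto
      ultimately have W: "openin (Euclidean_space m) W"
        unfolding W_def using V openin_trans_full by metis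
      have "z0 \<in> W" using z0V e by (simp add: W_def)
      then obtain d where d: "d > 0"
        "\<And>z. \<forall>j\<ge>m. z j = 0 \<Longrightarrow> \<forall>j<m. \<bar>z j - z0 j\<bar> < d \<Longrightarrow> z \<in> W"
        using openin_Euclidean_contains_box[OF W] by metis
      have "\<forall>\<^sub>F t in at t0. \<bar>c t j - z0 j\<bar> < d" if "j < m" for j
      proof -
        have "((\<lambda>t. c t j) \<longlongrightarrow> z0 j) (at t0)"
          using DERIV_isCont[OF c'[OF that]] by (simp add: isCont_def z0_def)
        from tendstoD[OF this d(1)] show ?thesis by (simp add: dist_real_def)
      qed
      then have "\<forall>\<^sub>F t in at t0. \<forall>j\<in>{..<m}. \<bar>c t j - z0 j\<bar> < d"
        by (intro eventually_ball_finite) auto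
      then show "\<forall>\<^sub>F t in at t0. dist (q t) (partial_deriv k f z0) < e"
      proof eventually_elim
        case (elim t)
        show ?case
        proof (cases "c t k = z0 k")
          case True
          then show ?thesis using e by (simp add: q_def)
        next
          case False
          define z where "z s = (y k t)(k := s)" for s
          have zW: "z s \<in> W" if s: "s \<in> closed_segment (z0 k) (c t k)" for s
          proof (rule d(2))
            show "\<forall>j\<ge>m. z s j = 0" using k z00 by (auto simp: z_def y_def)
            have "\<bar>s - z0 k\<bar> \<le> \<bar>c t k - z0 k\<bar>"
              using s by (auto simp: closed_segment_eq_real_ivl split: if_splits)
            then have "\<bar>s - z0 k\<bar> < d" using elim k by force
            then show "\<forall>j<m. \<bar>z s j - z0 j\<bar> < d" using elim d(1) by (auto simp: z_def y_def)
          qed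
          have "((\<lambda>s. f (z s)) has_real_derivative partial_deriv k f (z s)) (at s)"
            if s: "s \<in> closed_segment (z0 k) (c t k)" for s
          proof -
            have "z s \<in> V" using zW[OF s] by (simp add: W_def)
            from C_k_on_partial(1)[OF V f k this] show ?thesis by (simp add: z_def)
          qed
          then obtain s where s: "s \<in> closed_segment (z0 k) (c t k)"
            "f (z (c t k)) - f (z (z0 k)) = (c t k - z0 k) * partial_deriv k f (z s)"
            by (rule MVT_unordered[where f="\<lambda>s. f (z s)"])
          have "z (c t k) = y (Suc k) t" "z (z0 k) = y k t"
            by (auto simp: z_def y_def fun_eq_iff less_Suc_eq)
          then have "q t = partial_deriv k f (z s)"
            using s(2) False by (simp add: q_def D_def)
          then show ?thesis using zW[OF s(1)] by (simp add: W_def dist_commute)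
        qed
      qed
    qed
    moreover have "((\<lambda>t. (c t k - z0 k) / (t - t0)) \<longlongrightarrow> c' k) (at t0)"
      using c'[OF k] by (simp add: has_field_derivative_iff z0_def)
    ultimately have "((\<lambda>t. q t * ((c t k - z0 k) / (t - t0))) \<longlongrightarrow> partial_deriv k f z0 * c' k) (at t0)"
      by (rule tendsto_mult)
    moreover have "q t * ((c t k - z0 k) / (t - t0)) = (D t - D t0) / (t - t0)" for t
    proof -
      have "y (Suc k) t = y k t" if "c t k = z0 k"
        using that by (auto simp: y_def fun_eq_iff less_Suc_eq)
      then show ?thesis by (simp add: q_def D_def y0)
    qed
    ultimately have "((\<lambda>t. (D t - D t0) / (t - t0)) \<longlongrightarrow> partial_deriv k f z0 * c' k) (at t0)"
      by (simp only:)
    then show ?thesis by (simp only: has_field_derivative_iff D_def)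
  qed
  have "((\<lambda>t. f (y k t)) has_real_derivative (\<Sum>j<k. partial_deriv j f z0 * c' j)) (at t0)" if "k \<le> m" for k
    using that
  proof (induction k)
    case 0
    then show ?case by (simp add: y_def)
  next
    case (Suc k)
    then have "((\<lambda>t. f (y k t)) has_real_derivative (\<Sum>j<k. partial_deriv j f z0 * c' j)) (at t0)" by simp
    from DERIV_add[OF this step[of k]] Suc.prems show ?case by simp
  qed
  from this[of m] have
    "((\<lambda>t. f (y m t)) has_real_derivative (\<Sum>j<m. partial_deriv j f (c t0) * c' j)) (at t0)"
    by (simp add: z0_def)
  moreover have "\<forall>\<^sub>F t in nhds t0. f (y m t) = f (c t)"
    using cV
  proof eventually_elim
    case (elim t)
    then have "y m t = c t"
      using openin_subset[OF V] z00 by (auto simp: y_def topspace_Euclidean_space fun_eq_iff)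
    then show ?case by simp
  qed
  ultimately show ?thesis by (subst (asm) DERIV_cong_ev[OF refl _ refl])
qed

lemma continuous_on_euclidean_smooth:
  assumes "euclidean_smooth n U m V g"
  shows "continuous_on U g"
proof (rule continuous_on_coordinatewise_then_product)
  fix j
  show "continuous_on U (\<lambda>x. g x j)"
  proof (cases "j < m")
    case True
    then show ?thesis using assms C_k_on_continuous
      unfolding euclidean_smooth_def smooth_fun_on_def by blast
  next
    case False
    have "g x j = 0" if "x \<in> U" for x
      using that assms False openin_subset[of "Euclidean_space m" V]
      by (auto simp: euclidean_smooth_def topspace_Euclidean_space image_subset_iff subset_iff)
    then show ?thesis by (metis continuous_on_cong continuous_on_const)
  qed
qed

text \<open>
  By the chain rule the partial derivatives of a composite are sums of products of functions of
  class \<open>C\<^sup>k\<close>, so the induction on \<open>k\<close> closes.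
\<close>

lemma C_k_on_compose:
  assumes g: "euclidean_smooth n U m V g"
  shows "C_k_on k m V f \<Longrightarrow> C_k_on k n U (\<lambda>x. f (g x))"
proof (induction k arbitrary: f)
  have U: "openin (Euclidean_space n) U" and V: "openin (Euclidean_space m) V"
    and gUV: "g ` U \<subseteq> V" and gs: "\<And>j k. j < m \<Longrightarrow> C_k_on k n U (\<lambda>x. g x j)"
    using g by (auto simp: euclidean_smooth_def smooth_fun_on_def)
  have cont: "continuous_on U (\<lambda>x. f (g x))" if "continuous_on V f" for f
    using continuous_on_compose2[OF that continuous_on_euclidean_smooth[OF g] gUV] .
  {
    case 0
    then show ?case using cont by (simp add: U V continuous_map_Euclidean_subspace)
  next
    case (Suc k)
    have f1: "C_k_on (Suc 0) m V f"
    proof (rule C_k_on_SucI[OF V, where D="\<lambda>i. partial_deriv i f"])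
      show "continuous_on V f" using C_k_on_continuous[OF V Suc.prems] .
      fix i assume i: "i < m"
      show "((\<lambda>t. f (x(i := t))) has_real_derivative partial_deriv i f x) (at (x i))" if "x \<in> V" for x
        using C_k_on_partial(1)[OF V Suc.prems i that] .
      show "C_k_on 0 m V (partial_deriv i f)"
        using C_k_on_continuous[OF V C_k_on_partial(2)[OF V Suc.prems i]]
        by (simp add: continuous_map_Euclidean_subspace[OF V])
    qed
    show ?case
    proof (rule C_k_on_SucI[OF U, where
          D="\<lambda>i x. \<Sum>j<m. partial_deriv j f (g x) * partial_deriv i (\<lambda>x. g x j) x"])
      show "continuous_on U (\<lambda>x. f (g x))"
        using cont C_k_on_continuous[OF V Suc.prems] by blast
      fix i assume i: "i < n"
      show "((\<lambda>t. f (g (x(i := t)))) has_real_derivative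
          (\<Sum>j<m. partial_deriv j f (g x) * partial_deriv i (\<lambda>x. g x j) x)) (at (x i))" if x: "x \<in> U" for x
      proof -
        have "\<forall>\<^sub>F t in nhds (x i). g (x(i := t)) \<in> V"
          using eventually_fun_upd_in[OF U i x] by (rule eventually_mono) (use gUV in blast)
        moreover have "((\<lambda>t. g (x(i := t)) j) has_real_derivative partial_deriv i (\<lambda>x. g x j) x) (at (x i))"
          if "j < m" for j
          using C_k_on_partial(1)[OF U gs[OF that, of "Suc 0"] i x] .
        ultimately show ?thesis
          using chain_rule_along_curve[OF V f1, where c="\<lambda>t. g (x(i := t))" and ?t0.0="x i"
              and c'="\<lambda>j. partial_deriv i (\<lambda>x. g x j) x"] gUV x by auto
      qed
      show "C_k_on k n U (\<lambda>x. \<Sum>j<m. partial_deriv j f (g x) * partial_deriv i (\<lambda>x. g x j) x)"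
        using Suc.IH C_k_on_partial(2)[OF V Suc.prems] C_k_on_partial(2)[OF U gs _] i
        by (intro C_k_on_sum[OF U] C_k_on_mult[OF U]) auto
    qed
  }
qed

lemma smooth_fun_on_continuous:
  "openin (Euclidean_space n) U \<Longrightarrow> smooth_fun_on n U f \<Longrightarrow> continuous_on U f"
  using C_k_on_continuous unfolding smooth_fun_on_def by blast

lemma smooth_fun_on_cong:
  "openin (Euclidean_space n) U \<Longrightarrow> smooth_fun_on n U f \<Longrightarrow> (\<And>x. x \<in> U \<Longrightarrow> f x = g x) \<Longrightarrow> smooth_fun_on n U g"
  unfolding smooth_fun_on_def using C_k_on_cong by blast

lemma smooth_fun_on_subset:
  "openin (Euclidean_space n) U \<Longrightarrow> openin (Euclidean_space n) V \<Longrightarrow> V \<subseteq> U \<Longrightarrow>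
    smooth_fun_on n U f \<Longrightarrow> smooth_fun_on n V f"
  unfolding smooth_fun_on_def using C_k_on_subset by blast

lemma smooth_fun_on_locally:
  assumes "openin (Euclidean_space n) U"
    and "\<And>u. u \<in> U \<Longrightarrow> \<exists>V. openin (Euclidean_space n) V \<and> u \<in> V \<and> V \<subseteq> U \<and> smooth_fun_on n V f"
  shows "smooth_fun_on n U f"
  unfolding smooth_fun_on_def
  by (intro allI C_k_on_locally[OF assms(1)]) (use assms(2) in \<open>force simp: smooth_fun_on_def\<close>)

lemma smooth_fun_on_compose:
  "euclidean_smooth n U m V g \<Longrightarrow> smooth_fun_on m V f \<Longrightarrow> smooth_fun_on n U (\<lambda>x. f (g x))"
  unfolding smooth_fun_on_def using C_k_on_compose by blast

lemma euclidean_smooth_inclusion: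
  "openin (Euclidean_space n) U \<Longrightarrow> openin (Euclidean_space n) V \<Longrightarrow> U \<subseteq> V \<Longrightarrow>
    euclidean_smooth n U n V (\<lambda>x. x)"
  by (auto simp: euclidean_smooth_def smooth_fun_on_def C_k_on_coordinate)

lemma openin_euclidean_smooth_preimage:
  assumes "euclidean_smooth n U m V g" "openin (Euclidean_space m) W" "W \<subseteq> V"
  shows "openin (Euclidean_space n) {x \<in> U. g x \<in> W}"
proof -
  have U: "openin (Euclidean_space n) U" using assms(1) by (simp add: euclidean_smooth_def)
  obtain T where T: "open T" "W = {x. \<forall>i\<ge>m. x i = 0} \<inter> T"
    using assms(2) by (auto simp: Euclidean_space_eq_top_of_set openin_open)
  have "openin (top_of_set U) (U \<inter> g -` T)"
    using continuous_on_euclidean_smooth[OF assms(1)] T(1) by (rule continuous_openin_preimage_gen)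
  moreover have "U \<inter> g -` T = {x \<in> U. g x \<in> W}"
    using assms(1) openin_subset[of "Euclidean_space m" V] T(2)
    by (fastforce simp: euclidean_smooth_def topspace_Euclidean_space)
  ultimately show ?thesis
    using openin_trans[OF _ U[unfolded Euclidean_space_eq_top_of_set]]
    by (simp add: Euclidean_space_eq_top_of_set)
qed

lemma openin_smooth_fun_on_preimage:
  assumes "openin (Euclidean_space n) U" "smooth_fun_on n U f" "open T"
  shows "openin (Euclidean_space n) {x \<in> U. f x \<in> T}"
proof -
  have "openin (top_of_set U) (U \<inter> f -` T)"
    using smooth_fun_on_continuous[OF assms(1,2)] assms(3) by (rule continuous_openin_preimage_gen)
  moreover have "U \<inter> f -` T = {x \<in> U. f x \<in> T}" by auto
  ultimately show ?thesis
    using openin_trans[OF _ assms(1)[unfolded Euclidean_space_eq_top_of_set]]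
    by (simp add: Euclidean_space_eq_top_of_set)
qed

section \<open>A flat function and a smooth step\<close>

text \<open>
  \<open>flat 0\<close> is the classical function \<open>exp (- 1 / x)\<close> extended by zero. The extra powers of \<open>x\<close>
  make the family closed under differentiation.
\<close>

definition flat :: "nat \<Rightarrow> real \<Rightarrow> real" where
  "flat k x = (if x > 0 then exp (- (1 / x)) / x ^ k else 0)"

lemma flat_tendsto_0: "(flat k \<longlongrightarrow> 0) (at 0)"
proof -
  have "((\<lambda>x. (1 / x) ^ k / exp (1 / x)) \<longlongrightarrow> 0) (at_right (0 :: real))"
    by (rule filterlim_compose[OF tendsto_power_div_exp_0])
      (use filterlim_inverse_at_top_right in \<open>simp add: inverse_eq_divide\<close>)
  then have "(flat k \<longlongrightarrow> 0) (at_right 0)"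
    by (rule Lim_transform_eventually)
      (auto simp: eventually_at_right_field flat_def exp_minus field_simps intro: exI[of _ 1])
  moreover have "(flat k \<longlongrightarrow> 0) (at_left 0)"
    by (rule Lim_transform_eventually[OF tendsto_const])
      (auto simp: eventually_at_left_field flat_def intro: exI[of _ "-1"])
  ultimately show ?thesis by (simp add: filterlim_split_at)
qed

lemma DERIV_flat: "(flat k has_real_derivative flat (Suc (Suc k)) x - real k * flat (Suc k) x) (at x)"
proof (cases x "0 :: real" rule: linorder_cases)
  case less
  have "\<forall>\<^sub>F y in nhds x. flat k y = 0"
    using eventually_nhds_in_open[of "{..<0}" x] less by (auto simp: flat_def elim: eventually_mono)
  then show ?thesis using less
    by (subst DERIV_cong_ev[OF refl, of _ "\<lambda>_. 0"]) (auto simp: flat_def)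
next
  case equal
  \<comment> \<open>The difference quotient of \<open>flat k\<close> at \<open>0\<close> is the next member of the family.\<close>
  have "(\<lambda>h. (flat k (0 + h) - flat k 0) / h) = flat (Suc k)"
    by (auto simp: flat_def fun_eq_iff)
  then have "(flat k has_real_derivative 0) (at 0)"
    using flat_tendsto_0[of "Suc k"] by (simp add: DERIV_def)
  then show ?thesis using equal by (simp add: flat_def)
next
  case greater
  have "\<forall>\<^sub>F y in nhds x. exp (- (1 / y)) / y ^ k = flat k y"
    using eventually_nhds_in_open[of "{0<..}" x] greater by (auto simp: flat_def elim: eventually_mono)
  moreover have "((\<lambda>y. exp (- (1 / y)) / y ^ k) has_real_derivative
      flat (Suc (Suc k)) x - real k * flat (Suc k) x) (at x)"
  proof -
    have "((\<lambda>y. exp (- (1 / y))) has_real_derivative exp (- (1 / x)) * (inverse x * inverse x)) (at x)"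
      using greater by (auto intro!: derivative_eq_intros simp: field_simps)
    moreover have "((\<lambda>y. inverse y ^ k) has_real_derivative - (real k * inverse x ^ Suc k)) (at x)"
      by (rule DERIV_cong[OF DERIV_power[OF DERIV_inverse]]) (use greater in \<open>cases k; simp add: algebra_simps\<close>)+
    ultimately have "((\<lambda>y. exp (- (1 / y)) * inverse y ^ k) has_real_derivative
        exp (- (1 / x)) * (- (real k * inverse x ^ Suc k))
          + exp (- (1 / x)) * (inverse x * inverse x) * inverse x ^ k) (at x)"
      by (rule DERIV_mult')
    then show ?thesis
      using greater by (simp add: flat_def power_inverse divide_inverse algebra_simps)
  qed
  ultimately show ?thesis by (subst (asm) DERIV_cong_ev[OF refl _ refl])
qed

lemma C_k_on_flat:
  assumes U: "openin (Euclidean_space n) U"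
  shows "C_k_on k n U f \<Longrightarrow> C_k_on k n U (\<lambda>x. flat m (f x))"
proof (induction k arbitrary: m)
  have cont: "continuous_on UNIV (flat m)" for m
    using DERIV_flat by (meson DERIV_continuous continuous_at_imp_continuous_on)
  {
    case 0
    then show ?case using continuous_on_compose2[OF cont]
      by (simp add: U continuous_map_Euclidean_subspace)
  next
    case (Suc k)
    have *: "C_k_on k n U (\<lambda>x. flat m (f x))" for m using Suc C_k_on_Suc_D by blast
    show ?case
    proof (rule C_k_on_SucI[OF U, where
          D="\<lambda>i x. (flat (Suc (Suc m)) (f x) + (- real m) * flat (Suc m) (f x)) * partial_deriv i f x"])
      show "continuous_on U (\<lambda>x. flat m (f x))"
        using continuous_on_compose2[OF cont C_k_on_continuous[OF U Suc.prems]] by auto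
      fix i assume i: "i < n"
      show "((\<lambda>t. flat m (f (x(i := t)))) has_real_derivative
        (flat (Suc (Suc m)) (f x) + (- real m) * flat (Suc m) (f x)) * partial_deriv i f x) (at (x i))"
        if x: "x \<in> U" for x
        by (rule DERIV_cong[OF DERIV_chain2[OF DERIV_flat C_k_on_partial(1)[OF U Suc.prems i x]]]) simp
      show "C_k_on k n U
          (\<lambda>x. (flat (Suc (Suc m)) (f x) + (- real m) * flat (Suc m) (f x)) * partial_deriv i f x)"
        by (intro C_k_on_mult[OF U] C_k_on_add[OF U] C_k_on_const[OF U] * C_k_on_partial(2)[OF U Suc.prems i])
    qed
  }
qed

definition bump :: "real \<Rightarrow> real" where "bump = flat 0"

lemma bump_nonneg: "bump x \<ge> 0" and bump_pos_iff: "bump x > 0 \<longleftrightarrow> x > 0"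
  and bump_eq_0_iff: "bump x = 0 \<longleftrightarrow> x \<le> 0"
  by (auto simp: bump_def flat_def)

definition smooth_step :: "real \<Rightarrow> real" where
  "smooth_step x = bump x * inverse (bump x + bump (1 - x))"

lemma smooth_step_denominator_pos: "bump x + bump (1 - x) > 0"
  using bump_pos_iff[of x] bump_pos_iff[of "1 - x"] bump_nonneg[of x] bump_nonneg[of "1 - x"]
  by (cases "x > 0") linarith+

lemma smooth_step_0: "x \<le> 0 \<Longrightarrow> smooth_step x = 0"
  and smooth_step_1: "x \<ge> 1 \<Longrightarrow> smooth_step x = 1"
  and smooth_step_bounds: "0 \<le> smooth_step x" "smooth_step x \<le> 1"
  using smooth_step_denominator_pos[of x] bump_nonneg[of x] bump_nonneg[of "1 - x"]
    bump_eq_0_iff[of x] bump_eq_0_iff[of "1 - x"]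
  by (auto simp: smooth_step_def field_simps zero_less_mult_iff)

section \<open>Plots, smooth real functions and smooth homotopies\<close>

lemma plotD:
  assumes "diffeological_space X" "plot X n U p"
  shows "openin (Euclidean_space n) U" "u \<in> U \<Longrightarrow> p u \<in> pts X"
  using assms(1)[unfolded diffeological_space_def, THEN conjunct1] assms(2) by blast+

lemma plot_cong:
  assumes "diffeological_space X" "plot X n U p" "\<And>u. u \<in> U \<Longrightarrow> p u = q u"
  shows "plot X n U q"
  using assms(1)[unfolded diffeological_space_def, THEN conjunct2, THEN conjunct1] assms(2,3) by blast

lemma plot_const:
  assumes "diffeological_space X" "openin (Euclidean_space n) U" "x \<in> pts X"
  shows "plot X n U (\<lambda>_. x)"
  using assms(1)[unfolded diffeological_space_def, THEN conjunct2, THEN conjunct2, THEN conjunct1]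
    assms(2,3) by blast

lemma plot_locally:
  assumes "diffeological_space X" "openin (Euclidean_space n) U"
    and "\<And>u. u \<in> U \<Longrightarrow> \<exists>V. openin (Euclidean_space n) V \<and> u \<in> V \<and> V \<subseteq> U \<and> plot X n V p"
  shows "plot X n U p"
  using assms(1)[unfolded diffeological_space_def, THEN conjunct2, THEN conjunct2, THEN conjunct2,
      THEN conjunct1] assms(2,3) by metis

lemma plot_compose:
  assumes "diffeological_space X" "plot X m V p" "euclidean_smooth n U m V f"
  shows "plot X n U (\<lambda>u. p (f u))"
proof -
  have "plot X n U (p \<circ> f)"
    using assms(1)[unfolded diffeological_space_def, THEN conjunct2, THEN conjunct2, THEN conjunct2,
        THEN conjunct2] assms(2,3) by blast
  then show ?thesis by (simp add: o_def)
qed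

lemma plot_subset:
  assumes "diffeological_space X" "plot X n U p" "openin (Euclidean_space n) V" "V \<subseteq> U"
  shows "plot X n V p"
  using plot_compose[OF assms(1,2) euclidean_smooth_inclusion[OF assms(3) _ assms(4)]]
    plotD(1)[OF assms(1,2)] by simp

lemma smooth_mapD:
  assumes "smooth_map X Y f"
  shows "x \<in> pts X \<Longrightarrow> f x \<in> pts Y" "plot X n U p \<Longrightarrow> plot Y n U (\<lambda>u. f (p u))"
  using assms by (auto simp: smooth_map_def o_def)

lemma smooth_map_compose:
  "smooth_map X Y f \<Longrightarrow> smooth_map Y Z g \<Longrightarrow> smooth_map X Z (\<lambda>x. g (f x))"
  by (auto simp: smooth_map_def o_def image_subset_iff)

lemma smooth_map_ident: "smooth_map X X (\<lambda>x. x)"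
  by (auto simp: smooth_map_def o_def)

lemma openin_D_topology_preimage:
  assumes "diffeological_space Y" "smooth_map Y X f" "openin (D_topology X) A"
  shows "openin (D_topology Y) {y \<in> pts Y. f y \<in> A}"
  unfolding openin_D_topology
proof (intro conjI allI impI)
  fix n U p assume p: "plot Y n U p"
  have "{u \<in> U. p u \<in> {y \<in> pts Y. f y \<in> A}} = {u \<in> U. f (p u) \<in> A}"
    using plotD(2)[OF assms(1) p] by auto
  then show "openin (Euclidean_space n) {u \<in> U. p u \<in> {y \<in> pts Y. f y \<in> A}}"
    using smooth_mapD(2)[OF assms(2) p] assms(3) by (auto simp: openin_D_topology)
qed auto

lemma openin_D_topology_pts:
  assumes "diffeological_space X"
  shows "openin (D_topology X) (pts X)"
  unfolding openin_D_topology
proof (intro conjI allI impI)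
  fix n U p assume p: "plot X n U p"
  have "{u \<in> U. p u \<in> pts X} = U" using plotD(2)[OF assms p] by auto
  then show "openin (Euclidean_space n) {u \<in> U. p u \<in> pts X}" using plotD(1)[OF assms p] by simp
qed simp

lemma topspace_D_topology: "diffeological_space X \<Longrightarrow> topspace (D_topology X) = pts X"
  using openin_D_topology_pts[of X] openin_subset openin_topspace[of "D_topology X"]
  by (metis openin_D_topology subset_antisym)

lemma plot_openin_D_topology:
  assumes "diffeological_space X" "plot X n U p" "openin (D_topology X) A"
  shows "openin (Euclidean_space n) {u \<in> U. p u \<in> A}" "plot X n {u \<in> U. p u \<in> A} p"
proof -
  show o: "openin (Euclidean_space n) {u \<in> U. p u \<in> A}"
    using assms(2,3) by (simp add: openin_D_topology)
  show "plot X n {u \<in> U. p u \<in> A} p"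
    by (rule plot_subset[OF assms(1,2) o]) auto
qed

lemma diffeological_spaceI:
  assumes "\<And>n U p. plot X n U p \<Longrightarrow> openin (Euclidean_space n) U"
    and "\<And>n U p u. plot X n U p \<Longrightarrow> u \<in> U \<Longrightarrow> p u \<in> pts X"
    and "\<And>n U p q. plot X n U p \<Longrightarrow> (\<And>u. u \<in> U \<Longrightarrow> p u = q u) \<Longrightarrow> plot X n U q"
    and "\<And>n U x. openin (Euclidean_space n) U \<Longrightarrow> x \<in> pts X \<Longrightarrow> plot X n U (\<lambda>_. x)"
    and "\<And>n U p. openin (Euclidean_space n) U \<Longrightarrow>
        (\<And>u. u \<in> U \<Longrightarrow> \<exists>V. openin (Euclidean_space n) V \<and> u \<in> V \<and> V \<subseteq> U \<and> plot X n V p) \<Longrightarrow>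
        plot X n U p"
    and "\<And>n U m V f p. plot X m V p \<Longrightarrow> euclidean_smooth n U m V f \<Longrightarrow> plot X n U (\<lambda>u. p (f u))"
  shows "diffeological_space X"
  unfolding diffeological_space_def o_def
proof (intro conjI allI impI)
  fix n U p assume "plot X n U p"
  then show "openin (Euclidean_space n) U" "p ` U \<subseteq> pts X" using assms(1,2) by blast+
next
  fix n U p q assume "plot X n U p" "\<forall>u\<in>U. p u = q u"
  then show "plot X n U q" using assms(3) by simp
next
  fix n U p assume U: "openin (Euclidean_space n) U"
    and "\<forall>u\<in>U. \<exists>V. openin (Euclidean_space n) V \<and> u \<in> V \<and> V \<subseteq> U \<and> plot X n V p"
  then show "plot X n U p" by (intro assms(5)[OF U]) simp
qed (use assms(4,6) in simp_all)

lemma diffeological_space_real: "diffeological_space real_diffeology"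
proof (rule diffeological_spaceI; unfold real_diffeology_def diffeology.select_convs)
  fix n m U V f and p :: "(nat \<Rightarrow> real) \<Rightarrow> real"
  assume "openin (Euclidean_space m) V \<and> smooth_fun_on m V p" "euclidean_smooth n U m V f"
  then show "openin (Euclidean_space n) U \<and> smooth_fun_on n U (\<lambda>u. p (f u))"
    using smooth_fun_on_compose[of n U m V f p] by (auto simp: euclidean_smooth_def)
next
  fix n U and p :: "(nat \<Rightarrow> real) \<Rightarrow> real"
  assume U: "openin (Euclidean_space n) U"
    and loc: "\<And>u. u \<in> U \<Longrightarrow> \<exists>V. openin (Euclidean_space n) V \<and> u \<in> V \<and> V \<subseteq> U \<and>
      openin (Euclidean_space n) V \<and> smooth_fun_on n V p"
  have "smooth_fun_on n U p" by (rule smooth_fun_on_locally[OF U]) (use loc in metis)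
  then show "openin (Euclidean_space n) U \<and> smooth_fun_on n U p" using U by simp
qed (auto simp: smooth_fun_on_def C_k_on_const intro: C_k_on_cong)

lemma diffeological_space_subspace:
  assumes "diffeological_space X"
  shows "diffeological_space (subspace_diffeology X A)"
proof (rule diffeological_spaceI; unfold subspace_diffeology_def diffeology.select_convs)
  fix n U p q assume "plot X n U p \<and> p ` U \<subseteq> A" "\<And>u. u \<in> U \<Longrightarrow> p u = q u"
  then show "plot X n U q \<and> q ` U \<subseteq> A" using plot_cong[OF assms, of n U p q] by auto
next
  fix n U p assume U: "openin (Euclidean_space n) U"
    and loc: "\<And>u. u \<in> U \<Longrightarrow> \<exists>V. openin (Euclidean_space n) V \<and> u \<in> V \<and> V \<subseteq> U \<and> plot X n V p \<and> p ` V \<subseteq> A"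
  have "plot X n U p" by (rule plot_locally[OF assms U]) (use loc in metis)
  moreover have "p ` U \<subseteq> A" using loc by (meson image_subset_iff)
  ultimately show "plot X n U p \<and> p ` U \<subseteq> A" by simp
next
  fix n U m V f p assume "plot X m V p \<and> p ` V \<subseteq> A" "euclidean_smooth n U m V f"
  then show "plot X n U (\<lambda>u. p (f u)) \<and> (\<lambda>u. p (f u)) ` U \<subseteq> A"
    using plot_compose[OF assms, of m V p n U f] by (auto simp: euclidean_smooth_def)
qed (use plotD[OF assms] plot_const[OF assms] in auto)

lemma pts_prod: "pts (prod_diffeology X Y) = pts X \<times> pts Y"
  by (simp add: prod_diffeology_def)

lemma plot_prod_iff:
  "plot (prod_diffeology X Y) n U p \<longleftrightarrow> plot X n U (\<lambda>u. fst (p u)) \<and> plot Y n U (\<lambda>u. snd (p u))"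
  by (simp add: prod_diffeology_def o_def)

lemma diffeological_space_prod:
  assumes X: "diffeological_space X" and Y: "diffeological_space Y"
  shows "diffeological_space (prod_diffeology X Y)"
proof (rule diffeological_spaceI; unfold plot_prod_iff pts_prod)
  fix n U and p q :: "(nat \<Rightarrow> real) \<Rightarrow> 'a \<times> 'b"
  assume p: "plot X n U (\<lambda>u. fst (p u)) \<and> plot Y n U (\<lambda>u. snd (p u))"
  then show "openin (Euclidean_space n) U" using plotD(1)[OF X] by blast
  show "p u \<in> pts X \<times> pts Y" if "u \<in> U" for u
    using p plotD(2)[OF X, of n U "\<lambda>u. fst (p u)"] plotD(2)[OF Y, of n U "\<lambda>u. snd (p u)"] that
    by (simp add: mem_Times_iff)
  assume "\<And>u. u \<in> U \<Longrightarrow> p u = q u"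
  then show "plot X n U (\<lambda>u. fst (q u)) \<and> plot Y n U (\<lambda>u. snd (q u))"
    using plot_cong[OF X, of n U "\<lambda>u. fst (p u)" "\<lambda>u. fst (q u)"]
      plot_cong[OF Y, of n U "\<lambda>u. snd (p u)" "\<lambda>u. snd (q u)"] p by auto
next
  fix n U and p :: "(nat \<Rightarrow> real) \<Rightarrow> 'a \<times> 'b"
  assume U: "openin (Euclidean_space n) U"
    and loc: "\<And>u. u \<in> U \<Longrightarrow> \<exists>V. openin (Euclidean_space n) V \<and> u \<in> V \<and> V \<subseteq> U \<and>
      plot X n V (\<lambda>u. fst (p u)) \<and> plot Y n V (\<lambda>u. snd (p u))"
  have "plot X n U (\<lambda>u. fst (p u))" by (rule plot_locally[OF X U]) (use loc in metis)
  moreover have "plot Y n U (\<lambda>u. snd (p u))" by (rule plot_locally[OF Y U]) (use loc in metis)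
  ultimately show "plot X n U (\<lambda>u. fst (p u)) \<and> plot Y n U (\<lambda>u. snd (p u))" by simp
next
  fix n U m V f and p :: "(nat \<Rightarrow> real) \<Rightarrow> 'a \<times> 'b"
  assume "plot X m V (\<lambda>u. fst (p u)) \<and> plot Y m V (\<lambda>u. snd (p u))" "euclidean_smooth n U m V f"
  then show "plot X n U (\<lambda>u. fst (p (f u))) \<and> plot Y n U (\<lambda>u. snd (p (f u)))"
    using plot_compose[OF X, of m V "\<lambda>u. fst (p u)" n U f] plot_compose[OF Y, of m V "\<lambda>u. snd (p u)" n U f]
    by auto
qed (use plot_const[OF X] plot_const[OF Y] in auto)

lemma diffeological_space_unit_interval: "diffeological_space unit_interval"
  by (simp add: unit_interval_def diffeological_space_subspace diffeological_space_real)

lemma diffeological_space_cylinder: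
  "diffeological_space X \<Longrightarrow> diffeological_space (prod_diffeology X unit_interval)"
  by (simp add: diffeological_space_prod diffeological_space_unit_interval)

lemma pts_unit_interval: "pts unit_interval = {0..1}"
  by (simp add: unit_interval_def subspace_diffeology_def real_diffeology_def)

lemma plot_unit_interval_iff:
  "plot unit_interval n U q \<longleftrightarrow> openin (Euclidean_space n) U \<and> smooth_fun_on n U q \<and> (\<forall>u\<in>U. q u \<in> {0..1})"
  by (auto simp: unit_interval_def subspace_diffeology_def real_diffeology_def)

lemma smooth_map_fst: "smooth_map (prod_diffeology X Y) X fst"
  by (auto simp: smooth_map_def pts_prod plot_prod_iff o_def)

lemma smooth_map_cylinder_slice:
  assumes "diffeological_space X" "s \<in> {0..1}"
  shows "smooth_map X (prod_diffeology X unit_interval) (\<lambda>x. (x, s))"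
  using assms plotD[OF assms(1)] diffeological_space_unit_interval
  by (auto simp: smooth_map_def pts_prod plot_prod_iff o_def pts_unit_interval intro!: plot_const)

definition smooth_real :: "'x diffeology \<Rightarrow> ('x \<Rightarrow> real) \<Rightarrow> bool" where
  "smooth_real X f \<longleftrightarrow> (\<forall>n U p. plot X n U p \<longrightarrow> smooth_fun_on n U (\<lambda>u. f (p u)))"

lemma smooth_realD: "smooth_real X f \<Longrightarrow> plot X n U p \<Longrightarrow> smooth_fun_on n U (\<lambda>u. f (p u))"
  by (simp add: smooth_real_def)

lemma smooth_real_compose: "smooth_map X Y g \<Longrightarrow> smooth_real Y f \<Longrightarrow> smooth_real X (\<lambda>x. f (g x))"
  by (auto simp: smooth_real_def dest: smooth_mapD(2))

context
  fixes X :: "'x diffeology"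
  assumes X: "diffeological_space X"
begin

lemma smooth_real_const: "smooth_real X (\<lambda>_. c)"
  using plotD(1)[OF X] by (auto simp: smooth_real_def smooth_fun_on_def C_k_on_const)

lemma smooth_real_add: "smooth_real X f \<Longrightarrow> smooth_real X g \<Longrightarrow> smooth_real X (\<lambda>x. f x + g x)"
  using plotD(1)[OF X] by (auto simp: smooth_real_def smooth_fun_on_def C_k_on_add)

lemma smooth_real_mult: "smooth_real X f \<Longrightarrow> smooth_real X g \<Longrightarrow> smooth_real X (\<lambda>x. f x * g x)"
  using plotD(1)[OF X] by (auto simp: smooth_real_def smooth_fun_on_def C_k_on_mult)

lemma smooth_real_diff:
  assumes "smooth_real X f" "smooth_real X g" shows "smooth_real X (\<lambda>x. f x - g x)"
  using smooth_real_add[OF assms(1) smooth_real_mult[OF smooth_real_const[of "-1"] assms(2)]] by simp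

lemma smooth_real_sum:
  "(\<And>i. i \<in> I \<Longrightarrow> smooth_real X (f i)) \<Longrightarrow> smooth_real X (\<lambda>x. \<Sum>i\<in>I. f i x)"
  by (induction I rule: infinite_finite_induct) (auto intro: smooth_real_add smooth_real_const)

lemma smooth_real_inverse:
  "smooth_real X f \<Longrightarrow> (\<And>x. x \<in> pts X \<Longrightarrow> f x \<noteq> 0) \<Longrightarrow> smooth_real X (\<lambda>x. inverse (f x))"
  using plotD[OF X] by (auto simp: smooth_real_def smooth_fun_on_def C_k_on_inverse)

lemma smooth_real_bump: "smooth_real X f \<Longrightarrow> smooth_real X (\<lambda>x. bump (f x))"
  using plotD(1)[OF X] by (auto simp: smooth_real_def smooth_fun_on_def bump_def C_k_on_flat)

lemma smooth_real_step:
  assumes "smooth_real X f" shows "smooth_real X (\<lambda>x. smooth_step (f x))"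
  unfolding smooth_step_def
  using smooth_step_denominator_pos
  by (intro smooth_real_mult smooth_real_inverse smooth_real_add smooth_real_bump smooth_real_diff
      smooth_real_const assms) (metis less_irrefl)

lemma smooth_real_locally:
  assumes "\<And>x. x \<in> pts X \<Longrightarrow> \<exists>V g. openin (D_topology X) V \<and> x \<in> V \<and> smooth_real X g \<and> (\<forall>y\<in>V. f y = g y)"
  shows "smooth_real X f"
  unfolding smooth_real_def
proof (intro allI impI)
  fix n U p assume p: "plot X n U p"
  show "smooth_fun_on n U (\<lambda>u. f (p u))"
  proof (rule smooth_fun_on_locally[OF plotD(1)[OF X p]])
    fix u assume u: "u \<in> U"
    then obtain V g where V: "openin (D_topology X) V" "p u \<in> V" "smooth_real X g" "\<forall>y\<in>V. f y = g y"
      using assms plotD(2)[OF X p] by metis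
    let ?V = "{u \<in> U. p u \<in> V}"
    have "smooth_fun_on n ?V (\<lambda>u. f (p u))"
      using smooth_realD[OF V(3) plot_openin_D_topology(2)[OF X p V(1)]]
        plot_openin_D_topology(1)[OF X p V(1)] V(4) by (auto elim: smooth_fun_on_cong)
    then show "\<exists>V. openin (Euclidean_space n) V \<and> u \<in> V \<and> V \<subseteq> U \<and> smooth_fun_on n V (\<lambda>u. f (p u))"
      using plot_openin_D_topology(1)[OF X p V(1)] u V(2) by (intro exI[of _ ?V]) auto
  qed
qed

lemma openin_smooth_real_preimage:
  assumes "smooth_real X f" "open T"
  shows "openin (D_topology X) {x \<in> pts X. f x \<in> T}"
  unfolding openin_D_topology
proof (intro conjI allI impI)
  fix n U p assume p: "plot X n U p"
  have "{u \<in> U. p u \<in> {x \<in> pts X. f x \<in> T}} = {u \<in> U. f (p u) \<in> T}"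
    using plotD(2)[OF X p] by auto
  then show "openin (Euclidean_space n) {u \<in> U. p u \<in> {x \<in> pts X. f x \<in> T}}"
    using openin_smooth_fun_on_preimage[OF plotD(1)[OF X p] smooth_realD[OF assms(1) p] assms(2)] by simp
qed auto

lemma openin_smooth_real_greater:
  "smooth_real X f \<Longrightarrow> openin (D_topology X) {x \<in> pts X. f x > c}"
  using openin_smooth_real_preimage[of f "{c<..}"] by simp

lemma smooth_map_unit_interval_iff:
  "smooth_map X unit_interval f \<longleftrightarrow> smooth_real X f \<and> (\<forall>x\<in>pts X. f x \<in> {0..1})"
  using plotD[OF X]
  by (auto simp: smooth_map_def smooth_real_def plot_unit_interval_iff pts_unit_interval o_def image_subset_iff)

end

lemma smooth_real_snd: "smooth_real (prod_diffeology X unit_interval) snd"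
  by (auto simp: smooth_real_def plot_prod_iff plot_unit_interval_iff)

lemma smoothly_homotopicI:
  assumes "smooth_map (prod_diffeology X unit_interval) Y H"
    and "\<And>x. x \<in> pts X \<Longrightarrow> H (x, 0) = f x" "\<And>x. x \<in> pts X \<Longrightarrow> H (x, 1) = g x"
  shows "smoothly_homotopic X Y f g"
  using assms unfolding smoothly_homotopic_def by blast

lemma smooth_map_cylinder_reparametrize:
  assumes "diffeological_space X" "smooth_real (prod_diffeology X unit_interval) r"
    "\<And>z. z \<in> pts (prod_diffeology X unit_interval) \<Longrightarrow> r z \<in> {0..1}"
  shows "smooth_map (prod_diffeology X unit_interval) (prod_diffeology X unit_interval) (\<lambda>z. (fst z, r z))"
  unfolding smooth_map_def
proof (intro conjI allI impI)
  note C = diffeological_space_cylinder[OF assms(1)]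
  show "(\<lambda>z. (fst z, r z)) ` pts (prod_diffeology X unit_interval) \<subseteq> pts (prod_diffeology X unit_interval)"
    using assms(3) by (auto simp: pts_prod pts_unit_interval)
  fix n U p assume p: "plot (prod_diffeology X unit_interval) n U p"
  then show "plot (prod_diffeology X unit_interval) n U ((\<lambda>z. (fst z, r z)) \<circ> p)"
    using smooth_realD[OF assms(2) p] plotD[OF C p] assms(3)
    by (auto simp: plot_prod_iff o_def plot_unit_interval_iff)
qed

lemma smoothly_homotopic_sym:
  assumes X: "diffeological_space X" and h: "smoothly_homotopic X Y f g"
  shows "smoothly_homotopic X Y g f"
proof -
  let ?C = "prod_diffeology X unit_interval"
  obtain H where H: "smooth_map ?C Y H" "\<forall>x\<in>pts X. H (x, 0) = f x \<and> H (x, 1) = g x"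
    using h unfolding smoothly_homotopic_def by blast
  have "smooth_map ?C ?C (\<lambda>z. (fst z, 1 - snd z))"
    by (intro smooth_map_cylinder_reparametrize X smooth_real_diff diffeological_space_cylinder
        smooth_real_const smooth_real_snd) (auto simp: pts_prod pts_unit_interval)
  from smooth_map_compose[OF this H(1)] show ?thesis
    by (rule smoothly_homotopicI) (use H(2) in auto)
qed

lemma smooth_map_locally:
  assumes X: "diffeological_space X" and Y: "diffeological_space Y"
    and loc: "\<And>x. x \<in> pts X \<Longrightarrow> \<exists>V g. openin (D_topology X) V \<and> x \<in> V \<and> smooth_map X Y g \<and> (\<forall>y\<in>V. f y = g y)"
  shows "smooth_map X Y f"
  unfolding smooth_map_def
proof (intro conjI allI impI)
  show "f ` pts X \<subseteq> pts Y" using loc smooth_mapD(1)[of X Y] by (fastforce)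
  fix n U p assume p: "plot X n U p"
  show "plot Y n U (f \<circ> p)"
  proof (rule plot_locally[OF Y plotD(1)[OF X p]])
    fix u assume u: "u \<in> U"
    then obtain V g where V: "openin (D_topology X) V" "p u \<in> V" "smooth_map X Y g" "\<forall>y\<in>V. f y = g y"
      using loc plotD(2)[OF X p] by metis
    let ?V = "{u \<in> U. p u \<in> V}"
    have "plot Y n ?V (f \<circ> p)"
      using plot_cong[OF Y smooth_mapD(2)[OF V(3) plot_openin_D_topology(2)[OF X p V(1)]]] V(4) by auto
    then show "\<exists>V. openin (Euclidean_space n) V \<and> u \<in> V \<and> V \<subseteq> U \<and> plot Y n V (f \<circ> p)"
      using plot_openin_D_topology(1)[OF X p V(1)] u V(2) by (intro exI[of _ ?V]) auto
  qed
qed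

text \<open>
  Each homotopy is first reparametrized to be stationary near its ends, so that the concatenation
  is smooth across the midpoint.
\<close>

lemma smoothly_homotopic_trans:
  assumes X: "diffeological_space X" and Y: "diffeological_space Y"
    and h1: "smoothly_homotopic X Y f g" and h2: "smoothly_homotopic X Y g h"
  shows "smoothly_homotopic X Y f h"
proof -
  let ?C = "prod_diffeology X unit_interval"
  note C = diffeological_space_cylinder[OF X]
  obtain H where H: "smooth_map ?C Y H" "\<forall>x\<in>pts X. H (x, 0) = f x \<and> H (x, 1) = g x"
    using h1 unfolding smoothly_homotopic_def by blast
  obtain K where K: "smooth_map ?C Y K" "\<forall>x\<in>pts X. K (x, 0) = g x \<and> K (x, 1) = h x"
    using h2 unfolding smoothly_homotopic_def by blast
  have r: "smooth_map ?C ?C (\<lambda>z. (fst z, smooth_step (3 * snd z - c)))" for c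
    by (intro smooth_map_cylinder_reparametrize X smooth_real_step C smooth_real_diff smooth_real_mult
        smooth_real_const smooth_real_snd) (use smooth_step_bounds in auto)
  define H' where "H' z = H (fst z, smooth_step (3 * snd z - 0))" for z
  define K' where "K' z = K (fst z, smooth_step (3 * snd z - 2))" for z
  have H': "smooth_map ?C Y H'" and K': "smooth_map ?C Y K'"
    unfolding H'_def K'_def using smooth_map_compose[OF r H(1)] smooth_map_compose[OF r K(1)] .
  have mid: "H' z = K' z" if "z \<in> pts ?C" "1/3 \<le> snd z" "snd z \<le> 2/3" for z
    using that H(2) K(2) by (auto simp: H'_def K'_def smooth_step_0 smooth_step_1 pts_prod)
  define L where "L z = (if snd z < 1/2 then H' z else K' z)" for z
  have "smooth_map ?C Y L"
  proof (rule smooth_map_locally[OF C Y])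
    fix z assume z: "z \<in> pts ?C"
    have l: "openin (D_topology ?C) {z \<in> pts ?C. snd z \<in> {..<2/3}}"
      and r: "openin (D_topology ?C) {z \<in> pts ?C. snd z \<in> {1/3<..}}"
      by (intro openin_smooth_real_preimage C smooth_real_snd; simp)+
    show "\<exists>V g. openin (D_topology ?C) V \<and> z \<in> V \<and> smooth_map ?C Y g \<and> (\<forall>y\<in>V. L y = g y)"
    proof (cases "snd z < 2/3")
      case True
      then show ?thesis using l H' z mid
        by (intro exI[of _ "{z \<in> pts ?C. snd z \<in> {..<2/3}}"] exI[of _ H']) (auto simp: L_def)
    next
      case False
      then show ?thesis using r K' z mid
        by (intro exI[of _ "{z \<in> pts ?C. snd z \<in> {1/3<..}}"] exI[of _ K']) (auto simp: L_def)
    qed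
  qed
  then show ?thesis
    by (rule smoothly_homotopicI)
      (use H(2) K(2) in \<open>auto simp: L_def H'_def K'_def smooth_step_0 smooth_step_1\<close>)
qed

section \<open>Cocycles and \<open>\<Gamma>\<close>-structures\<close>

lemma pts_subspace: "pts (subspace_diffeology X A) = pts X \<inter> A"
  and plot_subspace_iff: "plot (subspace_diffeology X A) n U p \<longleftrightarrow> plot X n U p \<and> p ` U \<subseteq> A"
  by (simp_all add: subspace_diffeology_def)

lemma smooth_map_subspace_compose:
  assumes "smooth_map (subspace_diffeology X A) Z f" "smooth_map Y X g" "\<And>y. y \<in> B \<Longrightarrow> g y \<in> A"
  shows "smooth_map (subspace_diffeology Y B) Z (\<lambda>y. f (g y))"
  using assms by (fastforce simp: smooth_map_def pts_subspace plot_subspace_iff o_def image_subset_iff)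

lemma smooth_map_subspace_mono:
  "smooth_map (subspace_diffeology X A) Z f \<Longrightarrow> B \<subseteq> A \<Longrightarrow> smooth_map (subspace_diffeology X B) Z f"
  using smooth_map_subspace_compose[OF _ smooth_map_ident, of X A Z f B] by auto

lemma smooth_map_subspace_locally:
  assumes X: "diffeological_space X" and Z: "diffeological_space Z"
    and loc: "\<And>x. x \<in> A \<Longrightarrow> \<exists>V g. openin (D_topology X) V \<and> x \<in> V \<and>
      smooth_map (subspace_diffeology X (V \<inter> A)) Z g \<and> (\<forall>y\<in>V \<inter> A. f y = g y)"
  shows "smooth_map (subspace_diffeology X A) Z f"
  unfolding smooth_map_def pts_subspace plot_subspace_iff
proof (intro conjI allI impI)
  show "f ` (pts X \<inter> A) \<subseteq> pts Z"
  proof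
    fix z assume "z \<in> f ` (pts X \<inter> A)"
    then obtain x where x: "x \<in> pts X" "x \<in> A" "z = f x" by blast
    then obtain V g where "x \<in> V" "smooth_map (subspace_diffeology X (V \<inter> A)) Z g" "\<forall>y\<in>V \<inter> A. f y = g y"
      using loc by metis
    then show "z \<in> pts Z" using x smooth_mapD(1)[of _ Z g x] by (auto simp: pts_subspace)
  qed
  fix n U p assume p: "plot X n U p \<and> p ` U \<subseteq> A"
  then have pX: "plot X n U p" by simp
  show "plot Z n U (f \<circ> p)"
  proof (rule plot_locally[OF Z plotD(1)[OF X pX]])
    fix u assume u: "u \<in> U"
    then obtain V g where V: "openin (D_topology X) V" "p u \<in> V"
      "smooth_map (subspace_diffeology X (V \<inter> A)) Z g" "\<forall>y\<in>V \<inter> A. f y = g y"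
      using loc p by (metis image_subset_iff)
    let ?V = "{u \<in> U. p u \<in> V}"
    have "plot (subspace_diffeology X (V \<inter> A)) n ?V p"
      using plot_openin_D_topology(2)[OF X pX V(1)] p by (auto simp: plot_subspace_iff)
    then have "plot Z n ?V (f \<circ> p)"
      by (rule plot_cong[OF Z smooth_mapD(2)[OF V(3)]]) (use V(4) p in auto)
    then show "\<exists>V. openin (Euclidean_space n) V \<and> u \<in> V \<and> V \<subseteq> U \<and> plot Z n V (f \<circ> p)"
      using plot_openin_D_topology(1)[OF X pX V(1)] u V(2) by (intro exI[of _ ?V]) auto
  qed
qed

lemma D_open_coverD:
  assumes "D_open_cover X U"
  shows "openin (D_topology X) (U i)" "x \<in> U i \<Longrightarrow> x \<in> pts X" "x \<in> pts X \<Longrightarrow> \<exists>i. x \<in> U i"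
  using assms by (auto simp: D_open_cover_def)

locale diff_groupoid =
  fixes \<Gamma> :: "'g groupoid"
  assumes \<Gamma>: "diffeological_groupoid \<Gamma>"
begin

lemma arr_diffeological: "diffeological_space (arr \<Gamma>)"
  using \<Gamma> by (simp add: diffeological_groupoid_def)

lemma groupoid: "is_groupoid \<Gamma>"
  using \<Gamma> by (simp add: diffeological_groupoid_def)

lemma gcomp_closed:
  assumes "g \<in> pts (arr \<Gamma>)" "h \<in> pts (arr \<Gamma>)" "src \<Gamma> g = rng \<Gamma> h"
  shows "gcomp \<Gamma> g h \<in> pts (arr \<Gamma>)" "src \<Gamma> (gcomp \<Gamma> g h) = src \<Gamma> h" "rng \<Gamma> (gcomp \<Gamma> g h) = rng \<Gamma> g"
  using groupoid assms by (simp_all add: is_groupoid_def)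

lemma gcomp_assoc:
  assumes "g \<in> pts (arr \<Gamma>)" "h \<in> pts (arr \<Gamma>)" "k \<in> pts (arr \<Gamma>)" "src \<Gamma> g = rng \<Gamma> h" "src \<Gamma> h = rng \<Gamma> k"
  shows "gcomp \<Gamma> (gcomp \<Gamma> g h) k = gcomp \<Gamma> g (gcomp \<Gamma> h k)"
  using groupoid assms by (simp add: is_groupoid_def)

lemma smooth_map_gcomp:
  assumes "smooth_map X (arr \<Gamma>) f" "smooth_map X (arr \<Gamma>) g"
    and "\<And>x. x \<in> pts X \<Longrightarrow> src \<Gamma> (f x) = rng \<Gamma> (g x)"
    and X: "diffeological_space X"
  shows "smooth_map X (arr \<Gamma>) (\<lambda>x. gcomp \<Gamma> (f x) (g x))"
proof -
  have "smooth_map X (composable_pairs \<Gamma>) (\<lambda>x. (f x, g x))"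
    unfolding smooth_map_def composable_pairs_def pts_subspace plot_subspace_iff pts_prod plot_prod_iff
  proof (intro conjI allI impI)
    fix n U p assume p: "plot X n U p"
    then show "plot (arr \<Gamma>) n U (\<lambda>u. fst (((\<lambda>x. (f x, g x)) \<circ> p) u))"
      "plot (arr \<Gamma>) n U (\<lambda>u. snd (((\<lambda>x. (f x, g x)) \<circ> p) u))"
      using smooth_mapD(2)[OF assms(1)] smooth_mapD(2)[OF assms(2)] by simp_all
    show "((\<lambda>x. (f x, g x)) \<circ> p) ` U \<subseteq> {(g, h). src \<Gamma> g = rng \<Gamma> h}"
      using plotD(2)[OF X p] assms(3) by auto
  qed (use smooth_mapD(1)[OF assms(1)] smooth_mapD(1)[OF assms(2)] assms(3) in auto)
  moreover have "smooth_map (composable_pairs \<Gamma>) (arr \<Gamma>) (\<lambda>(g, h). gcomp \<Gamma> g h)"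
    using \<Gamma> by (simp add: diffeological_groupoid_def)
  ultimately have "smooth_map X (arr \<Gamma>) (\<lambda>x. (\<lambda>(g, h). gcomp \<Gamma> g h) (f x, g x))"
    by (rule smooth_map_compose)
  then show ?thesis by simp
qed

text \<open>
  A plot of a disjoint union stays locally in one summand, so smoothness on the arrows of the Cech
  groupoid is smoothness on each pairwise intersection.
\<close>

lemma smooth_map_cech_iff:
  assumes X: "diffeological_space X"
  shows "smooth_map (arr (cech_groupoid X U)) (arr \<Gamma>) h \<longleftrightarrow>
    (\<forall>i j. smooth_map (subspace_diffeology X (U i \<inter> U j)) (arr \<Gamma>) (\<lambda>x. h (x, i, j)))"
    (is "smooth_map ?C _ h \<longleftrightarrow> ?R")
proof
  have pts: "pts ?C = {(x, i, j). x \<in> pts X \<and> x \<in> U i \<and> x \<in> U j}"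
    by (auto simp: cech_groupoid_def sum_diffeology_def pts_subspace)
  have plot: "plot ?C n W p \<longleftrightarrow> openin (Euclidean_space n) W \<and>
      (\<forall>u\<in>W. \<exists>V i j. openin (Euclidean_space n) V \<and> u \<in> V \<and> V \<subseteq> W \<and> (\<forall>v\<in>V. snd (p v) = (i, j)) \<and>
         plot X n V (\<lambda>v. fst (p v)) \<and> (\<forall>v\<in>V. fst (p v) \<in> U i \<inter> U j))" for n W p
    by (simp add: cech_groupoid_def sum_diffeology_def plot_subspace_iff o_def image_subset_iff ball_conj_distrib)
  {
    assume h: "smooth_map ?C (arr \<Gamma>) h"
    show ?R
    proof (intro allI)
      fix i j
      have "smooth_map (subspace_diffeology X (U i \<inter> U j)) ?C (\<lambda>x. (x, i, j))"
        unfolding smooth_map_def pts plot pts_subspace plot_subspace_iff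
        using plotD(1)[OF X] by (fastforce simp: o_def)
      from smooth_map_compose[OF this h]
      show "smooth_map (subspace_diffeology X (U i \<inter> U j)) (arr \<Gamma>) (\<lambda>x. h (x, i, j))" .
    qed
  next
    assume R: ?R
    have "h z \<in> pts (arr \<Gamma>)" if "z \<in> pts ?C" for z
    proof -
      obtain x i j where z: "z = (x, i, j)" "x \<in> pts X" "x \<in> U i \<inter> U j"
        using \<open>z \<in> pts ?C\<close> unfolding pts by auto
      have "smooth_map (subspace_diffeology X (U i \<inter> U j)) (arr \<Gamma>) (\<lambda>x. h (x, i, j))" using R by simp
      from smooth_mapD(1)[OF this, of x] show ?thesis using z by (auto simp: pts_subspace)
    qed
    moreover have "plot (arr \<Gamma>) n W (h \<circ> p)" if p: "plot ?C n W p" for n W p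
    proof (rule plot_locally[OF arr_diffeological])
      show "openin (Euclidean_space n) W" using p by (simp add: plot)
      fix u assume "u \<in> W"
      then obtain V i j where V: "openin (Euclidean_space n) V" "u \<in> V" "V \<subseteq> W"
        "\<forall>v\<in>V. snd (p v) = (i, j)" "plot X n V (\<lambda>v. fst (p v))" "\<forall>v\<in>V. fst (p v) \<in> U i \<inter> U j"
        using p unfolding plot by metis
      have "smooth_map (subspace_diffeology X (U i \<inter> U j)) (arr \<Gamma>) (\<lambda>x. h (x, i, j))"
        using R by simp
      moreover have "plot (subspace_diffeology X (U i \<inter> U j)) n V (\<lambda>v. fst (p v))"
        using V(5,6) by (auto simp: plot_subspace_iff)
      ultimately have "plot (arr \<Gamma>) n V (\<lambda>v. h (fst (p v), i, j))"
        by (rule smooth_mapD(2))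
      then have "plot (arr \<Gamma>) n V (h \<circ> p)"
        by (rule plot_cong[OF arr_diffeological]) (use V(4) in \<open>auto simp: o_def\<close>, metis prod.collapse)
      then show "\<exists>V. openin (Euclidean_space n) V \<and> u \<in> V \<and> V \<subseteq> W \<and> plot (arr \<Gamma>) n V (h \<circ> p)"
        using V by blast
    qed
    ultimately show "smooth_map ?C (arr \<Gamma>) h" by (auto simp: smooth_map_def)
  }
qed

lemma is_cocycle_iff:
  assumes X: "diffeological_space X"
  shows "is_cocycle X \<Gamma> (U, h) \<longleftrightarrow> D_open_cover X U \<and>
    (\<forall>i j. smooth_map (subspace_diffeology X (U i \<inter> U j)) (arr \<Gamma>) (\<lambda>x. h (x, i, j))) \<and>
    (\<forall>i j x. x \<in> U i \<longrightarrow> x \<in> U j \<longrightarrow> rng \<Gamma> (h (x, i, j)) = h (x, i, i) \<and> src \<Gamma> (h (x, i, j)) = h (x, j, j)) \<and>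
    (\<forall>i j k x. x \<in> U i \<longrightarrow> x \<in> U j \<longrightarrow> x \<in> U k \<longrightarrow> gcomp \<Gamma> (h (x, i, j)) (h (x, j, k)) = h (x, i, k))"
proof (cases "D_open_cover X U")
  case True
  have pts: "pts (arr (cech_groupoid X U)) = {(x, i, j). x \<in> U i \<and> x \<in> U j}"
    using D_open_coverD(2)[OF True] by (auto simp: cech_groupoid_def sum_diffeology_def pts_subspace)
  have sel: "rng (cech_groupoid X U) = (\<lambda>(x, i, j). (x, i, i))"
    "src (cech_groupoid X U) = (\<lambda>(x, i, j). (x, j, j))"
    "gcomp (cech_groupoid X U) = (\<lambda>(x, i, j) (y, k, l). (x, i, l))"
    by (simp_all add: cech_groupoid_def)
  have 1: "(\<forall>g\<in>pts (arr (cech_groupoid X U)). Q g) \<longleftrightarrow> (\<forall>i j x. x \<in> U i \<longrightarrow> x \<in> U j \<longrightarrow> Q (x, i, j))" for Q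
    unfolding pts by auto
  have 2: "(\<forall>k l y. y \<in> U k \<longrightarrow> y \<in> U l \<longrightarrow> (x, j, j) = (y, k, k) \<longrightarrow> h (x, i, l) = Q y k l) \<longleftrightarrow>
      (\<forall>l. x \<in> U j \<longrightarrow> x \<in> U l \<longrightarrow> Q x j l = h (x, i, l))" for x i j Q
    by auto
  have 3: "(\<forall>i j x. x \<in> U i \<longrightarrow> x \<in> U j \<longrightarrow> (\<forall>k. x \<in> U j \<longrightarrow> x \<in> U k \<longrightarrow> Q i j k x)) \<longleftrightarrow>
      (\<forall>i j k x. x \<in> U i \<longrightarrow> x \<in> U j \<longrightarrow> x \<in> U k \<longrightarrow> Q i j k x)" for Q
    by auto
  show ?thesis
    unfolding is_cocycle_def smooth_groupoid_morphism_def fst_conv snd_conv smooth_map_cech_iff[OF X]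
      1 sel prod.case 2 3
    using True by (simp add: eq_commute)
qed (simp add: is_cocycle_def)

lemma is_cocycleI:
  assumes "diffeological_space X" "D_open_cover X U"
    "\<And>i j. smooth_map (subspace_diffeology X (U i \<inter> U j)) (arr \<Gamma>) (\<lambda>x. h (x, i, j))"
    "\<And>i j x. x \<in> U i \<Longrightarrow> x \<in> U j \<Longrightarrow> rng \<Gamma> (h (x, i, j)) = h (x, i, i)"
    "\<And>i j x. x \<in> U i \<Longrightarrow> x \<in> U j \<Longrightarrow> src \<Gamma> (h (x, i, j)) = h (x, j, j)"
    "\<And>i j k x. x \<in> U i \<Longrightarrow> x \<in> U j \<Longrightarrow> x \<in> U k \<Longrightarrow> gcomp \<Gamma> (h (x, i, j)) (h (x, j, k)) = h (x, i, k)"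
  shows "is_cocycle X \<Gamma> (U, h)"
  using assms by (simp add: is_cocycle_iff)

lemma cocycle_cover: "is_cocycle X \<Gamma> c \<Longrightarrow> D_open_cover X (fst c)"
  by (simp add: is_cocycle_def)

lemma cocycleD:
  assumes X: "diffeological_space X" and c: "is_cocycle X \<Gamma> c"
  shows "smooth_map (subspace_diffeology X (fst c i \<inter> fst c j)) (arr \<Gamma>) (\<lambda>x. snd c (x, i, j))"
    and "x \<in> fst c i \<Longrightarrow> x \<in> fst c j \<Longrightarrow> snd c (x, i, j) \<in> pts (arr \<Gamma>)"
    and "x \<in> fst c i \<Longrightarrow> x \<in> fst c j \<Longrightarrow> rng \<Gamma> (snd c (x, i, j)) = snd c (x, i, i)"
    and "x \<in> fst c i \<Longrightarrow> x \<in> fst c j \<Longrightarrow> src \<Gamma> (snd c (x, i, j)) = snd c (x, j, j)"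
    and "x \<in> fst c i \<Longrightarrow> x \<in> fst c j \<Longrightarrow> x \<in> fst c k \<Longrightarrow>
      gcomp \<Gamma> (snd c (x, i, j)) (snd c (x, j, k)) = snd c (x, i, k)"
proof -
  obtain U h where [simp]: "c = (U, h)" by fastforce
  note * = c[unfolded \<open>c = (U, h)\<close> is_cocycle_iff[OF X]]
  show sm: "smooth_map (subspace_diffeology X (fst c i \<inter> fst c j)) (arr \<Gamma>) (\<lambda>x. snd c (x, i, j))"
    using * by simp
  show "snd c (x, i, j) \<in> pts (arr \<Gamma>)" if "x \<in> fst c i" "x \<in> fst c j"
    using smooth_mapD(1)[OF sm, of x] that D_open_coverD(2)[OF cocycle_cover[OF c] that(1)]
    by (simp add: pts_subspace)
qed (use c[unfolded is_cocycle_iff[OF X, of "fst c" "snd c", simplified]] in auto)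

text \<open>
  Pulling a cocycle back along a map, passing to a finer cover and renaming the indices are all
  instances of one operation: the indices of a new cover are sent to indices of the old one by
  labels that are locally constant on the members of the new cover.
\<close>

definition relabel ::
    "('y \<Rightarrow> 'x) \<Rightarrow> ('j \<Rightarrow> 'y set) \<Rightarrow> ('j \<Rightarrow> 'y \<Rightarrow> 'i) \<Rightarrow> ('i, 'x, 'g) cocycle \<Rightarrow> ('j, 'y, 'g) cocycle" where
  "relabel f V l c = (V, \<lambda>(y, j, j'). snd c (f y, l j y, l j' y))"

definition labelling ::
    "'y diffeology \<Rightarrow> ('y \<Rightarrow> 'x) \<Rightarrow> ('j \<Rightarrow> 'y set) \<Rightarrow> ('j \<Rightarrow> 'y \<Rightarrow> 'i) \<Rightarrow> ('i, 'x, 'g) cocycle \<Rightarrow> bool" where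
  "labelling Y f V l c \<longleftrightarrow> D_open_cover Y V \<and> (\<forall>j. \<forall>y\<in>V j. f y \<in> fst c (l j y)) \<and>
     (\<forall>j i. openin (D_topology Y) {y \<in> V j. l j y = i})"

lemma is_cocycle_relabel:
  assumes X: "diffeological_space X" and Y: "diffeological_space Y"
    and c: "is_cocycle X \<Gamma> c" and f: "smooth_map Y X f" and l: "labelling Y f V l c"
  shows "is_cocycle Y \<Gamma> (relabel f V l c)"
  unfolding relabel_def
proof (rule is_cocycleI[OF Y], simp_all)
  have V: "D_open_cover Y V" and lU: "\<And>j y. y \<in> V j \<Longrightarrow> f y \<in> fst c (l j y)"
    and lo: "\<And>j i. openin (D_topology Y) {y \<in> V j. l j y = i}"
    using l by (auto simp: labelling_def)
  show "D_open_cover Y V" by fact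
  fix i j
  show "smooth_map (subspace_diffeology Y (V i \<inter> V j)) (arr \<Gamma>) (\<lambda>y. snd c (f y, l i y, l j y))"
  proof (rule smooth_map_subspace_locally[OF Y arr_diffeological])
    fix y assume y: "y \<in> V i \<inter> V j"
    define W where "W = {z \<in> V i. l i z = l i y} \<inter> {z \<in> V j. l j z = l j y}"
    have "smooth_map (subspace_diffeology Y (W \<inter> (V i \<inter> V j))) (arr \<Gamma>) (\<lambda>z. snd c (f z, l i y, l j y))"
    proof (rule smooth_map_subspace_compose[OF cocycleD(1)[OF X c] f])
      fix z assume "z \<in> W \<inter> (V i \<inter> V j)"
      then show "f z \<in> fst c (l i y) \<inter> fst c (l j y)"
        using lU[of z i] lU[of z j] by (simp add: W_def)
    qed
    moreover have "openin (D_topology Y) W" unfolding W_def by (intro openin_Int lo)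
    ultimately show "\<exists>V' g. openin (D_topology Y) V' \<and> y \<in> V' \<and>
        smooth_map (subspace_diffeology Y (V' \<inter> (V i \<inter> V j))) (arr \<Gamma>) g \<and>
        (\<forall>z\<in>V' \<inter> (V i \<inter> V j). snd c (f z, l i z, l j z) = g z)"
      using y by (intro exI[of _ W] exI[of _ "\<lambda>z. snd c (f z, l i y, l j y)"]) (auto simp: W_def)
  qed
qed (use l cocycleD[OF X c] in \<open>auto simp: labelling_def\<close>)

lemma equivalent_cocyclesI:
  assumes X: "diffeological_space X"
    and "is_cocycle X \<Gamma> (case_sum (fst c) (fst d), k)"
    and "is_cocycle X \<Gamma> c" "is_cocycle X \<Gamma> d"
    and "\<And>i j x. x \<in> fst c i \<Longrightarrow> x \<in> fst c j \<Longrightarrow> k (x, Inl i, Inl j) = snd c (x, i, j)"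
    and "\<And>i j x. x \<in> fst d i \<Longrightarrow> x \<in> fst d j \<Longrightarrow> k (x, Inr i, Inr j) = snd d (x, i, j)"
  shows "equivalent_cocycles X \<Gamma> c d"
  using assms unfolding equivalent_cocycles_def by blast

lemma D_open_cover_case_sum:
  assumes "D_open_cover X U" "D_open_cover X V"
  shows "D_open_cover X (case_sum U V)"
  using assms by (auto simp: D_open_cover_def UNIV_sum split: sum.split)

text \<open>
  The two covers together, with both families of labels, are once more a relabelling of the same
  cocycle; the resulting cocycle over the union of the covers witnesses the equivalence.
\<close>

lemma relabel_equivalent:
  assumes X: "diffeological_space X" and Y: "diffeological_space Y"
    and c: "is_cocycle X \<Gamma> c" and f: "smooth_map Y X f"
    and l: "labelling Y f V l c" and l': "labelling Y f V' l' c"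
  shows "equivalent_cocycles Y \<Gamma> (relabel f V l c) (relabel f V' l' c)"
proof -
  have "labelling Y f (case_sum V V') (case_sum l l') c"
    using l l' D_open_cover_case_sum[of Y V V'] by (auto simp: labelling_def split: sum.split)
  from is_cocycle_relabel[OF X Y c f this]
  show ?thesis
    by (intro equivalent_cocyclesI[OF Y, where k="snd (relabel f (case_sum V V') (case_sum l l') c)"]
        is_cocycle_relabel[OF X Y c f] l l') (simp_all add: relabel_def)
qed

lemma labelling_const:
  assumes "D_open_cover Y V" "\<And>j y. y \<in> V j \<Longrightarrow> f y \<in> fst c (l j)"
  shows "labelling Y f V (\<lambda>j _. l j) c"
proof -
  have "{y \<in> V j. l j = i} = (if l j = i then V j else {})" for i j by auto
  then show ?thesis using assms by (auto simp: labelling_def D_open_cover_def)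
qed

lemma pullback_cocycle_eq_relabel:
  "pullback_cocycle Y f c = relabel f (\<lambda>i. {y \<in> pts Y. f y \<in> fst c i}) (\<lambda>i _. i) c"
  by (simp add: pullback_cocycle_def relabel_def)

lemma labelling_pullback:
  assumes Y: "diffeological_space Y" and f: "smooth_map Y X f" and c: "is_cocycle X \<Gamma> c"
  shows "labelling Y f (\<lambda>i. {y \<in> pts Y. f y \<in> fst c i}) (\<lambda>i _. i) c"
proof (rule labelling_const)
  show "D_open_cover Y (\<lambda>i. {y \<in> pts Y. f y \<in> fst c i})"
    using cocycle_cover[OF c] openin_D_topology_preimage[OF Y f] smooth_mapD(1)[OF f]
    by (auto simp: D_open_cover_def)
qed simp

lemma is_cocycle_pullback:
  assumes "diffeological_space X" "diffeological_space Y" "smooth_map Y X f" "is_cocycle X \<Gamma> c"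
  shows "is_cocycle Y \<Gamma> (pullback_cocycle Y f c)"
  unfolding pullback_cocycle_eq_relabel
  using assms by (intro is_cocycle_relabel labelling_pullback)

lemma relabel_equivalent_pullback:
  assumes "diffeological_space X" "diffeological_space Y" "smooth_map Y X f" "is_cocycle X \<Gamma> c"
    "labelling Y f V l c"
  shows "equivalent_cocycles Y \<Gamma> (relabel f V l c) (pullback_cocycle Y f c)"
  unfolding pullback_cocycle_eq_relabel
  using assms by (intro relabel_equivalent labelling_pullback)

lemma pullback_cocycle_ident: "is_cocycle X \<Gamma> c \<Longrightarrow> pullback_cocycle X (\<lambda>x. x) c = c"
  using D_open_coverD(2)[OF cocycle_cover, of X c]
  by (auto simp: pullback_cocycle_def prod_eq_iff fun_eq_iff)

lemma pullback_cocycle_compose: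
  "(\<And>x. x \<in> pts X \<Longrightarrow> f x \<in> pts Y) \<Longrightarrow>
    pullback_cocycle X f (pullback_cocycle Y g c) = pullback_cocycle X (\<lambda>x. g (f x)) c"
  by (auto simp: pullback_cocycle_def fun_eq_iff)

lemma equivalent_cocycles_refl:
  assumes "diffeological_space X" "is_cocycle X \<Gamma> c"
  shows "equivalent_cocycles X \<Gamma> c c"
proof -
  have "labelling X (\<lambda>x. x) (fst c) (\<lambda>i _. i) c"
    by (rule labelling_const) (use cocycle_cover[OF assms(2)] in auto)
  moreover have "relabel (\<lambda>x. x) (fst c) (\<lambda>i _. i) c = c" by (simp add: relabel_def)
  ultimately show ?thesis
    using relabel_equivalent[OF assms(1,1,2) smooth_map_ident] by metis
qed

lemma equivalent_cocycles_cong: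
  assumes X: "diffeological_space X" and c: "is_cocycle X \<Gamma> c" and d: "is_cocycle X \<Gamma> d"
    and "fst c = fst d"
    and "\<And>i j x. x \<in> fst c i \<Longrightarrow> x \<in> fst c j \<Longrightarrow> snd c (x, i, j) = snd d (x, i, j)"
  shows "equivalent_cocycles X \<Gamma> c d"
  using equivalent_cocycles_refl[OF X c] assms unfolding equivalent_cocycles_def by auto

lemma equivalent_cocycles_pullback:
  assumes X: "diffeological_space X" and Y: "diffeological_space Y" and f: "smooth_map Y X f"
    and e: "equivalent_cocycles X \<Gamma> c d"
  shows "equivalent_cocycles Y \<Gamma> (pullback_cocycle Y f c) (pullback_cocycle Y f d)"
proof -
  obtain k where k: "is_cocycle X \<Gamma> (case_sum (fst c) (fst d), k)"
    "\<forall>i j. \<forall>x \<in> fst c i \<inter> fst c j. k (x, Inl i, Inl j) = snd c (x, i, j)"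
    "\<forall>i j. \<forall>x \<in> fst d i \<inter> fst d j. k (x, Inr i, Inr j) = snd d (x, i, j)"
    and cd: "is_cocycle X \<Gamma> c" "is_cocycle X \<Gamma> d"
    using e unfolding equivalent_cocycles_def by blast
  have "fst (pullback_cocycle Y f (case_sum (fst c) (fst d), k)) =
      case_sum (fst (pullback_cocycle Y f c)) (fst (pullback_cocycle Y f d))"
    by (auto simp: pullback_cocycle_def fun_eq_iff split: sum.split)
  then have "is_cocycle Y \<Gamma> (case_sum (fst (pullback_cocycle Y f c)) (fst (pullback_cocycle Y f d)),
      snd (pullback_cocycle Y f (case_sum (fst c) (fst d), k)))"
    using is_cocycle_pullback[OF X Y f k(1)] by (metis prod.collapse)
  then show ?thesis
    by (rule equivalent_cocyclesI[OF Y])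
      (use k(2,3) is_cocycle_pullback[OF X Y f cd(1)] is_cocycle_pullback[OF X Y f cd(2)] in
        \<open>auto simp: pullback_cocycle_def\<close>)
qed

lemma equivalent_cocycles_sym:
  assumes X: "diffeological_space X" and e: "equivalent_cocycles X \<Gamma> c d"
  shows "equivalent_cocycles X \<Gamma> d c"
proof -
  obtain k where k: "is_cocycle X \<Gamma> (case_sum (fst c) (fst d), k)"
    "\<forall>i j. \<forall>x \<in> fst c i \<inter> fst c j. k (x, Inl i, Inl j) = snd c (x, i, j)"
    "\<forall>i j. \<forall>x \<in> fst d i \<inter> fst d j. k (x, Inr i, Inr j) = snd d (x, i, j)"
    and cd: "is_cocycle X \<Gamma> c" "is_cocycle X \<Gamma> d"
    using e unfolding equivalent_cocycles_def by blast
  define V where "V = case_sum (fst d) (fst c)"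
  have "labelling X (\<lambda>x. x) V (\<lambda>j _. case_sum Inr Inl j) (case_sum (fst c) (fst d), k)"
    using D_open_cover_case_sum[OF cocycle_cover[OF cd(2)] cocycle_cover[OF cd(1)]]
    by (intro labelling_const) (auto simp: V_def split: sum.splits)
  from is_cocycle_relabel[OF X X k(1) smooth_map_ident this]
  show ?thesis
    unfolding relabel_def V_def
    by (rule equivalent_cocyclesI[OF X]) (use k(2,3) cd in auto)
qed

text \<open>
  A cocycle can be rebuilt from transition arrows to and from an auxiliary cocycle \<open>d\<close>: the arrow
  from \<open>b\<close> to \<open>a\<close> is the composite through any index \<open>v\<close> of \<open>d\<close>, and does not depend on \<open>v\<close>.
\<close>

lemma cocycle_through:
  fixes T :: "'a \<Rightarrow> 'v \<Rightarrow> 'x \<Rightarrow> 'g" and S :: "'v \<Rightarrow> 'a \<Rightarrow> 'x \<Rightarrow> 'g"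
  assumes X: "diffeological_space X" and d: "is_cocycle X \<Gamma> d" and A: "D_open_cover X A"
    and smT: "\<And>a v. smooth_map (subspace_diffeology X (A a \<inter> fst d v)) (arr \<Gamma>) (T a v)"
    and smS: "\<And>a v. smooth_map (subspace_diffeology X (A a \<inter> fst d v)) (arr \<Gamma>) (S v a)"
    and srcT: "\<And>a v x. x \<in> A a \<Longrightarrow> x \<in> fst d v \<Longrightarrow> src \<Gamma> (T a v x) = snd d (x, v, v)"
    and rngS: "\<And>a v x. x \<in> A a \<Longrightarrow> x \<in> fst d v \<Longrightarrow> rng \<Gamma> (S v a x) = snd d (x, v, v)"
    and TS: "\<And>a v x. x \<in> A a \<Longrightarrow> x \<in> fst d v \<Longrightarrow> rng \<Gamma> (T a v x) = gcomp \<Gamma> (T a v x) (S v a x)"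
      "\<And>a v x. x \<in> A a \<Longrightarrow> x \<in> fst d v \<Longrightarrow> src \<Gamma> (S v a x) = gcomp \<Gamma> (T a v x) (S v a x)"
    and ST: "\<And>a v x. x \<in> A a \<Longrightarrow> x \<in> fst d v \<Longrightarrow> gcomp \<Gamma> (S v a x) (T a v x) = snd d (x, v, v)"
    and Td: "\<And>a v v' x. x \<in> A a \<Longrightarrow> x \<in> fst d v \<Longrightarrow> x \<in> fst d v' \<Longrightarrow>
      gcomp \<Gamma> (T a v x) (snd d (x, v, v')) = T a v' x"
    and dS: "\<And>a v v' x. x \<in> A a \<Longrightarrow> x \<in> fst d v \<Longrightarrow> x \<in> fst d v' \<Longrightarrow>
      gcomp \<Gamma> (snd d (x, v, v')) (S v' a x) = S v a x"
  obtains m where "is_cocycle X \<Gamma> (A, m)"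
    "\<And>a b v x. x \<in> A a \<Longrightarrow> x \<in> A b \<Longrightarrow> x \<in> fst d v \<Longrightarrow> m (x, a, b) = gcomp \<Gamma> (T a v x) (S v b x)"
proof
  define m where "m = (\<lambda>(x, a, b). let v = SOME v. x \<in> fst d v in gcomp \<Gamma> (T a v x) (S v b x))"
  note [simp] = gcomp_closed cocycleD(2-4)[OF X d] srcT rngS
  have T: "T a v x \<in> pts (arr \<Gamma>)" and S: "S v a x \<in> pts (arr \<Gamma>)" if "x \<in> A a" "x \<in> fst d v" for a v x
    using that smooth_mapD(1)[OF smT, of x] smooth_mapD(1)[OF smS, of x] D_open_coverD(2)[OF A]
    by (auto simp: pts_subspace)
  have rngT_srcS: "rng \<Gamma> (T a v x) = src \<Gamma> (S v a x)" if "x \<in> A a" "x \<in> fst d v" for a v x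
    using TS[OF that] by simp
  have indep: "gcomp \<Gamma> (T a v' x) (S v' b x) = gcomp \<Gamma> (T a v x) (S v b x)"
    if "x \<in> A a" "x \<in> A b" "x \<in> fst d v" "x \<in> fst d v'" for a b v v' x
  proof -
    have "gcomp \<Gamma> (T a v' x) (S v' b x) = gcomp \<Gamma> (gcomp \<Gamma> (T a v x) (snd d (x, v, v'))) (S v' b x)"
      using that by (simp add: Td)
    also have "\<dots> = gcomp \<Gamma> (T a v x) (S v b x)"
      using that T S by (simp add: gcomp_assoc dS)
    finally show ?thesis .
  qed
  show m: "m (x, a, b) = gcomp \<Gamma> (T a v x) (S v b x)" if "x \<in> A a" "x \<in> A b" "x \<in> fst d v" for a b v x
    unfolding m_def Let_def prod.case using that by (intro indep) (auto intro: someI)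
  show "is_cocycle X \<Gamma> (A, m)"
  proof (rule is_cocycleI[OF X A])
    have ex: "\<exists>v. x \<in> fst d v" if "x \<in> A a" for x a
      using D_open_coverD(3)[OF cocycle_cover[OF d]] D_open_coverD(2)[OF A that] .
    fix a b c
    show "smooth_map (subspace_diffeology X (A a \<inter> A b)) (arr \<Gamma>) (\<lambda>x. m (x, a, b))"
    proof (rule smooth_map_subspace_locally[OF X arr_diffeological])
      fix x assume x: "x \<in> A a \<inter> A b"
      then obtain v where v: "x \<in> fst d v" using ex by blast
      let ?D = "fst d v \<inter> (A a \<inter> A b)"
      have "smooth_map (subspace_diffeology X ?D) (arr \<Gamma>) (\<lambda>y. gcomp \<Gamma> (T a v y) (S v b y))"
      proof (rule smooth_map_gcomp)
        show "smooth_map (subspace_diffeology X ?D) (arr \<Gamma>) (T a v)"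
          by (rule smooth_map_subspace_mono[OF smT]) auto
        show "smooth_map (subspace_diffeology X ?D) (arr \<Gamma>) (S v b)"
          by (rule smooth_map_subspace_mono[OF smS]) auto
      qed (auto simp: pts_subspace diffeological_space_subspace[OF X])
      then show "\<exists>V g. openin (D_topology X) V \<and> x \<in> V \<and>
          smooth_map (subspace_diffeology X (V \<inter> (A a \<inter> A b))) (arr \<Gamma>) g \<and>
          (\<forall>y\<in>V \<inter> (A a \<inter> A b). m (y, a, b) = g y)"
        using v D_open_coverD(1)[OF cocycle_cover[OF d]] m
        by (intro exI[of _ "fst d v"] exI[of _ "\<lambda>y. gcomp \<Gamma> (T a v y) (S v b y)"]) simp
    qed
    fix x assume x: "x \<in> A a" "x \<in> A b"
    then obtain v where v: "x \<in> fst d v" using ex by blast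
    show "rng \<Gamma> (m (x, a, b)) = m (x, a, a)" "src \<Gamma> (m (x, a, b)) = m (x, b, b)"
      using x v T S by (simp_all add: m TS[symmetric] rngT_srcS)
    assume c: "x \<in> A c"
    have "gcomp \<Gamma> (m (x, a, b)) (m (x, b, c)) =
        gcomp \<Gamma> (gcomp \<Gamma> (T a v x) (S v b x)) (gcomp \<Gamma> (T b v x) (S v c x))"
      using x c v by (simp add: m)
    also have "\<dots> = gcomp \<Gamma> (T a v x) (gcomp \<Gamma> (S v b x) (gcomp \<Gamma> (T b v x) (S v c x)))"
      using x c v T S by (intro gcomp_assoc) (simp_all add: rngT_srcS)
    also have "gcomp \<Gamma> (S v b x) (gcomp \<Gamma> (T b v x) (S v c x)) =
        gcomp \<Gamma> (gcomp \<Gamma> (S v b x) (T b v x)) (S v c x)"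
      using x c v T S by (intro gcomp_assoc[symmetric]) (simp_all add: rngT_srcS)
    also have "\<dots> = S v c x" using x c v by (simp add: ST dS)
    finally show "gcomp \<Gamma> (m (x, a, b)) (m (x, b, c)) = m (x, a, c)"
      using x c v by (simp add: m)
  qed
qed

text \<open>
  The transition arrows between the outer two covers run through the middle one: \<open>T\<close> and \<open>S\<close> collect
  the mixed components of the two given cocycles over unions of covers.
\<close>

lemma equivalent_cocycles_trans:
  assumes X: "diffeological_space X"
    and cd: "equivalent_cocycles X \<Gamma> c d" and de: "equivalent_cocycles X \<Gamma> d e"
  shows "equivalent_cocycles X \<Gamma> c e"
proof -
  obtain k where k: "is_cocycle X \<Gamma> (case_sum (fst c) (fst d), k)"
    "\<And>i j x. x \<in> fst c i \<Longrightarrow> x \<in> fst c j \<Longrightarrow> k (x, Inl i, Inl j) = snd c (x, i, j)"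
    "\<And>i j x. x \<in> fst d i \<Longrightarrow> x \<in> fst d j \<Longrightarrow> k (x, Inr i, Inr j) = snd d (x, i, j)"
    and c: "is_cocycle X \<Gamma> c" and d: "is_cocycle X \<Gamma> d"
    using cd unfolding equivalent_cocycles_def by blast
  obtain l where l: "is_cocycle X \<Gamma> (case_sum (fst d) (fst e), l)"
    "\<And>i j x. x \<in> fst d i \<Longrightarrow> x \<in> fst d j \<Longrightarrow> l (x, Inl i, Inl j) = snd d (x, i, j)"
    "\<And>i j x. x \<in> fst e i \<Longrightarrow> x \<in> fst e j \<Longrightarrow> l (x, Inr i, Inr j) = snd e (x, i, j)"
    and e: "is_cocycle X \<Gamma> e"
    using de unfolding equivalent_cocycles_def by blast
  define A where "A = case_sum (fst c) (fst e)"
  define T where "T a v x = (case a of Inl i \<Rightarrow> k (x, Inl i, Inr v) | Inr i \<Rightarrow> l (x, Inr i, Inl v))" for a v x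
  define S where "S v a x = (case a of Inl i \<Rightarrow> k (x, Inr v, Inl i) | Inr i \<Rightarrow> l (x, Inl v, Inr i))" for a v x
  note kD = cocycleD[OF X k(1), simplified] and lD = cocycleD[OF X l(1), simplified]
  have sm: "smooth_map (subspace_diffeology X (A a \<inter> fst d v)) (arr \<Gamma>) (T a v)"
      "smooth_map (subspace_diffeology X (A a \<inter> fst d v)) (arr \<Gamma>) (S v a)" for a v
    using kD(1)[of "Inl (projl a)" "Inr v"] kD(1)[of "Inr v" "Inl (projl a)"]
      lD(1)[of "Inr (projr a)" "Inl v"] lD(1)[of "Inl v" "Inr (projr a)"]
    by (cases a; simp add: A_def T_def[abs_def] S_def[abs_def] Int_commute)+
  have Inl: "src \<Gamma> (T (Inl i) v x) = snd d (x, v, v)" "rng \<Gamma> (S v (Inl i) x) = snd d (x, v, v)"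
    "gcomp \<Gamma> (T (Inl i) v x) (S v (Inl i') x) = k (x, Inl i, Inl i')"
    "rng \<Gamma> (T (Inl i) v x) = k (x, Inl i, Inl i)" "src \<Gamma> (S v (Inl i) x) = k (x, Inl i, Inl i)"
    "gcomp \<Gamma> (S v (Inl i) x) (T (Inl i) v x) = snd d (x, v, v)"
    "x \<in> fst d v' \<Longrightarrow> gcomp \<Gamma> (T (Inl i) v x) (snd d (x, v, v')) = T (Inl i) v' x"
    "x \<in> fst d v' \<Longrightarrow> gcomp \<Gamma> (snd d (x, v, v')) (S v' (Inl i) x) = S v (Inl i) x"
    if "x \<in> fst c i" "x \<in> fst c i'" "x \<in> fst d v" for x i i' v v'
    using that by (simp_all add: T_def S_def kD k(3)[symmetric])
  have Inr: "src \<Gamma> (T (Inr i) v x) = snd d (x, v, v)" "rng \<Gamma> (S v (Inr i) x) = snd d (x, v, v)"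
    "gcomp \<Gamma> (T (Inr i) v x) (S v (Inr i') x) = l (x, Inr i, Inr i')"
    "rng \<Gamma> (T (Inr i) v x) = l (x, Inr i, Inr i)" "src \<Gamma> (S v (Inr i) x) = l (x, Inr i, Inr i)"
    "gcomp \<Gamma> (S v (Inr i) x) (T (Inr i) v x) = snd d (x, v, v)"
    "x \<in> fst d v' \<Longrightarrow> gcomp \<Gamma> (T (Inr i) v x) (snd d (x, v, v')) = T (Inr i) v' x"
    "x \<in> fst d v' \<Longrightarrow> gcomp \<Gamma> (snd d (x, v, v')) (S v' (Inr i) x) = S v (Inr i) x"
    if "x \<in> fst e i" "x \<in> fst e i'" "x \<in> fst d v" for x i i' v v'
    using that by (simp_all add: T_def S_def lD l(2)[symmetric])
  have A: "D_open_cover X A"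
    unfolding A_def using c e by (intro D_open_cover_case_sum cocycle_cover)
  obtain m where m: "is_cocycle X \<Gamma> (A, m)"
    "\<And>a b v x. x \<in> A a \<Longrightarrow> x \<in> A b \<Longrightarrow> x \<in> fst d v \<Longrightarrow> m (x, a, b) = gcomp \<Gamma> (T a v x) (S v b x)"
    by (rule cocycle_through[OF X d A sm]) (use Inl Inr in \<open>simp_all add: A_def split: sum.splits\<close>)
  have ex: "\<exists>v. x \<in> fst d v" if "x \<in> A a" for x a
    using D_open_coverD(3)[OF cocycle_cover[OF d]] D_open_coverD(2)[OF A that] .
  show ?thesis
  proof (rule equivalent_cocyclesI[OF X m(1)[unfolded A_def] c e])
    fix i j x assume ij: "x \<in> fst c i" "x \<in> fst c j"
    then obtain v where "x \<in> fst d v" using ex[of x "Inl i"] by (auto simp: A_def)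
    then show "m (x, Inl i, Inl j) = snd c (x, i, j)"
      using ij Inl(3) k(2) by (simp add: m(2) A_def)
  next
    fix i j x assume ij: "x \<in> fst e i" "x \<in> fst e j"
    then obtain v where "x \<in> fst d v" using ex[of x "Inr i"] by (auto simp: A_def)
    then show "m (x, Inr i, Inr j) = snd e (x, i, j)"
      using ij Inr(3) l(3) by (simp add: m(2) A_def)
  qed
qed

definition structure_of :: "'x diffeology \<Rightarrow> ('i, 'x, 'g) cocycle \<Rightarrow> ('i, 'x, 'g) cocycle set" where
  "structure_of X c = cocycle_rel X \<Gamma> `` {c}"

lemma equiv_cocycle_rel:
  assumes "diffeological_space X"
  shows "equiv {c :: ('i, 'x, 'g) cocycle. is_cocycle X \<Gamma> c} (cocycle_rel X \<Gamma>)"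
proof (rule equivI)
  show "cocycle_rel X \<Gamma> \<subseteq> {c :: ('i, 'x, 'g) cocycle. is_cocycle X \<Gamma> c} \<times> {c. is_cocycle X \<Gamma> c}"
    by (auto simp: cocycle_rel_def equivalent_cocycles_def)
  show "refl_on {c :: ('i, 'x, 'g) cocycle. is_cocycle X \<Gamma> c} (cocycle_rel X \<Gamma>)"
    using equivalent_cocycles_refl[OF assms] by (auto simp: refl_on_def cocycle_rel_def)
  show "sym (cocycle_rel X \<Gamma> :: (('i, 'x, 'g) cocycle \<times> ('i, 'x, 'g) cocycle) set)"
    using equivalent_cocycles_sym[OF assms] by (auto simp: sym_def cocycle_rel_def)
  show "trans (cocycle_rel X \<Gamma> :: (('i, 'x, 'g) cocycle \<times> ('i, 'x, 'g) cocycle) set)"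
    unfolding trans_def cocycle_rel_def using equivalent_cocycles_trans[OF assms] by blast
qed

lemma mem_structure_of: "d \<in> structure_of X c \<longleftrightarrow> equivalent_cocycles X \<Gamma> c d"
  by (simp add: structure_of_def cocycle_rel_def)

lemma structure_of_eq_iff:
  assumes "diffeological_space X" "is_cocycle X \<Gamma> c" "is_cocycle X \<Gamma> d"
  shows "structure_of X c = structure_of X d \<longleftrightarrow> equivalent_cocycles X \<Gamma> c d"
  using eq_equiv_class_iff[OF equiv_cocycle_rel[OF assms(1)]] assms(2,3)
  by (simp add: structure_of_def cocycle_rel_def)

lemma structure_of_eqI:
  assumes "diffeological_space X" "equivalent_cocycles X \<Gamma> c d"
  shows "structure_of X c = structure_of X d"
proof -
  have "is_cocycle X \<Gamma> c" "is_cocycle X \<Gamma> d" using assms(2) by (simp_all add: equivalent_cocycles_def)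
  then show ?thesis using assms structure_of_eq_iff by blast
qed

lemma gamma_structures_iff:
  assumes "diffeological_space X"
  shows "S \<in> gamma_structures X \<Gamma> \<longleftrightarrow> (\<exists>c. is_cocycle X \<Gamma> c \<and> S = structure_of X c)"
  by (auto simp: gamma_structures_def quotient_def structure_of_def)

lemma smoothly_numerable_iff:
  assumes X: "diffeological_space X"
  shows "smoothly_numerable X \<Gamma> S \<longleftrightarrow>
    (\<exists>c. is_cocycle X \<Gamma> c \<and> smoothly_numerable_cover X (fst c) \<and> S = structure_of X c)"
proof
  assume "smoothly_numerable X \<Gamma> S"
  then obtain c d where S: "S = structure_of X c" and d: "d \<in> S" "smoothly_numerable_cover X (fst d)"
    by (auto simp: smoothly_numerable_def gamma_structures_iff[OF X])
  have e: "equivalent_cocycles X \<Gamma> c d" using S d(1) by (simp add: mem_structure_of)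
  then have "is_cocycle X \<Gamma> d" by (simp add: equivalent_cocycles_def)
  then show "\<exists>c. is_cocycle X \<Gamma> c \<and> smoothly_numerable_cover X (fst c) \<and> S = structure_of X c"
    using S d(2) structure_of_eqI[OF X e] by blast
next
  assume "\<exists>c. is_cocycle X \<Gamma> c \<and> smoothly_numerable_cover X (fst c) \<and> S = structure_of X c"
  then obtain c where c: "is_cocycle X \<Gamma> c" "smoothly_numerable_cover X (fst c)" "S = structure_of X c"
    by blast
  then have "c \<in> S" using equivalent_cocycles_refl[OF X] by (simp add: mem_structure_of)
  then show "smoothly_numerable X \<Gamma> S"
    using c unfolding smoothly_numerable_def gamma_structures_iff[OF X] by blast
qed

lemma pullback_structure_of:
  assumes X: "diffeological_space X" and Y: "diffeological_space Y" and f: "smooth_map X Y f"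
    and c: "is_cocycle Y \<Gamma> c"
  shows "pullback_structure X \<Gamma> f (structure_of Y c) = structure_of X (pullback_cocycle X f c)"
proof -
  have "structure_of X (pullback_cocycle X f d) = structure_of X (pullback_cocycle X f c)"
    if "d \<in> structure_of Y c" for d
    using that equivalent_cocycles_pullback[OF Y X f, of c d]
    by (intro structure_of_eqI[OF X, symmetric]) (simp add: mem_structure_of)
  moreover have "c \<in> structure_of Y c"
    using equivalent_cocycles_refl[OF Y c] by (simp add: mem_structure_of)
  ultimately show ?thesis
    unfolding pullback_structure_def structure_of_def[symmetric] by blast
qed

lemma pullback_structure_compose:
  assumes X: "diffeological_space X" and Y: "diffeological_space Y" and Z: "diffeological_space Z"
    and f: "smooth_map X Y f" and g: "smooth_map Y Z g" and S: "S \<in> gamma_structures Z \<Gamma>"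
  shows "pullback_structure X \<Gamma> f (pullback_structure Y \<Gamma> g S) = pullback_structure X \<Gamma> (\<lambda>x. g (f x)) S"
proof -
  obtain c where c: "is_cocycle Z \<Gamma> c" "S = structure_of Z c"
    using S gamma_structures_iff[OF Z] by blast
  show ?thesis
    unfolding c(2) pullback_structure_of[OF Y Z g c(1)]
      pullback_structure_of[OF X Y f is_cocycle_pullback[OF Z Y g c(1)]]
      pullback_structure_of[OF X Z smooth_map_compose[OF f g] c(1)]
    using pullback_cocycle_compose[of X f Y g c] smooth_mapD(1)[OF f] by simp
qed

lemma pullback_structure_ident:
  assumes X: "diffeological_space X" and S: "S \<in> gamma_structures X \<Gamma>"
  shows "pullback_structure X \<Gamma> (\<lambda>x. x) S = S"
proof -
  obtain c where c: "is_cocycle X \<Gamma> c" "S = structure_of X c"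
    using S gamma_structures_iff[OF X] by blast
  then show ?thesis
    using pullback_structure_of[OF X X smooth_map_ident c(1)] pullback_cocycle_ident[OF c(1)] by simp
qed

lemma pullback_structure_cong:
  assumes X: "diffeological_space X" and Y: "diffeological_space Y"
    and f: "smooth_map X Y f" and g: "smooth_map X Y g" and S: "S \<in> gamma_structures Y \<Gamma>"
    and eq: "\<And>x. x \<in> pts X \<Longrightarrow> f x = g x"
  shows "pullback_structure X \<Gamma> f S = pullback_structure X \<Gamma> g S"
proof -
  obtain c where c: "is_cocycle Y \<Gamma> c" "S = structure_of Y c"
    using S gamma_structures_iff[OF Y] by blast
  have "equivalent_cocycles X \<Gamma> (pullback_cocycle X f c) (pullback_cocycle X g c)"
    using is_cocycle_pullback[OF Y X f c(1)] is_cocycle_pullback[OF Y X g c(1)] eq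
    by (intro equivalent_cocycles_cong[OF X]) (auto simp: pullback_cocycle_def fun_eq_iff)
  then show ?thesis
    unfolding c(2) pullback_structure_of[OF X Y f c(1)] pullback_structure_of[OF X Y g c(1)]
    by (rule structure_of_eqI[OF X])
qed

end

section \<open>Numerable covers\<close>

text \<open>
  The function \<open>s i\<close> is positive exactly where \<open>\<tau> i\<close> exceeds \<open>1\<close>; hence its support stays inside
  \<open>\<tau> i \<ge> 1\<close>, and some \<open>s i\<close> is positive at each point. These functions need not be locally
  finite. The factor in \<open>r m\<close> that involves \<open>s j\<close> for \<open>j < m\<close> is positive when all of them
  vanish, which keeps \<open>r m\<close> positive at the first \<open>m\<close> with \<open>s m x > 0\<close>. On the other hand, where
  some \<open>s j\<close> is bounded below by a positive number, it kills \<open>r m\<close> for all large \<open>m\<close>.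
\<close>

lemma smoothly_numerable_cover_positivity_sets:
  assumes X: "diffeological_space X" and \<tau>: "\<And>i :: nat. smooth_real X (\<tau> i)"
    and big: "\<And>x. x \<in> pts X \<Longrightarrow> \<exists>i. \<tau> i x > 1"
  shows "smoothly_numerable_cover X (\<lambda>i. {x \<in> pts X. \<tau> i x > 0})"
proof -
  define s where "s i x = bump (\<tau> i x - 1)" for i x
  define r where "r m x = s m x * bump (1 - real m * (\<Sum>j<m. s j x))" for m x
  have ss: "smooth_real X (s i)" for i
    unfolding s_def[abs_def] by (intro smooth_real_bump smooth_real_diff smooth_real_const X \<tau>)
  have sr: "smooth_real X (r m)" for m
    unfolding r_def[abs_def]
    by (intro smooth_real_mult smooth_real_bump smooth_real_diff smooth_real_sum smooth_real_const X ss)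
  have s0: "s i x \<ge> 0" and s_pos: "s i x > 0 \<longleftrightarrow> \<tau> i x > 1" for i x
    by (auto simp: s_def bump_nonneg bump_pos_iff)
  have r0: "r m x \<ge> 0" for m x by (simp add: r_def s0 bump_nonneg)
  have r_imp: "\<tau> m x > 1" if "r m x > 0" for m x
    using that s_pos[of m x] s0[of m x] bump_nonneg by (auto simp: r_def zero_less_mult_iff)
  have r_ex: "\<exists>m. r m x > 0" if x: "x \<in> pts X" for x
  proof -
    define m where "m = (LEAST m. s m x > 0)"
    have m: "s m x > 0" using big[OF x] LeastI_ex[of "\<lambda>m. s m x > 0"] s_pos by (simp add: m_def)
    have "s j x = 0" if "j < m" for j
      using not_less_Least[of j "\<lambda>m. s m x > 0"] that s0[of j x] by (simp add: m_def)
    then have "r m x > 0" using m by (simp add: r_def bump_pos_iff)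
    then show ?thesis by blast
  qed
  have local: "\<exists>V N. openin (D_topology X) V \<and> x \<in> V \<and> (\<forall>y\<in>V. \<forall>m\<ge>N. r m y = 0)" if x: "x \<in> pts X" for x
  proof -
    obtain j where j: "s j x > 0" using big[OF x] s_pos by blast
    define V where "V = {y \<in> pts X. s j y > s j x / 2}"
    obtain N where N: "real N * (s j x / 2) > 1" using reals_Archimedean3[of "s j x / 2"] j by (meson half_gt_zero)
    have "r m y = 0" if y: "y \<in> V" and m: "m \<ge> max N (Suc j)" for y m
    proof -
      have "1 \<le> real N * (s j x / 2)" using N by simp
      also have "\<dots> \<le> real m * s j y"
        using y m j by (intro mult_mono) (auto simp: V_def)
      also have "\<dots> \<le> real m * (\<Sum>j<m. s j y)"
        using m s0 member_le_sum[of j "{..<m}" "\<lambda>j. s j y"] by (intro mult_left_mono) auto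
      finally show ?thesis by (simp add: r_def bump_eq_0_iff)
    qed
    moreover have "openin (D_topology X) V"
      unfolding V_def by (rule openin_smooth_real_greater[OF X ss])
    moreover have "x \<in> V" using x j by (simp add: V_def)
    ultimately show ?thesis by blast
  qed
  define R where "R x = (\<Sum>m. r m x)" for x
  have r_sums: "(\<lambda>m. r m y) sums (\<Sum>m<N. r m y)" if "\<forall>m\<ge>N. r m y = 0" for y N
    using that by (intro sums_finite) auto
  have sums_R: "(\<lambda>m. r m x) sums R x" if x: "x \<in> pts X" for x
    using local[OF x] r_sums sums_unique unfolding R_def by metis
  have r_le_R: "r m x \<le> R x" if "x \<in> pts X" for m x
    using sum_le_suminf[of "\<lambda>m. r m x" "{m}"] sums_R[OF that] r0 by (auto simp: R_def sums_iff)
  have R_pos: "R x > 0" if x: "x \<in> pts X" for x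
    using r_ex[OF x] r_le_R[OF x] by (meson less_le_trans)
  have "smooth_real X R"
  proof (rule smooth_real_locally[OF X])
    fix x assume "x \<in> pts X"
    then obtain V N where V: "openin (D_topology X) V" "x \<in> V" "\<forall>y\<in>V. \<forall>m\<ge>N. r m y = 0"
      using local by blast
    have "smooth_real X (\<lambda>y. \<Sum>m<N. r m y)" by (rule smooth_real_sum[OF X sr])
    moreover have "\<forall>y\<in>V. R y = (\<Sum>m<N. r m y)"
      using V(3) r_sums[THEN sums_unique] by (simp add: R_def)
    ultimately show "\<exists>V g. openin (D_topology X) V \<and> x \<in> V \<and> smooth_real X g \<and> (\<forall>y\<in>V. R y = g y)"
      using V by blast
  qed
  define l where "l m x = r m x * inverse (R x)" for m x
  have sl: "smooth_real X (l m)" for m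
    unfolding l_def[abs_def] using R_pos
    by (intro smooth_real_mult smooth_real_inverse X sr \<open>smooth_real X R\<close>) force
  have l01: "l m x \<in> {0..1}" if "x \<in> pts X" for m x
    using r0[of m x] r_le_R[OF that, of m] R_pos[OF that] by (simp add: l_def divide_inverse[symmetric])
  have l_pos: "r m x > 0" if "x \<in> pts X" "l m x > 0" for m x
    using that R_pos[OF that(1)] by (simp add: l_def zero_less_mult_iff)
  have part: "smooth_partition_of_unity X l"
    unfolding smooth_partition_of_unity_def
  proof (intro conjI allI ballI)
    show "smooth_map X unit_interval (l i)" for i
      using smooth_map_unit_interval_iff[OF X] sl l01 by blast
    show "(\<lambda>i. l i x) sums 1" if "x \<in> pts X" for x
      using sums_mult2[OF sums_R[OF that], of "inverse (R x)"] R_pos[OF that] by (simp add: l_def)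
  qed
  have supp: "supp_on X (l i) \<subseteq> {x \<in> pts X. \<tau> i x > 0}" for i
  proof -
    have "closedin (D_topology X) {x \<in> pts X. \<tau> i x \<ge> 1}"
    proof -
      have "pts X - {x \<in> pts X. \<tau> i x \<ge> 1} = {x \<in> pts X. \<tau> i x \<in> {..<1}}" by auto
      then show ?thesis
        using openin_smooth_real_preimage[OF X \<tau>, of "{..<1}" i]
        by (simp add: closedin_def topspace_D_topology[OF X] Collect_restrict)
    qed
    then have "supp_on X (l i) \<subseteq> {x \<in> pts X. \<tau> i x \<ge> 1}"
      unfolding supp_on_def by (rule closure_of_minimal[rotated]) (use l_pos r_imp in force)
    then show ?thesis by force
  qed
  have lf: "locally_finite_supports X l"
    unfolding locally_finite_supports_def
  proof
    fix x assume "x \<in> pts X"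
    then obtain V N where V: "openin (D_topology X) V" "x \<in> V" "\<forall>y\<in>V. \<forall>m\<ge>N. r m y = 0"
      using local by blast
    have "supp_on X (l i) \<inter> V = {}" if "i \<ge> N" for i
    proof -
      have "V \<inter> {x \<in> pts X. l i x \<in> {0<..1}} = {}" using V(3) that by (auto simp: l_def)
      then show ?thesis
        using openin_Int_closure_of_eq_empty[OF V(1)] unfolding supp_on_def by blast
    qed
    then have "{i. supp_on X (l i) \<inter> V \<noteq> {}} \<subseteq> {..<N}" using not_le by blast
    then show "\<exists>V. openin (D_topology X) V \<and> x \<in> V \<and> finite {i. supp_on X (l i) \<inter> V \<noteq> {}}"
      using V(1,2) finite_subset[OF _ finite_lessThan] by (intro exI[of _ V] conjI)
  qed
  have "D_open_cover X (\<lambda>i. {x \<in> pts X. \<tau> i x > 0})"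
    unfolding D_open_cover_def
  proof (intro conjI allI)
    show "openin (D_topology X) {x \<in> pts X. \<tau> i x > 0}" for i
      by (rule openin_smooth_real_greater[OF X \<tau>])
    show "(\<Union>i. {x \<in> pts X. \<tau> i x > 0}) = pts X" using big by (fastforce intro: less_trans[of 0 1])
  qed
  then show ?thesis
    using part lf supp unfolding smoothly_numerable_cover_def by blast
qed

text \<open>
  If all the rescaled functions \<open>2 ^ (i + 2) * l i\<close> were at most \<open>1\<close> at a point, the partition of
  unity would sum to at most \<open>1 / 2\<close> there.
\<close>

lemma smoothly_numerable_cover_obtain_positivity_sets:
  assumes X: "diffeological_space X" and U: "smoothly_numerable_cover X U"
  obtains \<tau> where "\<And>i. smooth_real X (\<tau> i)" "\<And>x. x \<in> pts X \<Longrightarrow> \<exists>i. \<tau> i x > 1"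
    "\<And>i x. x \<in> pts X \<Longrightarrow> \<tau> i x > 0 \<Longrightarrow> x \<in> U i"
proof -
  obtain l where l: "smooth_partition_of_unity X l" "\<And>i. supp_on X (l i) \<subseteq> U i"
    using U by (auto simp: smoothly_numerable_cover_def)
  have li: "smooth_real X (l i)" "x \<in> pts X \<Longrightarrow> l i x \<in> {0..1}" for i x
    using l(1) smooth_map_unit_interval_iff[OF X] by (auto simp: smooth_partition_of_unity_def)
  show ?thesis
  proof
    show "smooth_real X (\<lambda>x. 2 ^ (i + 2) * l i x)" for i
      by (intro smooth_real_mult smooth_real_const X li)
    show "\<exists>i. 2 ^ (i + 2) * l i x > 1" if x: "x \<in> pts X" for x
    proof (rule ccontr)
      assume "\<nexists>i. 2 ^ (i + 2) * l i x > 1"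
      then have "l i x \<le> (1 / 4) * (1 / 2) ^ i" for i
        by (auto simp: not_less field_simps)
      moreover have "(\<lambda>i. l i x) sums 1" using l(1) x by (simp add: smooth_partition_of_unity_def)
      moreover have "(\<lambda>i. (1 / 4) * (1 / 2 :: real) ^ i) sums ((1 / 4) * (1 / (1 - 1 / 2)))"
        by (intro sums_mult geometric_sums) simp
      ultimately have "1 \<le> (1 / 4) * (1 / (1 - 1 / 2) :: real)" by (rule sums_le)
      then show False by simp
    qed
    show "x \<in> U i" if x: "x \<in> pts X" "2 ^ (i + 2) * l i x > 0" for i x
    proof -
      have "x \<in> {x \<in> pts X. l i x \<in> {0<..1}}"
        using x li(2)[OF x(1), of i] by (auto simp: zero_less_mult_iff)
      moreover have "{x \<in> pts X. l i x \<in> {0<..1}} \<subseteq> supp_on X (l i)"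
        unfolding supp_on_def by (rule closure_of_subset) (auto simp: topspace_D_topology[OF X])
      ultimately show ?thesis using l(2) by blast
    qed
  qed
qed

section \<open>The classifying space\<close>

context diff_groupoid
begin

text \<open>
  The sequences in the encoded set are indexed by \<open>i\<close>. The \<open>i\<close>-th one lists the row \<open>h i\<close> in its
  second components; its first components hold the tag \<open>i\<close>, by which the row can be found again,
  followed by the weights.
\<close>

definition encode :: "(nat \<Rightarrow> real) \<Rightarrow> (nat \<Rightarrow> nat \<Rightarrow> 'g) \<Rightarrow> 'g classifying_point" where
  "encode t h = range (\<lambda>i k. (case k of 0 \<Rightarrow> real i | Suc j \<Rightarrow> t j, h i k))"

definition weight :: "'g classifying_point \<Rightarrow> nat \<Rightarrow> real" where
  "weight b j = fst ((SOME s. s \<in> b) (Suc j))"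

definition arrow :: "'g classifying_point \<Rightarrow> nat \<Rightarrow> nat \<Rightarrow> 'g" where
  "arrow b i j = snd ((SOME s. s \<in> b \<and> fst (s 0) = real i) j)"

lemma weight_encode: "weight (encode t h) = t"
proof
  fix j
  have "(SOME s. s \<in> encode t h) \<in> encode t h"
    by (rule someI_ex[of "\<lambda>s. s \<in> encode t h"]) (auto simp: encode_def)
  then show "weight (encode t h) j = t j" by (auto simp: weight_def encode_def)
qed

lemma arrow_encode: "arrow (encode t h) i j = h i j"
proof -
  let ?s = "SOME s. s \<in> encode t h \<and> fst (s 0) = real i"
  have "?s \<in> encode t h \<and> fst (?s 0) = real i"
    by (rule someI_ex[of "\<lambda>s. s \<in> encode t h \<and> fst (s 0) = real i"]) (auto simp: encode_def)
  then have "?s = (\<lambda>k. (case k of 0 \<Rightarrow> real i | Suc j \<Rightarrow> t j, h i k))"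
    by (auto simp: encode_def)
  then show ?thesis by (simp add: arrow_def)
qed

text \<open>
  Fixing the arrows to be \<^const>\<open>undefined\<close> off the indices of positive weight makes the
  representation of a point unique, so that maps with the same weights and arrows are equal.
\<close>

definition weighted_cocycle :: "(nat \<Rightarrow> real) \<Rightarrow> (nat \<Rightarrow> nat \<Rightarrow> 'g) \<Rightarrow> bool" where
  "weighted_cocycle t h \<longleftrightarrow> (\<exists>i. t i > 1) \<and>
     (\<forall>i j. t i > 0 \<longrightarrow> t j > 0 \<longrightarrow>
        h i j \<in> pts (arr \<Gamma>) \<and> rng \<Gamma> (h i j) = h i i \<and> src \<Gamma> (h i j) = h j j) \<and>
     (\<forall>i j k. t i > 0 \<longrightarrow> t j > 0 \<longrightarrow> t k > 0 \<longrightarrow> gcomp \<Gamma> (h i j) (h j k) = h i k) \<and>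
     (\<forall>i j. \<not> (t i > 0 \<and> t j > 0) \<longrightarrow> h i j = undefined)"

definition B\<Gamma> :: "'g classifying_point diffeology" where
  "B\<Gamma> = \<lparr>pts = {encode t h | t h. weighted_cocycle t h},
     plot = (\<lambda>n U p. openin (Euclidean_space n) U \<and> p ` U \<subseteq> {encode t h | t h. weighted_cocycle t h} \<and>
       (\<forall>i. smooth_fun_on n U (\<lambda>u. weight (p u) i)) \<and>
       (\<forall>i j. plot (arr \<Gamma>) n {u \<in> U. weight (p u) i > 0 \<and> weight (p u) j > 0} (\<lambda>u. arrow (p u) i j)))\<rparr>"

lemma pts_B\<Gamma>: "b \<in> pts B\<Gamma> \<longleftrightarrow> weighted_cocycle (weight b) (arrow b) \<and> b = encode (weight b) (arrow b)"
proof -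
  have "arrow (encode t h) = h" for t h by (simp add: arrow_encode fun_eq_iff)
  then show ?thesis by (auto simp: B\<Gamma>_def weight_encode)
qed

lemma plot_B\<Gamma>:
  "plot B\<Gamma> n U p \<longleftrightarrow> openin (Euclidean_space n) U \<and> (\<forall>u\<in>U. p u \<in> pts B\<Gamma>) \<and>
    (\<forall>i. smooth_fun_on n U (\<lambda>u. weight (p u) i)) \<and>
    (\<forall>i j. plot (arr \<Gamma>) n {u \<in> U. weight (p u) i > 0 \<and> weight (p u) j > 0} (\<lambda>u. arrow (p u) i j))"
  by (simp add: B\<Gamma>_def image_subset_iff)

lemma diffeological_space_B\<Gamma>: "diffeological_space B\<Gamma>"
proof (rule diffeological_spaceI)
  note A = arr_diffeological
  fix n U p assume p: "plot B\<Gamma> n U p"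
  then have U: "openin (Euclidean_space n) U" by (simp add: plot_B\<Gamma>)
  show "openin (Euclidean_space n) U" by fact
  show "p u \<in> pts B\<Gamma>" if "u \<in> U" for u using p that by (simp add: plot_B\<Gamma>)
  fix q assume q: "\<And>u. u \<in> U \<Longrightarrow> p u = q u"
  show "plot B\<Gamma> n U q"
    unfolding plot_B\<Gamma>
  proof (intro conjI allI ballI)
    show "smooth_fun_on n U (\<lambda>u. weight (q u) i)" for i
      using p q smooth_fun_on_cong[OF U, of "\<lambda>u. weight (p u) i"] by (simp add: plot_B\<Gamma>)
    have *: "{u \<in> U. weight (q u) i > 0 \<and> weight (q u) j > 0} =
        {u \<in> U. weight (p u) i > 0 \<and> weight (p u) j > 0}" for i j
      using q by auto
    show "plot (arr \<Gamma>) n {u \<in> U. weight (q u) i > 0 \<and> weight (q u) j > 0} (\<lambda>u. arrow (q u) i j)" for i j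
      unfolding * by (rule plot_cong[OF A, where p="\<lambda>u. arrow (p u) i j"])
        (use p q in \<open>auto simp: plot_B\<Gamma>\<close>)
  qed (use p q in \<open>auto simp: plot_B\<Gamma>\<close>)
next
  note A = arr_diffeological
  fix n U b assume U: "openin (Euclidean_space n) U" and b: "b \<in> pts B\<Gamma>"
  have "plot (arr \<Gamma>) n {u \<in> U. weight b i > 0 \<and> weight b j > 0} (\<lambda>u. arrow b i j)" for i j
  proof (cases "weight b i > 0 \<and> weight b j > 0")
    case True
    then show ?thesis using b U by (auto simp: pts_B\<Gamma> weighted_cocycle_def intro!: plot_const[OF A])
  next
    case False
    then have e: "{u \<in> U. weight b i > 0 \<and> weight b j > 0} = {}" by auto
    show ?thesis unfolding e by (rule plot_locally[OF A]) auto
  qed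
  then show "plot B\<Gamma> n U (\<lambda>_. b)"
    using U b by (auto simp: plot_B\<Gamma> smooth_fun_on_def C_k_on_const)
next
  note A = arr_diffeological
  fix n U p assume U: "openin (Euclidean_space n) U"
    and loc: "\<And>u. u \<in> U \<Longrightarrow> \<exists>V. openin (Euclidean_space n) V \<and> u \<in> V \<and> V \<subseteq> U \<and> plot B\<Gamma> n V p"
  have sm: "smooth_fun_on n U (\<lambda>u. weight (p u) i)" for i
    by (rule smooth_fun_on_locally[OF U]) (use loc plot_B\<Gamma> in metis)
  show "plot B\<Gamma> n U p"
    unfolding plot_B\<Gamma>
  proof (intro conjI allI ballI U sm)
    show "p u \<in> pts B\<Gamma>" if "u \<in> U" for u using loc[OF that] by (auto simp: plot_B\<Gamma>)
    fix i j
    let ?W = "\<lambda>V. {u \<in> V. weight (p u) i > 0 \<and> weight (p u) j > 0}"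
    have "?W U = {u \<in> U. weight (p u) i \<in> {0<..}} \<inter> {u \<in> U. weight (p u) j \<in> {0<..}}" by auto
    then have o: "openin (Euclidean_space n) (?W U)"
      using openin_smooth_fun_on_preimage[OF U sm open_greaterThan] by (simp add: openin_Int)
    show "plot (arr \<Gamma>) n (?W U) (\<lambda>u. arrow (p u) i j)"
    proof (rule plot_locally[OF A o])
      fix u assume u: "u \<in> ?W U"
      then obtain V where V: "openin (Euclidean_space n) V" "u \<in> V" "V \<subseteq> U" "plot B\<Gamma> n V p"
        using loc by blast
      then have "plot (arr \<Gamma>) n (?W V) (\<lambda>u. arrow (p u) i j)" by (simp add: plot_B\<Gamma>)
      then show "\<exists>V. openin (Euclidean_space n) V \<and> u \<in> V \<and> V \<subseteq> ?W U \<and> plot (arr \<Gamma>) n V (\<lambda>u. arrow (p u) i j)"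
        using plotD(1)[OF A] u V by (intro exI[of _ "?W V"]) auto
    qed
  qed
next
  note A = arr_diffeological
  fix n U m V f p assume p: "plot B\<Gamma> m V p" and f: "euclidean_smooth n U m V f"
  have fU: "f u \<in> V" if "u \<in> U" for u using f that by (auto simp: euclidean_smooth_def)
  show "plot B\<Gamma> n U (\<lambda>u. p (f u))"
    unfolding plot_B\<Gamma>
  proof (intro conjI allI ballI)
    show "openin (Euclidean_space n) U" using f by (simp add: euclidean_smooth_def)
    show "p (f u) \<in> pts B\<Gamma>" if "u \<in> U" for u using fU[OF that] p by (simp add: plot_B\<Gamma>)
    show "smooth_fun_on n U (\<lambda>u. weight (p (f u)) i)" for i
      using smooth_fun_on_compose[OF f, of "\<lambda>u. weight (p u) i"] p by (simp add: plot_B\<Gamma>)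
    fix i j
    let ?W = "{u \<in> V. weight (p u) i > 0 \<and> weight (p u) j > 0}"
    let ?W' = "{u \<in> U. weight (p (f u)) i > 0 \<and> weight (p (f u)) j > 0}"
    have W: "plot (arr \<Gamma>) m ?W (\<lambda>u. arrow (p u) i j)" using p by (simp add: plot_B\<Gamma>)
    have e: "?W' = {u \<in> U. f u \<in> ?W}" using fU by auto
    have o: "openin (Euclidean_space n) ?W'"
      unfolding e by (rule openin_euclidean_smooth_preimage[OF f plotD(1)[OF A W]]) auto
    have "euclidean_smooth n ?W' m ?W f"
      using f o plotD(1)[OF A W] fU smooth_fun_on_subset[of n U ?W']
      by (auto simp: euclidean_smooth_def)
    from plot_compose[OF A W this]
    show "plot (arr \<Gamma>) n ?W' (\<lambda>u. arrow (p (f u)) i j)" .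
  qed
qed

lemma smooth_real_weight: "smooth_real B\<Gamma> (\<lambda>b. weight b i)"
  by (simp add: smooth_real_def plot_B\<Gamma>)

definition universal_cocycle :: "(nat, 'g classifying_point, 'g) cocycle" where
  "universal_cocycle = (\<lambda>i. {b \<in> pts B\<Gamma>. weight b i > 0}, \<lambda>(b, i, j). arrow b i j)"

lemma smoothly_numerable_universal_cover: "smoothly_numerable_cover B\<Gamma> (fst universal_cocycle)"
  unfolding universal_cocycle_def fst_conv
  by (rule smoothly_numerable_cover_positivity_sets[OF diffeological_space_B\<Gamma> smooth_real_weight])
    (auto simp: pts_B\<Gamma> weighted_cocycle_def)

lemma is_cocycle_universal: "is_cocycle B\<Gamma> \<Gamma> universal_cocycle"
  unfolding universal_cocycle_def
proof (rule is_cocycleI[OF diffeological_space_B\<Gamma>], simp_all)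
  show "D_open_cover B\<Gamma> (\<lambda>i. {b \<in> pts B\<Gamma>. weight b i > 0})"
    using smoothly_numerable_universal_cover
    by (simp add: smoothly_numerable_cover_def universal_cocycle_def)
  fix i j
  let ?S = "{b \<in> pts B\<Gamma>. weight b i > 0} \<inter> {b \<in> pts B\<Gamma>. weight b j > 0}"
  show "smooth_map (subspace_diffeology B\<Gamma> ?S) (arr \<Gamma>) (\<lambda>b. arrow b i j)"
    unfolding smooth_map_def pts_subspace plot_subspace_iff
  proof (intro conjI allI impI)
    fix n U p assume p: "plot B\<Gamma> n U p \<and> p ` U \<subseteq> ?S"
    then have e: "{u \<in> U. weight (p u) i > 0 \<and> weight (p u) j > 0} = U" by auto
    have "plot (arr \<Gamma>) n {u \<in> U. weight (p u) i > 0 \<and> weight (p u) j > 0} (\<lambda>u. arrow (p u) i j)"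
      using p by (simp add: plot_B\<Gamma>)
    then show "plot (arr \<Gamma>) n U ((\<lambda>b. arrow b i j) \<circ> p)" unfolding e by (simp add: o_def)
  qed (auto simp: pts_B\<Gamma> weighted_cocycle_def)
qed (auto simp: pts_B\<Gamma> weighted_cocycle_def)

definition universal_structure :: "('g classifying_point, 'g) gamma_structure" where
  "universal_structure = structure_of B\<Gamma> universal_cocycle"

lemma smoothly_numerable_universal: "smoothly_numerable B\<Gamma> \<Gamma> universal_structure"
  using smoothly_numerable_iff[OF diffeological_space_B\<Gamma>] is_cocycle_universal
    smoothly_numerable_universal_cover universal_structure_def by blast

text \<open>
  Weights \<open>\<tau>\<close> and arrows \<open>h\<close> on \<open>X\<close> are assembled pointwise; the values of \<open>h\<close> outside the
  overlaps of the positivity sets are discarded.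
\<close>

definition classifying_map ::
    "(nat \<Rightarrow> 'x \<Rightarrow> real) \<Rightarrow> ('x \<times> nat \<times> nat \<Rightarrow> 'g) \<Rightarrow> 'x \<Rightarrow> 'g classifying_point" where
  "classifying_map \<tau> h x =
     encode (\<lambda>i. \<tau> i x) (\<lambda>i j. if \<tau> i x > 0 \<and> \<tau> j x > 0 then h (x, i, j) else undefined)"

lemma weight_classifying_map: "weight (classifying_map \<tau> h x) i = \<tau> i x"
  by (simp add: classifying_map_def weight_encode)

lemma arrow_classifying_map:
  "\<tau> i x > 0 \<Longrightarrow> \<tau> j x > 0 \<Longrightarrow> arrow (classifying_map \<tau> h x) i j = h (x, i, j)"
  by (simp add: classifying_map_def arrow_encode)

lemma classifying_map_eqI:
  assumes "\<And>i. \<tau> i x = \<tau>' i y"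
    "\<And>i j. \<tau>' i y > 0 \<Longrightarrow> \<tau>' j y > 0 \<Longrightarrow> h (x, i, j) = h' (y, i, j)"
  shows "classifying_map \<tau> h x = classifying_map \<tau>' h' y"
  unfolding classifying_map_def assms(1) using assms(2)
  by (intro arg_cong2[where f=encode]) (auto simp: fun_eq_iff)

lemma classifying_map_of_point:
  assumes "f x \<in> pts B\<Gamma>"
  shows "classifying_map (\<lambda>i x. weight (f x) i) (\<lambda>(x, i, j). arrow (f x) i j) x = f x"
proof -
  have "(\<lambda>i j. if weight (f x) i > 0 \<and> weight (f x) j > 0 then arrow (f x) i j else undefined) = arrow (f x)"
    using assms by (auto simp: pts_B\<Gamma> weighted_cocycle_def fun_eq_iff)
  then show ?thesis using assms unfolding classifying_map_def prod.case by (simp add: pts_B\<Gamma>)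
qed

lemma smooth_map_classifying_map:
  assumes X: "diffeological_space X" and \<tau>: "\<And>i. smooth_real X (\<tau> i)"
    and big: "\<And>x. x \<in> pts X \<Longrightarrow> \<exists>i. \<tau> i x > 1"
    and h: "is_cocycle X \<Gamma> (\<lambda>i. {x \<in> pts X. \<tau> i x > 0}, h)"
  shows "smooth_map X B\<Gamma> (classifying_map \<tau> h)"
proof -
  note hD = cocycleD[OF X h, simplified]
  have pts: "classifying_map \<tau> h x \<in> pts B\<Gamma>" if x: "x \<in> pts X" for x
  proof -
    have "weighted_cocycle (\<lambda>i. \<tau> i x)
        (\<lambda>i j. if \<tau> i x > 0 \<and> \<tau> j x > 0 then h (x, i, j) else undefined)"
      using big[OF x] x hD(2-5) by (auto simp: weighted_cocycle_def)
    then show ?thesis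
      unfolding classifying_map_def B\<Gamma>_def by auto
  qed
  show ?thesis
    unfolding smooth_map_def
  proof (intro conjI allI impI)
    show "classifying_map \<tau> h ` pts X \<subseteq> pts B\<Gamma>" using pts by blast
    fix n U p assume p: "plot X n U p"
    have "plot (arr \<Gamma>) n {u \<in> U. \<tau> i (p u) > 0 \<and> \<tau> j (p u) > 0} (\<lambda>u. arrow (classifying_map \<tau> h (p u)) i j)"
      for i j
    proof -
      let ?S = "{x \<in> pts X. \<tau> i x > 0} \<inter> {x \<in> pts X. \<tau> j x > 0}"
      have "openin (D_topology X) ?S"
        by (intro openin_Int openin_smooth_real_greater[OF X \<tau>])
      moreover have e: "{u \<in> U. p u \<in> ?S} = {u \<in> U. \<tau> i (p u) > 0 \<and> \<tau> j (p u) > 0}"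
        using plotD(2)[OF X p] by auto
      ultimately have "plot X n {u \<in> U. \<tau> i (p u) > 0 \<and> \<tau> j (p u) > 0} p"
        using plot_openin_D_topology(2)[OF X p, of ?S] by (simp only: e)
      then have "plot (subspace_diffeology X ?S) n {u \<in> U. \<tau> i (p u) > 0 \<and> \<tau> j (p u) > 0} p"
        using e by (auto simp: plot_subspace_iff)
      from smooth_mapD(2)[OF hD(1) this]
      show ?thesis
        by (rule plot_cong[OF arr_diffeological]) (simp add: arrow_classifying_map)
    qed
    then show "plot B\<Gamma> n U (classifying_map \<tau> h \<circ> p)"
      using plotD[OF X p] pts smooth_realD[OF \<tau> p] by (simp add: plot_B\<Gamma> weight_classifying_map)
  qed
qed

lemma pullback_classifying_map:
  assumes X: "diffeological_space X" and \<tau>: "\<And>i. smooth_real X (\<tau> i)"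
    and big: "\<And>x. x \<in> pts X \<Longrightarrow> \<exists>i. \<tau> i x > 1"
    and h: "is_cocycle X \<Gamma> (\<lambda>i. {x \<in> pts X. \<tau> i x > 0}, h)"
  shows "pullback_structure X \<Gamma> (classifying_map \<tau> h) universal_structure =
    structure_of X (\<lambda>i. {x \<in> pts X. \<tau> i x > 0}, h)"
proof -
  let ?f = "classifying_map \<tau> h"
  have f: "smooth_map X B\<Gamma> ?f" by (rule smooth_map_classifying_map[OF assms])
  have "equivalent_cocycles X \<Gamma> (pullback_cocycle X ?f universal_cocycle) (\<lambda>i. {x \<in> pts X. \<tau> i x > 0}, h)"
    using is_cocycle_pullback[OF diffeological_space_B\<Gamma> X f is_cocycle_universal] h smooth_mapD(1)[OF f]
    by (intro equivalent_cocycles_cong[OF X])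
      (auto simp: pullback_cocycle_def universal_cocycle_def weight_classifying_map arrow_classifying_map
        fun_eq_iff)
  then show ?thesis
    unfolding universal_structure_def
      pullback_structure_of[OF X diffeological_space_B\<Gamma> f is_cocycle_universal]
    by (rule structure_of_eqI[OF X])
qed

text \<open>
  The positivity sets of the rescaled partition of unity refine the given cover, and restriction to
  a refinement does not change the structure.
\<close>

lemma smoothly_numerable_classified:
  assumes X: "diffeological_space X" and S: "smoothly_numerable X \<Gamma> S"
  obtains f where "smooth_map X B\<Gamma> f" "S = pullback_structure X \<Gamma> f universal_structure"
proof -
  obtain c where c: "is_cocycle X \<Gamma> c" "smoothly_numerable_cover X (fst c)" "S = structure_of X c"
    using S smoothly_numerable_iff[OF X] by blast
  obtain \<tau> where \<tau>: "\<And>i. smooth_real X (\<tau> i)" "\<And>x. x \<in> pts X \<Longrightarrow> \<exists>i. \<tau> i x > 1"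
    "\<And>i x. x \<in> pts X \<Longrightarrow> \<tau> i x > 0 \<Longrightarrow> x \<in> fst c i"
    using smoothly_numerable_cover_obtain_positivity_sets[OF X c(2)] by blast
  let ?V = "\<lambda>i. {x \<in> pts X. \<tau> i x > 0}"
  have "D_open_cover X ?V"
    using smoothly_numerable_cover_positivity_sets[OF X \<tau>(1,2)]
    by (simp add: smoothly_numerable_cover_def)
  then have l: "labelling X (\<lambda>x. x) ?V (\<lambda>i _. i) c"
    by (rule labelling_const) (use \<tau>(3) in auto)
  have r: "relabel (\<lambda>x. x) ?V (\<lambda>i _. i) c = (?V, snd c)" by (simp add: relabel_def)
  have V: "is_cocycle X \<Gamma> (?V, snd c)"
    using is_cocycle_relabel[OF X X c(1) smooth_map_ident l] r by simp
  have "equivalent_cocycles X \<Gamma> (?V, snd c) c"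
    using relabel_equivalent_pullback[OF X X smooth_map_ident c(1) l] pullback_cocycle_ident[OF c(1)] r
    by simp
  then have "structure_of X (?V, snd c) = S"
    unfolding c(3) by (rule structure_of_eqI[OF X])
  then show ?thesis
    using that[OF smooth_map_classifying_map[OF X \<tau>(1,2) V]] pullback_classifying_map[OF X \<tau>(1,2) V] by simp
qed

lemma smoothly_numerable_pullback_universal:
  assumes X: "diffeological_space X" and f: "smooth_map X B\<Gamma> f"
  shows "smoothly_numerable X \<Gamma> (pullback_structure X \<Gamma> f universal_structure)"
proof -
  let ?c = "pullback_cocycle X f universal_cocycle"
  have "fst ?c = (\<lambda>i. {x \<in> pts X. weight (f x) i > 0})"
    using smooth_mapD(1)[OF f] by (auto simp: pullback_cocycle_def universal_cocycle_def fun_eq_iff)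
  moreover have "smoothly_numerable_cover X (\<lambda>i. {x \<in> pts X. weight (f x) i > 0})"
    using smooth_mapD(1)[OF f]
    by (intro smoothly_numerable_cover_positivity_sets[OF X] smooth_real_compose[OF f smooth_real_weight])
      (auto simp: pts_B\<Gamma> weighted_cocycle_def)
  ultimately show ?thesis
    using smoothly_numerable_iff[OF X] is_cocycle_pullback[OF diffeological_space_B\<Gamma> X f is_cocycle_universal]
      pullback_structure_of[OF X diffeological_space_B\<Gamma> f is_cocycle_universal]
    by (metis universal_structure_def)
qed

section \<open>Homotopies between classifying maps\<close>

text \<open>
  All homotopies below come from this lemma, applied with \<open>Y\<close> a cylinder: only weights and
  locally constant labels in a known cocycle have to be supplied.
\<close>

lemma smooth_map_classifying_map_relabel:
  assumes X: "diffeological_space X" and Y: "diffeological_space Y"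
    and c: "is_cocycle X \<Gamma> c" and f: "smooth_map Y X f"
    and W: "\<And>j. smooth_real Y (W j)" and big: "\<And>y. y \<in> pts Y \<Longrightarrow> \<exists>j. W j y > 1"
    and lab: "\<And>j y. y \<in> pts Y \<Longrightarrow> W j y > 0 \<Longrightarrow> f y \<in> fst c (l j y)"
    and lo: "\<And>j i. openin (D_topology Y) {y \<in> pts Y. W j y > 0 \<and> l j y = i}"
  shows "smooth_map Y B\<Gamma> (classifying_map W (\<lambda>(y, j, j'). snd c (f y, l j y, l j' y)))"
proof (rule smooth_map_classifying_map[OF Y W big])
  have "D_open_cover Y (\<lambda>j. {y \<in> pts Y. W j y > 0})"
    using smoothly_numerable_cover_positivity_sets[OF Y W big]
    by (simp add: smoothly_numerable_cover_def)
  then have "labelling Y f (\<lambda>j. {y \<in> pts Y. W j y > 0}) l c"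
    using lab lo by (auto simp: labelling_def)
  from is_cocycle_relabel[OF X Y c f this]
  show "is_cocycle Y \<Gamma> (\<lambda>j. {y \<in> pts Y. W j y > 0}, \<lambda>(y, j, j'). snd c (f y, l j y, l j' y))"
    by (simp add: relabel_def)
qed

text \<open>
  The coordinate \<open>n\<close> of \<open>f\<close> is moved to position \<open>\<sigma> n\<close>; all other positions get weight \<open>0\<close>.
\<close>

definition spread :: "(nat \<Rightarrow> nat) \<Rightarrow> ('x \<Rightarrow> 'g classifying_point) \<Rightarrow> 'x \<Rightarrow> 'g classifying_point" where
  "spread \<sigma> f = classifying_map (\<lambda>j x. if j \<in> range \<sigma> then weight (f x) (inv \<sigma> j) else 0)
     (\<lambda>(x, j, j'). arrow (f x) (inv \<sigma> j) (inv \<sigma> j'))"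

lemma weight_gt_1: "b \<in> pts B\<Gamma> \<Longrightarrow> \<exists>i. weight b i > 1"
  by (auto simp: pts_B\<Gamma> weighted_cocycle_def)

lemma smooth_real_weight_cylinder:
  "smooth_map X B\<Gamma> f \<Longrightarrow> smooth_real (prod_diffeology X unit_interval) (\<lambda>z. weight (f (fst z)) i)"
  by (intro smooth_real_compose[OF smooth_map_fst] smooth_real_compose[OF _ smooth_real_weight])

text \<open>
  Coordinates cannot all be moved at once, because position \<open>\<sigma> n\<close> may be needed both for
  coordinate \<open>n\<close> and for coordinate \<open>\<sigma> n\<close>, which carry unrelated arrows. They are moved one after
  the other. In terms of the remaining time \<open>w = 1 - s\<close>, coordinate \<open>n\<close> is faded in at position
  \<open>n\<close> while \<open>4 ^ n * w\<close> falls from \<open>1\<close> to \<open>1 / 2\<close>, and faded out at position \<open>\<sigma> n\<close> while it falls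
  from \<open>1 / 2\<close> to \<open>1 / 4\<close>. At every time one of the two copies has its full weight. Since
  \<open>\<sigma> n > n\<close>, position \<open>\<sigma> n\<close> is free before coordinate \<open>\<sigma> n\<close> enters it. Infinitely many moves
  accumulate at the end \<open>w = 0\<close>, but smoothness is required of each weight separately, and each
  position takes part in at most two moves.
\<close>

lemma spread_homotopic:
  assumes X: "diffeological_space X" and f: "smooth_map X B\<Gamma> f"
    and \<sigma>: "inj \<sigma>" "\<And>n. \<sigma> n > n"
  shows "smoothly_homotopic X B\<Gamma> (spread \<sigma> f) f"
proof -
  let ?C = "prod_diffeology X unit_interval"
  note C = diffeological_space_cylinder[OF X]
  note inv_simp = inv_f_f[OF \<sigma>(1)]
  have fp: "f (fst z) \<in> pts B\<Gamma>" if "z \<in> pts ?C" for z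
    using that smooth_mapD(1)[OF f] by (auto simp: pts_prod)
  define w :: "'a \<times> real \<Rightarrow> real" where "w z = 1 - snd z" for z
  have w0: "w z \<ge> 0" if "z \<in> pts ?C" for z
    using that by (auto simp: w_def pts_prod pts_unit_interval)
  define on where "on j z = smooth_step (2 - 2 * 4 ^ j * w z)" for j z
  define off where "off n z = smooth_step (4 * 4 ^ n * w z - 1)" for n z
  define W where "W j z = on j z * weight (f (fst z)) j +
    (if j \<in> range \<sigma> then off (inv \<sigma> j) z * weight (f (fst z)) (inv \<sigma> j) else 0)" for j z
  define l where "l j z = (if 4 ^ j * w z < 1 then j else inv \<sigma> j)" for j z
  have sw: "smooth_real ?C w"
    unfolding w_def[abs_def] by (intro smooth_real_diff smooth_real_const smooth_real_snd C)
  have sW: "smooth_real ?C (W j)" for j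
    unfolding W_def[abs_def] on_def[abs_def] off_def[abs_def]
    by (cases "j \<in> range \<sigma>") (simp_all, (intro smooth_real_add smooth_real_mult smooth_real_step
        smooth_real_diff smooth_real_const sw smooth_real_weight_cylinder[OF f] C)+)
  have on_0: "on j z = 0" if "4 ^ j * w z \<ge> 1" for j z
    using that by (simp add: on_def smooth_step_0)
  have off_0: "off n z = 0" if "4 * 4 ^ n * w z \<le> 1" for n z
    using that by (simp add: off_def smooth_step_0)
  have times: "4 * 4 ^ n * w z \<le> 4 ^ \<sigma> n * w z" if "z \<in> pts ?C" for n z
  proof -
    have "(4 :: real) ^ Suc n \<le> 4 ^ \<sigma> n" using \<sigma>(2)[of n] by (intro power_increasing) auto
    then show ?thesis using w0[OF that] by (simp add: mult_right_mono)
  qed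
  have W_early: "W j z = on j z * weight (f (fst z)) j" if z: "z \<in> pts ?C" "4 ^ j * w z < 1" for j z
  proof -
    have "off (inv \<sigma> j) z = 0" if "j \<in> range \<sigma>"
    proof -
      obtain n where n: "j = \<sigma> n" using \<open>j \<in> range \<sigma>\<close> by blast
      have "4 * 4 ^ n * w z \<le> 1" using times[OF z(1), of n] z(2) n by simp
      then show ?thesis using off_0 n inv_simp by simp
    qed
    then show ?thesis by (simp add: W_def)
  qed
  have W_late: "W j z = (if j \<in> range \<sigma> then off (inv \<sigma> j) z * weight (f (fst z)) (inv \<sigma> j) else 0)"
    if "4 ^ j * w z \<ge> 1" for j z
    using on_0[OF that] by (simp add: W_def)
  have W_pos: "weight (f (fst z)) (l j z) > 0 \<and>
      (4 ^ j * w z < 1 \<or> j \<in> range \<sigma> \<and> 4 * 4 ^ inv \<sigma> j * w z > 1)"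
    if z: "z \<in> pts ?C" and pos: "W j z > 0" for j z
  proof (cases "4 ^ j * w z < 1")
    case True
    then have "0 < on j z * weight (f (fst z)) j" using W_early[OF z] pos by simp
    then show ?thesis
      using True smooth_step_bounds(1) by (auto simp: l_def on_def zero_less_mult_iff not_less[symmetric])
  next
    case False
    then have j: "j \<in> range \<sigma>" "0 < off (inv \<sigma> j) z * weight (f (fst z)) (inv \<sigma> j)"
      using W_late[of j z] pos by (auto split: if_splits)
    then have "4 * 4 ^ inv \<sigma> j * w z > 1" using off_0[of "inv \<sigma> j" z] by fastforce
    then show ?thesis
      using False j smooth_step_bounds(1)
      by (auto simp: l_def off_def zero_less_mult_iff not_less[symmetric])
  qed
  have "smooth_map ?C B\<Gamma> (classifying_map W
      (\<lambda>(z, j, j'). snd universal_cocycle (f (fst z), l j z, l j' z)))"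
  proof (rule smooth_map_classifying_map_relabel[OF diffeological_space_B\<Gamma> C is_cocycle_universal _ sW])
    show "smooth_map ?C B\<Gamma> (\<lambda>z. f (fst z))" by (rule smooth_map_compose[OF smooth_map_fst f])
    show "\<exists>j. W j z > 1" if z: "z \<in> pts ?C" for z
    proof -
      obtain n where n: "weight (f (fst z)) n > 1" using weight_gt_1[OF fp[OF z]] by blast
      show ?thesis
      proof (cases "4 ^ n * w z \<le> 1 / 2")
        case True
        then have "on n z = 1" by (simp add: on_def smooth_step_1)
        then show ?thesis using W_early[OF z, of n] True n by (intro exI[of _ n]) simp
      next
        case False
        then have "4 * 4 ^ n * w z - 1 \<ge> 1" by (simp add: not_le algebra_simps)
        then have "off n z = 1" unfolding off_def by (rule smooth_step_1)
        moreover have "4 ^ \<sigma> n * w z \<ge> 1" using times[OF z, of n] False by simp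
        ultimately show ?thesis using W_late[of "\<sigma> n" z] n inv_simp by (intro exI[of _ "\<sigma> n"]) simp
      qed
    qed
    show "f (fst z) \<in> fst universal_cocycle (l j z)" if "z \<in> pts ?C" "W j z > 0" for j z
      using W_pos[OF that] fp[OF that(1)] by (simp add: universal_cocycle_def)
    \<comment> \<open>Before and after its change of label, a position is occupied on two disjoint open sets.\<close>
    show "openin (D_topology ?C) {z \<in> pts ?C. W j z > 0 \<and> l j z = i}" for j i
    proof -
      define P where "P = {z \<in> pts ?C. W j z > 0}"
      define E where "E = {z \<in> pts ?C. 1 - 4 ^ j * w z > 0}"
      define L where "L = {z \<in> pts ?C. 4 * 4 ^ inv \<sigma> j * w z > 1}"
      have o: "openin (D_topology ?C) P" "openin (D_topology ?C) E" "openin (D_topology ?C) L"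
        unfolding P_def E_def L_def
        by (intro openin_smooth_real_greater C sW smooth_real_diff smooth_real_const smooth_real_mult sw)+
      have late: "\<not> 4 ^ j * w z < 1" if "z \<in> L" "j \<in> range \<sigma>" for z
        using that times[of z "inv \<sigma> j"] f_inv_into_f[of j \<sigma> UNIV] by (auto simp: L_def)
      have "{z \<in> pts ?C. W j z > 0 \<and> l j z = i} =
          (if j = i then P \<inter> E else {}) \<union> (if j \<in> range \<sigma> \<and> inv \<sigma> j = i then P \<inter> L else {})"
        using W_pos[of _ j] late by (auto simp: P_def E_def L_def l_def split: if_splits)
      then show ?thesis using o by (auto intro!: openin_Un openin_Int)
    qed
  qed
  then show ?thesis
  proof (rule smoothly_homotopicI)
    fix x assume x: "x \<in> pts X"
    have four: "1 \<le> (4 :: real) ^ n" for n by simp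
    show "classifying_map W (\<lambda>(z, j, j'). snd universal_cocycle (f (fst z), l j z, l j' z)) (x, 0) = spread \<sigma> f x"
      unfolding spread_def
    proof (rule classifying_map_eqI)
      have "off n (x, 0) = 1" for n
      proof -
        have "4 * 4 ^ n * w (x, 0) = 4 * 4 ^ n" by (simp add: w_def)
        then have "1 \<le> 4 * 4 ^ n * w (x, 0) - 1" using four[of n] by linarith
        then show ?thesis unfolding off_def by (rule smooth_step_1)
      qed
      then show "W j (x, 0) = (if j \<in> range \<sigma> then weight (f x) (inv \<sigma> j) else 0)" for j
        using W_late[of j "(x, 0)"] by (simp add: w_def)
      have "l j (x, 0) = inv \<sigma> j" for j
        using leD[OF four[of j]] by (simp add: l_def w_def)
      then show "(\<lambda>(z, j, j'). snd universal_cocycle (f (fst z), l j z, l j' z)) ((x, 0), i, j) =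
          (\<lambda>(x, j, j'). arrow (f x) (inv \<sigma> j) (inv \<sigma> j')) (x, i, j)" for i j
        by (simp add: universal_cocycle_def)
    qed
    have "classifying_map W (\<lambda>(z, j, j'). snd universal_cocycle (f (fst z), l j z, l j' z)) (x, 1) =
        classifying_map (\<lambda>i x. weight (f x) i) (\<lambda>(x, i, j). arrow (f x) i j) x"
    proof (rule classifying_map_eqI)
      show "W j (x, 1) = weight (f x) j" for j
        by (simp add: W_def w_def on_def off_def smooth_step_0 smooth_step_1)
    qed (auto simp: universal_cocycle_def l_def w_def)
    then show "classifying_map W (\<lambda>(z, j, j'). snd universal_cocycle (f (fst z), l j z, l j' z)) (x, 1) = f x"
      using classifying_map_of_point[of f x] smooth_mapD(1)[OF f x] by simp
  qed
qed

text \<open>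
  With disjoint ranges the positions of \<open>f\<close> and \<open>g\<close> never collide, and a cocycle over the union
  of the two covers supplies the arrows between them. The weights of \<open>g\<close> have fully appeared at
  \<open>s = 1 / 2\<close>, when those of \<open>f\<close> begin to fade, so at each time one of the two families is intact.
\<close>

lemma spread_join_homotopic:
  assumes X: "diffeological_space X" and f: "smooth_map X B\<Gamma> f" and g: "smooth_map X B\<Gamma> g"
    and e: "equivalent_cocycles X \<Gamma> (pullback_cocycle X f universal_cocycle) (pullback_cocycle X g universal_cocycle)"
    and \<sigma>: "inj \<sigma>" and \<rho>: "inj \<rho>" and disj: "range \<sigma> \<inter> range \<rho> = {}"
  shows "smoothly_homotopic X B\<Gamma> (spread \<sigma> f) (spread \<rho> g)"
proof -
  let ?C = "prod_diffeology X unit_interval"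
  note C = diffeological_space_cylinder[OF X]
  note inv_simp = inv_f_f[OF \<sigma>(1)] inv_f_f[OF \<rho>(1)]
  let ?U = "\<lambda>f i. {x \<in> pts X. weight (f x) i > 0}"
  have fp: "f x \<in> pts B\<Gamma>" and gp: "g x \<in> pts B\<Gamma>" if "x \<in> pts X" for x
    using that smooth_mapD(1)[OF f] smooth_mapD(1)[OF g] by auto
  have U: "fst (pullback_cocycle X f universal_cocycle) = ?U f"
    "fst (pullback_cocycle X g universal_cocycle) = ?U g"
    using fp gp by (auto simp: pullback_cocycle_def universal_cocycle_def fun_eq_iff)
  obtain k where k: "is_cocycle X \<Gamma> (case_sum (?U f) (?U g), k)"
    "\<And>i j x. x \<in> ?U f i \<Longrightarrow> x \<in> ?U f j \<Longrightarrow> k (x, Inl i, Inl j) = arrow (f x) i j"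
    "\<And>i j x. x \<in> ?U g i \<Longrightarrow> x \<in> ?U g j \<Longrightarrow> k (x, Inr i, Inr j) = arrow (g x) i j"
    using e unfolding equivalent_cocycles_def U
    by (auto simp: pullback_cocycle_def universal_cocycle_def)
  define W where "W j z = (if j \<in> range \<sigma> then smooth_step (2 - 2 * snd z) * weight (f (fst z)) (inv \<sigma> j)
    else if j \<in> range \<rho> then smooth_step (2 * snd z - 0) * weight (g (fst z)) (inv \<rho> j) else 0)" for j z
  define l where "l j = (if j \<in> range \<sigma> then Inl (inv \<sigma> j) else Inr (inv \<rho> j))" for j
  have pos: "fst z \<in> case_sum (?U f) (?U g) (l j)" if "z \<in> pts ?C" "W j z > 0" for j z
    using that smooth_step_bounds(1)
    by (auto simp: W_def l_def pts_prod zero_less_mult_iff not_less[symmetric] split: if_splits)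
  have sW: "smooth_real ?C (W j)" for j
    unfolding W_def[abs_def]
    by (cases "j \<in> range \<sigma>"; cases "j \<in> range \<rho>") (simp_all only: if_True if_False,
      (intro smooth_real_mult smooth_real_step smooth_real_diff smooth_real_const smooth_real_snd
        smooth_real_weight_cylinder[OF f] smooth_real_weight_cylinder[OF g] C)+)
  have "smooth_map ?C B\<Gamma> (classifying_map W
      (\<lambda>(z, j, j'). snd (case_sum (?U f) (?U g), k) (fst z, l j, l j')))"
  proof (rule smooth_map_classifying_map_relabel[OF X C k(1) smooth_map_fst sW])
    show "\<exists>j. W j z > 1" if z: "z \<in> pts ?C" for z
    proof (cases "snd z \<le> 1 / 2")
      case True
      obtain n where "weight (f (fst z)) n > 1" using weight_gt_1 fp z by (fastforce simp: pts_prod)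
      then show ?thesis using True inv_simp
        by (intro exI[of _ "\<sigma> n"]) (simp add: W_def smooth_step_1)
    next
      case False
      obtain n where "weight (g (fst z)) n > 1" using weight_gt_1 gp z by (fastforce simp: pts_prod)
      moreover have "\<rho> n \<notin> range \<sigma>" using disj by blast
      ultimately show ?thesis using False inv_simp
        by (intro exI[of _ "\<rho> n"]) (simp add: W_def smooth_step_1)
    qed
    show "fst z \<in> fst (case_sum (?U f) (?U g), k) (l j)" if "z \<in> pts ?C" "W j z > 0" for j z
      using pos[OF that] by simp
    show "openin (D_topology ?C) {z \<in> pts ?C. W j z > 0 \<and> l j = i}" for j i
      using openin_smooth_real_greater[OF C sW, of 0 j] by (cases "l j = i") auto
  qed
  then show ?thesis
  proof (rule smoothly_homotopicI)
    fix x assume x: "x \<in> pts X"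
    show "classifying_map W (\<lambda>(z, j, j'). snd (case_sum (?U f) (?U g), k) (fst z, l j, l j')) (x, 0) = spread \<sigma> f x"
      unfolding spread_def
      by (rule classifying_map_eqI)
        (use x k(2) in \<open>auto simp: W_def l_def smooth_step_0 smooth_step_1 split: if_splits\<close>)
    show "classifying_map W (\<lambda>(z, j, j'). snd (case_sum (?U f) (?U g), k) (fst z, l j, l j')) (x, 1) = spread \<rho> g x"
      unfolding spread_def
      by (rule classifying_map_eqI)
        (use x k(3) disj in \<open>auto simp: W_def l_def smooth_step_0 smooth_step_1 split: if_splits\<close>)
  qed
qed

lemma homotopic_if_pullback_eq:
  assumes X: "diffeological_space X" and f: "smooth_map X B\<Gamma> f" and g: "smooth_map X B\<Gamma> g"
    and eq: "pullback_structure X \<Gamma> f universal_structure = pullback_structure X \<Gamma> g universal_structure"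
  shows "smoothly_homotopic X B\<Gamma> f g"
proof -
  note B = diffeological_space_B\<Gamma>
  have e: "equivalent_cocycles X \<Gamma> (pullback_cocycle X f universal_cocycle) (pullback_cocycle X g universal_cocycle)"
    using eq structure_of_eq_iff[OF X is_cocycle_pullback[OF B X f is_cocycle_universal]
        is_cocycle_pullback[OF B X g is_cocycle_universal]]
    by (simp add: universal_structure_def pullback_structure_of[OF X B f is_cocycle_universal]
        pullback_structure_of[OF X B g is_cocycle_universal])
  define \<sigma> \<rho> :: "nat \<Rightarrow> nat" where "\<sigma> n = 2 * n + 1" and "\<rho> n = 2 * n + 2" for n
  have \<sigma>: "inj \<sigma>" "\<And>n. \<sigma> n > n" and \<rho>: "inj \<rho>" "\<And>n. \<rho> n > n"
    by (auto simp: \<sigma>_def \<rho>_def inj_def)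
  have "range \<sigma> \<inter> range \<rho> = {}" unfolding \<sigma>_def[abs_def] \<rho>_def[abs_def] by auto presburger
  then have "smoothly_homotopic X B\<Gamma> (spread \<sigma> f) (spread \<rho> g)"
    by (rule spread_join_homotopic[OF X f g e \<sigma>(1) \<rho>(1)])
  with spread_homotopic[OF X f \<sigma>] spread_homotopic[OF X g \<rho>] show ?thesis
    using smoothly_homotopic_sym[OF X] smoothly_homotopic_trans[OF X B] by blast
qed

section \<open>The classification theorem\<close>

lemma pullback_cylinder_end:
  assumes X: "diffeological_space X" and Y: "diffeological_space Y"
    and H: "smooth_map (prod_diffeology X unit_interval) Y H" and S: "S \<in> gamma_structures Y \<Gamma>"
    and f: "smooth_map X Y f" "\<And>x. x \<in> pts X \<Longrightarrow> H (x, s) = f x" and s: "s \<in> {0..1}"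
  shows "pullback_structure X \<Gamma> (\<lambda>x. (x, s)) (pullback_structure (prod_diffeology X unit_interval) \<Gamma> H S) =
    pullback_structure X \<Gamma> f S"
  unfolding pullback_structure_compose[OF X diffeological_space_cylinder[OF X] Y
      smooth_map_cylinder_slice[OF X s] H S]
  by (rule pullback_structure_cong[OF X Y _ f(1) S f(2)])
    (rule smooth_map_compose[OF smooth_map_cylinder_slice[OF X s] H])

text \<open>
  The pullback along the homotopy is the concordance. Numerability of pullbacks is required once on
  spaces with the points of \<open>X\<close> and once on spaces with the points of a cylinder, since a
  hypothesis is monomorphic.
\<close>

lemma concordant_if_homotopic:
  assumes X: "diffeological_space X" and Y: "diffeological_space Y" and S: "S \<in> gamma_structures Y \<Gamma>"
    and num: "\<And>(Z :: 'x diffeology) h. diffeological_space Z \<Longrightarrow> smooth_map Z Y h \<Longrightarrow>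
      smoothly_numerable Z \<Gamma> (pullback_structure Z \<Gamma> h S)"
      "\<And>(Z :: ('x \<times> real) diffeology) h. diffeological_space Z \<Longrightarrow> smooth_map Z Y h \<Longrightarrow>
      smoothly_numerable Z \<Gamma> (pullback_structure Z \<Gamma> h S)"
    and f: "smooth_map (X :: 'x diffeology) Y f" and g: "smooth_map X Y g"
    and h: "smoothly_homotopic X Y f g"
  shows "smoothly_numerably_concordant X \<Gamma> (pullback_structure X \<Gamma> f S) (pullback_structure X \<Gamma> g S)"
proof -
  let ?C = "prod_diffeology X unit_interval"
  obtain H where H: "smooth_map ?C Y H" "\<And>x. x \<in> pts X \<Longrightarrow> H (x, 0) = f x" "\<And>x. x \<in> pts X \<Longrightarrow> H (x, 1) = g x"
    using h unfolding smoothly_homotopic_def by blast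
  show ?thesis
    unfolding smoothly_numerably_concordant_def
    using num(1)[OF X f] num(1)[OF X g] num(2)[OF diffeological_space_cylinder[OF X] H(1)]
      pullback_cylinder_end[OF X Y H(1) S f H(2)] pullback_cylinder_end[OF X Y H(1) S g H(3)]
    by (intro conjI exI[of _ "pullback_structure ?C \<Gamma> H S"]) simp_all
qed

lemma universal_in_gamma_structures: "universal_structure \<in> gamma_structures B\<Gamma> \<Gamma>"
  using smoothly_numerable_universal by (simp add: smoothly_numerable_def)

text \<open>
  The concordance is the pullback along some \<open>F\<close> on the cylinder. The ends of \<open>F\<close> have the same
  pullbacks as \<open>f\<close> and \<open>g\<close>, hence are homotopic to them.
\<close>

lemma homotopic_if_concordant:
  assumes X: "diffeological_space X" and f: "smooth_map X B\<Gamma> f" and g: "smooth_map X B\<Gamma> g"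
    and c: "smoothly_numerably_concordant X \<Gamma>
      (pullback_structure X \<Gamma> f universal_structure) (pullback_structure X \<Gamma> g universal_structure)"
  shows "smoothly_homotopic X B\<Gamma> f g"
proof -
  let ?C = "prod_diffeology X unit_interval"
  note B = diffeological_space_B\<Gamma> and C = diffeological_space_cylinder[OF X]
  obtain S where S: "smoothly_numerable ?C \<Gamma> S"
    "pullback_structure X \<Gamma> (\<lambda>x. (x, 0)) S = pullback_structure X \<Gamma> f universal_structure"
    "pullback_structure X \<Gamma> (\<lambda>x. (x, 1)) S = pullback_structure X \<Gamma> g universal_structure"
    using c unfolding smoothly_numerably_concordant_def by blast
  obtain F where F: "smooth_map ?C B\<Gamma> F" "S = pullback_structure ?C \<Gamma> F universal_structure"
    using smoothly_numerable_classified[OF C S(1)] by blast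
  have F0: "smooth_map X B\<Gamma> (\<lambda>x. F (x, 0))" and F1: "smooth_map X B\<Gamma> (\<lambda>x. F (x, 1))"
    by (rule smooth_map_compose[OF smooth_map_cylinder_slice[OF X] F(1)]; simp)+
  have "smoothly_homotopic X B\<Gamma> (\<lambda>x. F (x, 0)) f"
    by (rule homotopic_if_pullback_eq[OF X F0 f])
      (use pullback_cylinder_end[OF X B F(1) universal_in_gamma_structures F0 refl] S(2) F(2) in simp)
  moreover have "smoothly_homotopic X B\<Gamma> (\<lambda>x. F (x, 1)) g"
    by (rule homotopic_if_pullback_eq[OF X F1 g])
      (use pullback_cylinder_end[OF X B F(1) universal_in_gamma_structures F1 refl] S(3) F(2) in simp)
  moreover have "smoothly_homotopic X B\<Gamma> (\<lambda>x. F (x, 0)) (\<lambda>x. F (x, 1))"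
    by (rule smoothly_homotopicI[OF F(1)]) simp_all
  ultimately show ?thesis
    using smoothly_homotopic_sym[OF X] smoothly_homotopic_trans[OF X B] by blast
qed

lemma classifies_B\<Gamma>: "classifies TYPE('x) \<Gamma> B\<Gamma> universal_structure"
  unfolding classifies_def
proof (intro conjI allI impI)
  show "diffeological_space B\<Gamma>" by (rule diffeological_space_B\<Gamma>)
  show "smoothly_numerable B\<Gamma> \<Gamma> universal_structure" by (rule smoothly_numerable_universal)
  fix X :: "'x diffeology" and h
  assume "diffeological_space X" "smoothly_numerable X \<Gamma> h"
  then show "\<exists>\<eta>. smooth_map X B\<Gamma> \<eta> \<and> h = pullback_structure X \<Gamma> \<eta> universal_structure"
    using smoothly_numerable_classified by blast
next
  fix X :: "'x diffeology" and \<eta>0 \<eta>1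
  assume X: "diffeological_space X" and \<eta>: "smooth_map X B\<Gamma> \<eta>0" "smooth_map X B\<Gamma> \<eta>1"
  show "smoothly_numerably_concordant X \<Gamma> (pullback_structure X \<Gamma> \<eta>0 universal_structure)
      (pullback_structure X \<Gamma> \<eta>1 universal_structure) \<longleftrightarrow> smoothly_homotopic X B\<Gamma> \<eta>0 \<eta>1"
    using homotopic_if_concordant[OF X \<eta>]
      concordant_if_homotopic[OF X diffeological_space_B\<Gamma> universal_in_gamma_structures
        smoothly_numerable_pullback_universal smoothly_numerable_pullback_universal \<eta>]
    by blast
qed

lemma smoothly_homotopic_compose_left:
  assumes h: "smoothly_homotopic X Y f g" and k: "smooth_map Y Z k"
  shows "smoothly_homotopic X Z (\<lambda>x. k (f x)) (\<lambda>x. k (g x))"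
  using h smooth_map_compose[OF _ k] unfolding smoothly_homotopic_def by fastforce

lemma smoothly_homotopic_compose_right:
  assumes f: "smooth_map X Y f" and h: "smoothly_homotopic Y Z g k"
  shows "smoothly_homotopic X Z (\<lambda>x. g (f x)) (\<lambda>x. k (f x))"
proof -
  obtain H where H: "smooth_map (prod_diffeology Y unit_interval) Z H"
    "\<And>y. y \<in> pts Y \<Longrightarrow> H (y, 0) = g y" "\<And>y. y \<in> pts Y \<Longrightarrow> H (y, 1) = k y"
    using h unfolding smoothly_homotopic_def by blast
  have "smooth_map (prod_diffeology X unit_interval) (prod_diffeology Y unit_interval) (\<lambda>z. (f (fst z), snd z))"
    using f by (auto simp: smooth_map_def pts_prod plot_prod_iff o_def image_subset_iff)
  from smooth_map_compose[OF this H(1)] show ?thesis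
    by (rule smoothly_homotopicI) (use H(2,3) smooth_mapD(1)[OF f] in auto)
qed

text \<open>
  Let \<open>\<phi>\<close> and \<open>\<psi>\<close> be classifying maps between \<open>B\<Gamma>\<close> and \<open>B\<close>. The composite \<open>\<phi> \<circ> \<psi>\<close> pulls \<open>\<gamma>\<close>
  back to \<open>\<gamma>\<close>, as the identity does, so it is homotopic to the identity because \<open>B\<close> classifies
  structures on itself. Maps into \<open>B\<close> can therefore be compared after composing with \<open>\<psi>\<close>, where
  the classification by \<open>B\<Gamma>\<close> is available for all types of points.
\<close>

lemma classifies_transfer:
  fixes B :: "'g classifying_point diffeology"
  assumes cl: "classifies TYPE('g classifying_point) \<Gamma> B \<gamma>"
  shows "classifies TYPE('x) \<Gamma> B \<gamma>"
proof -
  note B0 = diffeological_space_B\<Gamma>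
  have B: "diffeological_space B" and \<gamma>: "smoothly_numerable B \<Gamma> \<gamma>"
    and univ: "\<And>(X :: 'g classifying_point diffeology) h. diffeological_space X \<Longrightarrow> smoothly_numerable X \<Gamma> h \<Longrightarrow>
        \<exists>\<eta>. smooth_map X B \<eta> \<and> h = pullback_structure X \<Gamma> \<eta> \<gamma>"
    and conc: "\<And>(X :: 'g classifying_point diffeology) \<eta>0 \<eta>1. diffeological_space X \<Longrightarrow>
        smooth_map X B \<eta>0 \<Longrightarrow> smooth_map X B \<eta>1 \<Longrightarrow>
        smoothly_numerably_concordant X \<Gamma> (pullback_structure X \<Gamma> \<eta>0 \<gamma>) (pullback_structure X \<Gamma> \<eta>1 \<gamma>) \<longleftrightarrow>
         smoothly_homotopic X B \<eta>0 \<eta>1"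
    using cl unfolding classifies_def by blast+
  have \<gamma>S: "\<gamma> \<in> gamma_structures B \<Gamma>" using \<gamma> by (simp add: smoothly_numerable_def)
  obtain \<phi> where \<phi>: "smooth_map B\<Gamma> B \<phi>" "universal_structure = pullback_structure B\<Gamma> \<Gamma> \<phi> \<gamma>"
    using univ[OF B0 smoothly_numerable_universal] by blast
  obtain \<psi> where \<psi>: "smooth_map B B\<Gamma> \<psi>" "\<gamma> = pullback_structure B \<Gamma> \<psi> universal_structure"
    using smoothly_numerable_classified[OF B \<gamma>] by blast
  have pull_\<psi>: "pullback_structure X \<Gamma> \<eta> \<gamma> = pullback_structure X \<Gamma> (\<lambda>x. \<psi> (\<eta> x)) universal_structure"
    if "diffeological_space X" "smooth_map X B \<eta>" for X :: "'y diffeology" and \<eta>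
    using pullback_structure_compose[OF that(1) B B0 that(2) \<psi>(1) universal_in_gamma_structures] \<psi>(2) by simp
  have pull_\<phi>: "pullback_structure X \<Gamma> \<eta> universal_structure = pullback_structure X \<Gamma> (\<lambda>x. \<phi> (\<eta> x)) \<gamma>"
    if "diffeological_space X" "smooth_map X B\<Gamma> \<eta>" for X :: "'y diffeology" and \<eta>
    using pullback_structure_compose[OF that(1) B0 B that(2) \<phi>(1) \<gamma>S] \<phi>(2) by simp
  have num: "smoothly_numerable X \<Gamma> (pullback_structure X \<Gamma> \<eta> \<gamma>)"
    if "diffeological_space X" "smooth_map X B \<eta>" for X :: "'y diffeology" and \<eta>
    unfolding pull_\<psi>[OF that]
    by (rule smoothly_numerable_pullback_universal[OF that(1) smooth_map_compose[OF that(2) \<psi>(1)]])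
  have "smoothly_homotopic B B (\<lambda>b. b) (\<lambda>b. b)"
    by (rule smoothly_homotopicI[OF smooth_map_fst]) simp_all
  from concordant_if_homotopic[OF B B \<gamma>S num num smooth_map_ident smooth_map_ident this]
  have \<gamma>\<gamma>: "smoothly_numerably_concordant B \<Gamma> \<gamma> \<gamma>"
    by (simp add: pullback_structure_ident[OF B \<gamma>S])
  have \<phi>\<psi>: "smooth_map B B (\<lambda>b. \<phi> (\<psi> b))" by (rule smooth_map_compose[OF \<psi>(1) \<phi>(1)])
  have retract: "smoothly_homotopic B B (\<lambda>b. \<phi> (\<psi> b)) (\<lambda>b. b)"
    using conc[OF B \<phi>\<psi> smooth_map_ident] \<gamma>\<gamma>
    unfolding pull_\<phi>[OF B \<psi>(1), symmetric] \<psi>(2)[symmetric] pullback_structure_ident[OF B \<gamma>S] by simp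
  show ?thesis
    unfolding classifies_def
  proof (intro conjI allI impI B \<gamma>)
    fix X :: "'x diffeology" and h
    assume X: "diffeological_space X" and h: "smoothly_numerable X \<Gamma> h"
    obtain \<eta> where \<eta>: "smooth_map X B\<Gamma> \<eta>" "h = pullback_structure X \<Gamma> \<eta> universal_structure"
      using smoothly_numerable_classified[OF X h] by blast
    then show "\<exists>\<eta>. smooth_map X B \<eta> \<and> h = pullback_structure X \<Gamma> \<eta> \<gamma>"
      using pull_\<phi>[OF X \<eta>(1)] smooth_map_compose[OF \<eta>(1) \<phi>(1)] by blast
  next
    fix X :: "'x diffeology" and \<eta>0 \<eta>1
    assume X: "diffeological_space X" and \<eta>0: "smooth_map X B \<eta>0" and \<eta>1: "smooth_map X B \<eta>1"
    show "smoothly_numerably_concordant X \<Gamma> (pullback_structure X \<Gamma> \<eta>0 \<gamma>) (pullback_structure X \<Gamma> \<eta>1 \<gamma>) \<longleftrightarrow>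
        smoothly_homotopic X B \<eta>0 \<eta>1" (is "?conc \<longleftrightarrow> ?hom")
    proof
      assume ?hom
      then show ?conc by (intro concordant_if_homotopic[OF X B \<gamma>S] num \<eta>0 \<eta>1)
    next
      assume ?conc
      then have "smoothly_homotopic X B\<Gamma> (\<lambda>x. \<psi> (\<eta>0 x)) (\<lambda>x. \<psi> (\<eta>1 x))"
        unfolding pull_\<psi>[OF X \<eta>0] pull_\<psi>[OF X \<eta>1]
        by (rule homotopic_if_concordant[OF X smooth_map_compose[OF \<eta>0 \<psi>(1)] smooth_map_compose[OF \<eta>1 \<psi>(1)]])
      then have "smoothly_homotopic X B (\<lambda>x. \<phi> (\<psi> (\<eta>0 x))) (\<lambda>x. \<phi> (\<psi> (\<eta>1 x)))"
        by (rule smoothly_homotopic_compose_left[OF _ \<phi>(1)])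
      moreover note smoothly_homotopic_compose_right[OF \<eta>0 retract]
        smoothly_homotopic_compose_right[OF \<eta>1 retract]
      ultimately show ?hom
        using smoothly_homotopic_sym[OF X] smoothly_homotopic_trans[OF X B] by blast
    qed
  qed
qed

end

theorem theorem3p5:
  fixes \<Gamma> :: "'g groupoid"
  assumes "diffeological_groupoid \<Gamma>"
  shows
    "(\<exists>(B :: 'g classifying_point diffeology) \<gamma>.
        classifies TYPE('g classifying_point) \<Gamma> B \<gamma>) \<and>
     (\<forall>(B :: 'g classifying_point diffeology) \<gamma>.
        classifies TYPE('g classifying_point) \<Gamma> B \<gamma> \<longrightarrow> classifies TYPE('x) \<Gamma> B \<gamma>)"
proof -
  interpret diff_groupoid \<Gamma> by unfold_locales (rule assms)
  show ?thesis using classifies_B\<Gamma> classifies_transfer by blast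
qed

end
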